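(* It is decidable in polynomial time (in the size of the input graph) whether a given DAG $\mathcal{G}$ on vertex set $V$ is structurally identifiable within the class of all DAGs on $V$, i.e. whether every DAG $\mathcal{G}'$ on $V$ with $\mathcal{M}_{\mathcal{G}'}=\mathcal{M}_{\mathcal{G}}$ equals $\mathcal{G}$. It is also decidable in polynomial time whether two given DAGs $\mathcal{G}_1,\mathcal{G}_2$ on the same vertex set are model equivalent, i.e. whether $\mathcal{M}_{\mathcal{G}_1}=\mathcal{M}_{\mathcal{G}_2}$.
   Context: All graphs are finite directed graphs $\mathcal{G}=(V,E)$ without multiple edges, whose edge set $E\subseteq V\times V$ contains every self-loop $i\to i$, $i\in V$. A DAG is a graph with no directed cycle of length greater than one (self-loops are ignored for acyclicity). $\mathbb{R}^E$ is the set of real $V\times V$ matrices $M$ with $m_{ji}=0$ whenever $i\to j\notin E$; a matrix is stable if all its eigenvalues have strictly negative real part; $\mathrm{PD}_V$ is the set of real symmetric positive definite $V\times V$ matrices. The graphical continuous Lyapunov model of $\mathcal{G}$ is $\mathcal{M}_{\mathcal{G}}=\{\Sigma\in\mathrm{PD}_V : M\Sigma+\Sigma M^T+2I=0\text{ for some stable }M\in\mathbb{R}^E\}$. *)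

theory Defs
  imports "Jordan_Normal_Form.Char_Poly"
begin

section \<open>Graphs\<close>

text \<open>The vertex set is \<open>{..<n}\<close>; a pair \<open>(i, j)\<close> in the edge relation is the edge
  \<open>i \<rightarrow> j\<close>.\<close>

definition digraph_on :: "nat \<Rightarrow> nat rel \<Rightarrow> bool" where
  "digraph_on n E \<longleftrightarrow> E \<subseteq> {..<n} \<times> {..<n} \<and> (\<forall>i<n. (i, i) \<in> E)"

definition dag_on :: "nat \<Rightarrow> nat rel \<Rightarrow> bool" where
  "dag_on n E \<longleftrightarrow> digraph_on n E \<and> acyclic (E - Id)"


section \<open>Graphical continuous Lyapunov models\<close>

text \<open>Note the index order: the edge \<open>i \<rightarrow> j\<close> is carried by the entry in row \<open>j\<close> and
  column \<open>i\<close>.\<close>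

definition drift_matrices :: "nat \<Rightarrow> nat rel \<Rightarrow> real mat set" where
  "drift_matrices n E =
     {M \<in> carrier_mat n n. \<forall>i<n. \<forall>j<n. (i, j) \<notin> E \<longrightarrow> M $$ (j, i) = 0}"

definition stable_mat :: "real mat \<Rightarrow> bool" where
  "stable_mat M \<longleftrightarrow> (\<forall>z. eigenvalue (map_mat complex_of_real M) z \<longrightarrow> Re z < 0)"

definition pd_matrices :: "nat \<Rightarrow> real mat set" where
  "pd_matrices n =
     {S \<in> carrier_mat n n. transpose_mat S = S \<and>
        (\<forall>v \<in> carrier_vec n. v \<noteq> 0\<^sub>v n \<longrightarrow> 0 < v \<bullet> (S *\<^sub>v v))}"

definition lyapunov_model :: "nat \<Rightarrow> nat rel \<Rightarrow> real mat set" where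
  "lyapunov_model n E =
     {S \<in> pd_matrices n. \<exists>M \<in> drift_matrices n E.
        stable_mat M \<and> M * S + S * transpose_mat M + 2 \<cdot>\<^sub>m 1\<^sub>m n = 0\<^sub>m n n}"

definition model_equivalent :: "nat \<Rightarrow> nat rel \<Rightarrow> nat rel \<Rightarrow> bool" where
  "model_equivalent n E\<^sub>1 E\<^sub>2 \<longleftrightarrow> lyapunov_model n E\<^sub>1 = lyapunov_model n E\<^sub>2"

definition dag_structurally_identifiable :: "nat \<Rightarrow> nat rel \<Rightarrow> bool" where
  "dag_structurally_identifiable n E \<longleftrightarrow>
     (\<forall>E'. dag_on n E' \<and> lyapunov_model n E' = lyapunov_model n E \<longrightarrow> E' = E)"


section \<open>Deterministic multi-tape Turing machines\<close>

text \<open>Tapes are two-way infinite. States and tape symbols are initial segments of the natural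
  numbers; symbol 0 is the blank. A tape is its content together with the head position.\<close>

datatype head_move = Move_Left | Stay | Move_Right

type_synonym tape = "(int \<Rightarrow> nat) \<times> int"
type_synonym tm_config = "nat \<times> tape list"

record turing_machine =
  num_tapes :: nat
  num_states :: nat
  num_symbols :: nat
  start_state :: nat
  accept_state :: nat
  reject_state :: nat
  trans_fun :: "nat \<Rightarrow> nat list \<Rightarrow> nat \<times> (nat \<times> head_move) list"

text \<open>On states and symbols outside the finite ranges \<open>trans_fun\<close> is unconstrained; a run of
  a well-formed machine never gets there.\<close>

definition wf_tm :: "turing_machine \<Rightarrow> bool" where
  "wf_tm M \<longleftrightarrow>
     1 \<le> num_tapes M \<and> 3 \<le> num_symbols M \<and>
     start_state M < num_states M \<and> accept_state M < num_states M \<and>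
     reject_state M < num_states M \<and> accept_state M \<noteq> reject_state M \<and>
     (\<forall>q < num_states M. \<forall>ss. length ss = num_tapes M \<and> set ss \<subseteq> {..<num_symbols M} \<longrightarrow>
        (case trans_fun M q ss of (q', acts) \<Rightarrow>
           q' < num_states M \<and> length acts = num_tapes M \<and>
           (\<forall>(s, d) \<in> set acts. s < num_symbols M)))"

fun tape_read :: "tape \<Rightarrow> nat" where
  "tape_read (c, h) = c h"

fun head_shift :: "head_move \<Rightarrow> int" where
  "head_shift Move_Left = - 1"
| "head_shift Stay = 0"
| "head_shift Move_Right = 1"

fun tape_act :: "nat \<times> head_move \<Rightarrow> tape \<Rightarrow> tape" where
  "tape_act (s, d) (c, h) = (c(h := s), h + head_shift d)"

fun tm_step :: "turing_machine \<Rightarrow> tm_config \<Rightarrow> tm_config" where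
  "tm_step M (q, ts) =
     (if q = accept_state M \<or> q = reject_state M then (q, ts)
      else case trans_fun M q (map tape_read ts) of
        (q', acts) \<Rightarrow> (q', map2 tape_act acts ts))"

definition bit_symbol :: "bool \<Rightarrow> nat" where
  "bit_symbol b = (if b then 2 else 1)"

definition input_tape :: "bool list \<Rightarrow> tape" where
  "input_tape w =
     (\<lambda>i. if 0 \<le> i \<and> i < int (length w) then bit_symbol (w ! nat i) else 0, 0)"

definition tm_init :: "turing_machine \<Rightarrow> bool list \<Rightarrow> tm_config" where
  "tm_init M w = (start_state M, input_tape w # replicate (num_tapes M - 1) (\<lambda>_. 0, 0))"

text \<open>Only inputs encoding an instance matter. Since \<open>tm_step\<close> leaves halted configurations
  unchanged, being in a halting state after exactly \<open>t\<close> steps means having halted within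
  \<open>t\<close> steps.\<close>

definition poly_time_decidable ::
  "('a \<Rightarrow> bool list) \<Rightarrow> 'a set \<Rightarrow> ('a \<Rightarrow> bool) \<Rightarrow> bool" where
  "poly_time_decidable enc Inst P \<longleftrightarrow>
     (\<exists>M (p :: nat poly). wf_tm M \<and>
        (\<forall>x \<in> Inst.
           fst ((tm_step M ^^ poly p (length (enc x))) (tm_init M (enc x))) =
             (if P x then accept_state M else reject_state M)))"


section \<open>Graphs as inputs\<close>

text \<open>The number of vertices in unary, a separator, and the adjacency matrices row by row.
  The length is polynomially equivalent to the number of vertices, hence also to the number
  of vertices plus edges.\<close>

definition adjacency_bits :: "nat \<Rightarrow> nat rel \<Rightarrow> bool list" where
  "adjacency_bits n E = concat (map (\<lambda>i. map (\<lambda>j. (i, j) \<in> E) [0..<n]) [0..<n])"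

fun encode_graph :: "nat \<times> nat rel \<Rightarrow> bool list" where
  "encode_graph (n, E) = replicate n True @ [False] @ adjacency_bits n E"

fun encode_graph_pair :: "nat \<times> nat rel \<times> nat rel \<Rightarrow> bool list" where
  "encode_graph_pair (n, E\<^sub>1, E\<^sub>2) =
     replicate n True @ [False] @ adjacency_bits n E\<^sub>1 @ adjacency_bits n E\<^sub>2"

end

theory Submission
  imports Defs
begin

text \<open>For positive definite \<open>s\<close> the Lyapunov equation alone forces the drift matrix to be stable, so
  membership in a model is solvability of a linear system. Setting the covariance to the identity
  outside a vertex subset shows that equivalent graphs have equivalent induced subgraphs; explicit
  covariance matrices on at most four vertices then show that equivalent DAGs have the same
  skeleton and that they can differ only in edges \<open>i \<rightarrow> j\<close> whose end points have the same closed
  neighbourhood and meet further local conditions. Conversely, when the other parents and children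
  of \<open>i\<close> and \<open>j\<close> agree as well, an explicit change of the drift matrix shows that reversing the edge
  preserves the model, and any two DAGs satisfying the local criterion are joined by such reversals. In
  particular a DAG is not identifiable iff it has a reversible edge. Both criteria are first-order
  sentences about the adjacency relation, hence decidable in polynomial time by a Turing machine
  that loops over all values of the quantified vertices.\<close>

section \<open>Lyapunov models and reversal of an edge\<close>

text \<open>For fixed \<open>s\<close> the solutions of the Lyapunov equation are
  \<open>m = (K - I) s^-1\<close> with \<open>K\<close> skew-symmetric, so only \<open>K\<close> is
  free, and the graph prescribes zeros of \<open>m\<close>. Trading an edge for its reversal means
  changing \<open>K\<close> so that one entry of \<open>m\<close> vanishes and no forbidden entry
  appears. The obstacle is that \<open>s^-1\<close> is usually full, so a change of \<open>K\<close>
  tends to spread over all of \<open>m\<close>. The local conditions prevent this: let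
  \<open>W\<close> consist of the end points of the edge and their common parents, and
  \<open>C\<close> of their other common children. Then all edges from \<open>W\<close> to
  \<open>C\<close> are present, \<open>W\<close> is ancestral, and no edge leads from
  \<open>W\<close> or \<open>C\<close> to the remaining vertices. Hence the remaining vertices are
  uncorrelated with \<open>W\<close>, and a suitable rank two change of \<open>K\<close> touches
  only entries that carry edges. Covariances and drifts are functions on an arbitrary finite vertex
  set, so that passing to an induced subgraph is a mere change of the index set.\<close>

definition pos_def :: "nat set \<Rightarrow> (nat \<Rightarrow> nat \<Rightarrow> real) \<Rightarrow> bool" where
  "pos_def V s \<longleftrightarrow> (\<forall>i\<in>V. \<forall>j\<in>V. s i j = s j i) \<and>
     (\<forall>v. (\<exists>i\<in>V. v i \<noteq> 0) \<longrightarrow> 0 < (\<Sum>i\<in>V. \<Sum>j\<in>V. v i * s i j * v j))"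

definition supported :: "nat set \<Rightarrow> nat rel \<Rightarrow> (nat \<Rightarrow> nat \<Rightarrow> real) \<Rightarrow> bool" where
  "supported V E m \<longleftrightarrow> (\<forall>i\<in>V. \<forall>j\<in>V. (i, j) \<notin> E \<longrightarrow> m j i = 0)"

definition lyap_eq :: "nat set \<Rightarrow> (nat \<Rightarrow> nat \<Rightarrow> real) \<Rightarrow> (nat \<Rightarrow> nat \<Rightarrow> real) \<Rightarrow> bool" where
  "lyap_eq V m s \<longleftrightarrow> (\<forall>i\<in>V. \<forall>j\<in>V.
     (\<Sum>k\<in>V. m i k * s k j) + (\<Sum>k\<in>V. s i k * m j k) = (if i = j then - 2 else 0))"

definition lyap_model :: "nat set \<Rightarrow> nat rel \<Rightarrow> (nat \<Rightarrow> nat \<Rightarrow> real) \<Rightarrow> bool" where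
  "lyap_model V E s \<longleftrightarrow> pos_def V s \<and> (\<exists>m. supported V E m \<and> lyap_eq V m s)"

lemma pos_defD:
  "pos_def V s \<Longrightarrow> i \<in> V \<Longrightarrow> v i \<noteq> 0 \<Longrightarrow> 0 < (\<Sum>i\<in>V. \<Sum>j\<in>V. v i * s i j * v j)"
  "pos_def V s \<Longrightarrow> i \<in> V \<Longrightarrow> j \<in> V \<Longrightarrow> s i j = s j i"
  unfolding pos_def_def by blast+

lemma lyap_eqD:
  "lyap_eq V m s \<Longrightarrow> i \<in> V \<Longrightarrow> j \<in> V \<Longrightarrow>
     (\<Sum>k\<in>V. m i k * s k j) + (\<Sum>k\<in>V. s i k * m j k) = (if i = j then - 2 else 0)"
  unfolding lyap_eq_def by blast

lemma supportedD: "supported V E m \<Longrightarrow> i \<in> V \<Longrightarrow> j \<in> V \<Longrightarrow> (i, j) \<notin> E \<Longrightarrow> m j i = 0"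
  unfolding supported_def by blast

text \<open>The matrix \<open>m s\<close> and its transpose \<open>s m^T\<close> have the same
  quadratic form, and their sum is \<open>- 2 I\<close>. Both sign results below,
  \<open>diag_neg\<close> and stability, come from this identity.\<close>

lemma lyap_quadratic:
  assumes fin: "finite V" and sym: "pos_def V s" and eq: "lyap_eq V m s"
  shows "(\<Sum>i\<in>V. \<Sum>k\<in>V. v i * m i k * (\<Sum>j\<in>V. s k j * v j)) = - (\<Sum>i\<in>V. (v i)\<^sup>2)"
proof -
  let ?Q = "\<Sum>i\<in>V. \<Sum>k\<in>V. v i * m i k * (\<Sum>j\<in>V. s k j * v j)"
  have Q1: "?Q = (\<Sum>i\<in>V. \<Sum>j\<in>V. v i * v j * (\<Sum>k\<in>V. m i k * s k j))"
  proof (rule sum.cong[OF refl])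
    fix i
    have "(\<Sum>k\<in>V. v i * m i k * (\<Sum>j\<in>V. s k j * v j)) =
        (\<Sum>k\<in>V. \<Sum>j\<in>V. v i * v j * (m i k * s k j))"
      by (simp add: sum_distrib_left mult_ac)
    also have "\<dots> = (\<Sum>j\<in>V. \<Sum>k\<in>V. v i * v j * (m i k * s k j))" by (rule sum.swap)
    finally show "(\<Sum>k\<in>V. v i * m i k * (\<Sum>j\<in>V. s k j * v j)) =
        (\<Sum>j\<in>V. v i * v j * (\<Sum>k\<in>V. m i k * s k j))"
      by (simp add: sum_distrib_left)
  qed
  have Q2: "?Q = (\<Sum>i\<in>V. \<Sum>j\<in>V. v i * v j * (\<Sum>k\<in>V. s i k * m j k))"
    unfolding Q1
    by (subst sum.swap) (intro sum.cong refl, simp add: mult_ac pos_defD(2)[OF sym] cong: sum.cong)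
  have "2 * ?Q = (\<Sum>i\<in>V. \<Sum>j\<in>V. v i * v j * (\<Sum>k\<in>V. m i k * s k j)) +
      (\<Sum>i\<in>V. \<Sum>j\<in>V. v i * v j * (\<Sum>k\<in>V. s i k * m j k))"
    using Q1 Q2 by linarith
  also have "\<dots> = (\<Sum>i\<in>V. \<Sum>j\<in>V. v i * v j *
      ((\<Sum>k\<in>V. m i k * s k j) + (\<Sum>k\<in>V. s i k * m j k)))"
    by (simp add: sum.distrib distrib_left)
  also have "\<dots> = (\<Sum>i\<in>V. \<Sum>j\<in>V. if j = i then - 2 * (v i)\<^sup>2 else 0)"
    by (intro sum.cong refl) (auto simp: lyap_eqD[OF eq] power2_eq_square)
  also have "\<dots> = - 2 * (\<Sum>i\<in>V. (v i)\<^sup>2)"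
    using fin by (simp add: sum.delta sum_distrib_left)
  finally show ?thesis by linarith
qed

text \<open>Principal submatrices of a positive definite matrix are invertible. The induction adds
  one vertex at a time, as in block elimination; since \<open>p\<close> vanishes off
  \<open>W\<close>, the sum over \<open>V\<close> is the product with the submatrix.\<close>

lemma pos_def_solve:
  assumes fin: "finite V" and pd: "pos_def V s" and sub: "W \<subseteq> V"
  shows "\<exists>p. (\<forall>k. k \<notin> W \<longrightarrow> p k = 0) \<and> (\<forall>w\<in>W. (\<Sum>l\<in>V. s w l * p l) = b w)"
proof -
  have "finite W" using fin sub finite_subset by blast
  then show ?thesis using sub
  proof (induction W arbitrary: b rule: finite_induct)
    case empty
    show ?case by (intro exI[of _ "\<lambda>_. 0"]) simp
  next
    case (insert w W)
    obtain p where p: "\<And>k. k \<notin> W \<Longrightarrow> p k = 0" "\<And>u. u \<in> W \<Longrightarrow> (\<Sum>l\<in>V. s u l * p l) = b u"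
      using insert.IH[of b] insert.prems by blast
    obtain q where q: "\<And>k. k \<notin> W \<Longrightarrow> q k = 0" "\<And>u. u \<in> W \<Longrightarrow> (\<Sum>l\<in>V. s u l * q l) = s u w"
      using insert.IH[of "\<lambda>u. s u w"] insert.prems by blast
    \<comment> \<open>\<open>s z\<close> vanishes on \<open>W\<close> and is positive at \<open>w\<close>, so adding a multiple of \<open>z\<close> repairs the new equation.\<close>
    define z where "z k = (if k = w then 1 else 0) - q k" for k
    define y where "y u = (\<Sum>l\<in>V. s u l * z l)" for u
    have y_eq: "y u = s u w - (\<Sum>l\<in>V. s u l * q l)" for u
    proof -
      have "y u = (\<Sum>l\<in>V. (if l = w then s u l else 0) - s u l * q l)"
        unfolding y_def z_def by (intro sum.cong) (auto simp: algebra_simps)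
      then show ?thesis using fin insert.prems by (simp add: sum_subtractf sum.delta)
    qed
    have y0: "y u = 0" if "u \<in> W" for u using y_eq q(2) that by simp
    have zw: "z w = 1" using q(1) insert.hyps unfolding z_def by simp
    have z0: "z k = 0" if "k \<notin> insert w W" for k using q(1) that unfolding z_def by simp
    \<comment> \<open>\<open>z\<close> lives on \<open>insert w W\<close>, where \<open>y\<close>
      vanishes except at \<open>w\<close>, and \<open>z w = 1\<close>. So the pivot
      \<open>y w\<close>, a Schur complement, is the value of the quadratic form at
      \<open>z\<close>.\<close>
    have "0 < (\<Sum>i\<in>V. \<Sum>j\<in>V. z i * s i j * z j)"
      using pos_defD(1)[OF pd, of w z] insert.prems zw by simp
    also have "\<dots> = (\<Sum>i\<in>V. z i * y i)"
      unfolding y_def by (simp add: sum_distrib_left mult.assoc)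
    also have "\<dots> = (\<Sum>i\<in>V. if i = w then y w else 0)"
      by (intro sum.cong refl) (use zw z0 y0 in auto)
    also have "\<dots> = y w" using fin insert.prems by (simp add: sum.delta)
    finally have yw: "y w > 0" .
    define t where "t = (b w - (\<Sum>l\<in>V. s w l * p l)) / y w"
    have lin: "(\<Sum>l\<in>V. s u l * (p l + t * z l)) = (\<Sum>l\<in>V. s u l * p l) + t * y u" for u
      unfolding y_def by (simp add: sum.distrib distrib_left sum_distrib_left mult_ac)
    show ?case
    proof (intro exI[of _ "\<lambda>k. p k + t * z k"] conjI allI impI ballI)
      show "p k + t * z k = 0" if "k \<notin> insert w W" for k using p(1) z0 that by simp
      show "(\<Sum>l\<in>V. s u l * (p l + t * z l)) = b u" if "u \<in> insert w W" for u
        unfolding lin using that p(2) y0 yw by (auto simp: t_def)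
    qed
  qed
qed

section \<open>Acyclic graphs: signs of diagonal entries, independence of ancestral sets\<close>

lemma finite_acyclic_rank:
  assumes "finite r" "acyclic (r :: ('a \<times> 'a) set)"
  obtains f :: "'a \<Rightarrow> nat" where "\<And>a b. (a, b) \<in> r \<Longrightarrow> f a < f b"
proof
  fix a b assume ab: "(a, b) \<in> r"
  \<comment> \<open>The rank counts proper ancestors; along an edge at least the source is added to
    the set.\<close>
  have "finite {u. (u, b) \<in> r\<^sup>+}"
  proof (rule finite_subset)
    show "{u. (u, b) \<in> r\<^sup>+} \<subseteq> Domain r" by (auto dest: tranclD)
    show "finite (Domain r)" using assms(1) by (simp add: finite_Domain)
  qed
  moreover have "{u. (u, a) \<in> r\<^sup>+} \<subset> {u. (u, b) \<in> r\<^sup>+}"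
    using ab assms(2) by (auto simp: acyclic_def intro: trancl_into_trancl)
  ultimately show "card {u. (u, a) \<in> r\<^sup>+} < card {u. (u, b) \<in> r\<^sup>+}"
    by (rule psubset_card_mono)
qed

locale ranked =
  fixes V :: "nat set" and E :: "nat rel" and f :: "nat \<Rightarrow> nat"
  assumes fin: "finite V"
    and rank: "\<And>a b. (a, b) \<in> E \<Longrightarrow> a \<noteq> b \<Longrightarrow> f a < f b"
begin

text \<open>The quadratic identity is tested with a \<open>p\<close> supported on \<open>B\<close>,
  the vertices of lower rank and \<open>v\<close>, such that \<open>s p\<close> restricted to
  \<open>B\<close> is the unit vector at \<open>v\<close>. Edges into \<open>B\<close> start in
  \<open>B\<close>, and \<open>v\<close> has no edge to another vertex of \<open>B\<close>, so the
  double sum collapses to \<open>p v * m v v\<close>. It equals minus the squared norm of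
  \<open>p\<close>, while \<open>p v\<close> is the value of the form of \<open>s\<close> at
  \<open>p\<close>, hence positive.\<close>

lemma diag_neg:
  assumes pd: "pos_def V s" and sup: "supported V E m" and eq: "lyap_eq V m s" and v: "v \<in> V"
  shows "m v v < 0"
proof -
  define B where "B = {u \<in> V. f u < f v \<or> u = v}"
  obtain p where p: "\<And>k. k \<notin> B \<Longrightarrow> p k = 0"
      "\<And>w. w \<in> B \<Longrightarrow> (\<Sum>l\<in>V. s w l * p l) = (if w = v then 1 else 0)"
    using pos_def_solve[OF fin pd, of B "\<lambda>w. if w = v then 1 else 0"] unfolding B_def by auto
  define y where "y k = (\<Sum>j\<in>V. s k j * p j)" for k
  have vB: "v \<in> B" using v by (simp add: B_def)
  have yv: "y v = 1" using p(2)[OF vB] by (simp add: y_def)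
  have pnz: "\<exists>i\<in>V. p i \<noteq> 0"
  proof (rule ccontr)
    assume "\<not> ?thesis"
    then have "y v = 0" unfolding y_def by simp
    then show False using yv by simp
  qed
  have py: "(\<Sum>i\<in>V. p i * y i) = p v"
  proof -
    have "(\<Sum>i\<in>V. p i * y i) = (\<Sum>i\<in>V. if i = v then p v else 0)"
    proof (intro sum.cong refl)
      fix i show "p i * y i = (if i = v then p v else 0)"
        using p(1)[of i] p(2)[of i] unfolding y_def by (cases "i \<in> B") auto
    qed
    then show ?thesis using fin v by (simp add: sum.delta)
  qed
  have pv: "p v > 0"
  proof -
    obtain i where "i \<in> V" "p i \<noteq> 0" using pnz by blast
    then have "0 < (\<Sum>i\<in>V. \<Sum>j\<in>V. p i * s i j * p j)" by (rule pos_defD(1)[OF pd])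
    also have "\<dots> = (\<Sum>i\<in>V. p i * y i)"
      unfolding y_def by (simp add: sum_distrib_left mult.assoc)
    finally show ?thesis using py by simp
  qed
  have "- (\<Sum>i\<in>V. (p i)\<^sup>2) = (\<Sum>i\<in>V. \<Sum>k\<in>V. p i * m i k * y k)"
    using lyap_quadratic[OF fin pd eq, of p] unfolding y_def by simp
  also have "\<dots> = (\<Sum>i\<in>V. \<Sum>k\<in>V. if k = v then (if i = v then p v * m v v else 0) else 0)"
  proof (intro sum.cong refl)
    fix i k assume i: "i \<in> V" and k: "k \<in> V"
    show "p i * m i k * y k = (if k = v then (if i = v then p v * m v v else 0) else 0)"
    proof (cases "i \<in> B")
      case False
      then show ?thesis using p(1) vB by auto
    next
      case iB: True
      show ?thesis
      proof (cases "k \<in> B")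
        case True
        then have yk: "y k = (if k = v then 1 else 0)" using p(2) by (simp add: y_def)
        have "m i v = 0" if "i \<noteq> v"
        proof -
          have "(v, i) \<notin> E" using that iB rank[of v i] by (auto simp: B_def)
          then show ?thesis using supportedD[OF sup] i v by blast
        qed
        then show ?thesis using yk by auto
      next
        case False
        have "(k, i) \<notin> E" using False iB rank[of k i] k by (cases "k = i") (auto simp: B_def)
        then have "m i k = 0" using supportedD[OF sup] i k by blast
        then show ?thesis using False vB by auto
      qed
    qed
  qed
  also have "\<dots> = p v * m v v" using fin v by (simp add: sum.delta)
  finally have e: "p v * m v v = - (\<Sum>i\<in>V. (p i)\<^sup>2)" by simp
  have "(\<Sum>i\<in>V. (p i)\<^sup>2) > 0"
  proof -
    obtain i where "i \<in> V" "p i \<noteq> 0" using pnz by blast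
    then show ?thesis using fin by (intro sum_pos2[of _ i]) auto
  qed
  then show ?thesis using e pv by (metis mult_less_0_iff neg_less_0_iff_less not_less_iff_gr_or_eq)
qed

text \<open>Besides \<open>s w r\<close>, the equation at \<open>(w, r)\<close> only involves
  covariances in which \<open>w\<close> or \<open>r\<close> is replaced by a proper parent. These
  vanish by induction, which leaves \<open>(m w w + m r r) * s w r = 0\<close> with a negative
  factor.\<close>

lemma independent_blocks:
  assumes pd: "pos_def V s" and sup: "supported V E m" and eq: "lyap_eq V m s"
    and W: "W \<subseteq> V" and R: "R \<subseteq> V" and WR: "W \<inter> R = {}"
    and clW: "\<And>a b. (a, b) \<in> E \<Longrightarrow> a \<in> V \<Longrightarrow> b \<in> W \<Longrightarrow> a \<in> W"
    and clR: "\<And>a b. (a, b) \<in> E \<Longrightarrow> a \<in> V \<Longrightarrow> b \<in> R \<Longrightarrow> a \<in> R"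
  shows "w \<in> W \<Longrightarrow> r \<in> R \<Longrightarrow> s w r = 0"
proof (induction "f w + f r" arbitrary: w r rule: less_induct)
  case less
  have wV: "w \<in> V" and rV: "r \<in> V" and wr: "w \<noteq> r" using less.prems W R WR by auto
  have 1: "(\<Sum>k\<in>V. m w k * s k r) = (\<Sum>k\<in>V. if k = w then m w w * s w r else 0)"
  proof (intro sum.cong refl)
    fix k assume k: "k \<in> V"
    show "m w k * s k r = (if k = w then m w w * s w r else 0)"
    proof (cases "k = w")
      case False
      show ?thesis
      proof (cases "(k, w) \<in> E")
        case True
        then have "f k < f w" "k \<in> W" using rank False clW k less.prems by auto
        then show ?thesis using less.hyps[of k r] less.prems False by simp
      qed (use supportedD[OF sup k wV] False in simp)
    qed simp
  qed
  have 2: "(\<Sum>k\<in>V. s w k * m r k) = (\<Sum>k\<in>V. if k = r then s w r * m r r else 0)"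
  proof (intro sum.cong refl)
    fix k assume k: "k \<in> V"
    show "s w k * m r k = (if k = r then s w r * m r r else 0)"
    proof (cases "k = r")
      case False
      show ?thesis
      proof (cases "(k, r) \<in> E")
        case True
        then have "f k < f r" "k \<in> R" using rank False clR k less.prems by auto
        then show ?thesis using less.hyps[of w k] less.prems False by simp
      qed (use supportedD[OF sup k rV] False in simp)
    qed simp
  qed
  have "(m w w + m r r) * s w r = 0"
  proof -
    have "m w w * s w r + s w r * m r r = 0"
      using lyap_eqD[OF eq wV rV] wr fin wV rV unfolding 1 2 by (simp add: sum.delta)
    then show ?thesis by (simp add: algebra_simps)
  qed
  moreover have "m w w + m r r < 0"
    using diag_neg[OF pd sup eq] wV rV by (simp add: add_neg_neg)
  ultimately show ?case by simp
qed

end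

definition reverse_edge :: "nat \<Rightarrow> nat \<Rightarrow> nat rel \<Rightarrow> nat rel" where
  "reverse_edge i j E = insert (j, i) (E - {(i, j)})"

text \<open>Let \<open>p\<^sub>i\<close> and \<open>p\<^sub>j\<close> be the vectors supported on \<open>W\<close> whose images \<open>x\<^sub>i = s p\<^sub>i\<close> and \<open>x\<^sub>j = s p\<^sub>j\<close> are unit
  vectors on \<open>W\<close>. Adding a multiple of \<open>x\<^sub>i p\<^sub>j\<^sup>T - x\<^sub>j p\<^sub>i\<^sup>T\<close> to the drift matrix changes its product with \<open>s\<close>
  by a multiple of the skew-symmetric matrix \<open>x\<^sub>i x\<^sub>j\<^sup>T - x\<^sub>j x\<^sub>i\<^sup>T\<close>; the multiple is chosen to cancel the
  entry of the edge \<open>i \<rightarrow> j\<close>.\<close>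

lemma lyap_model_reverse_edge:
  assumes rk: "ranked V E f"
    and W: "W \<subseteq> V" and C: "C \<subseteq> V" and WC: "W \<inter> C = {}"
    and ij: "i \<in> W" "j \<in> W" "i \<noteq> j"
    and Wi: "\<And>w. w \<in> W \<Longrightarrow> w \<noteq> j \<Longrightarrow> (w, i) \<in> E"
    and Wj: "\<And>w. w \<in> W \<Longrightarrow> w \<noteq> i \<Longrightarrow> (w, j) \<in> E"
    and WtoC: "\<And>w c. w \<in> W \<Longrightarrow> c \<in> C \<Longrightarrow> (w, c) \<in> E"
    and clW: "\<And>a b. (a, b) \<in> E \<Longrightarrow> a \<in> V \<Longrightarrow> b \<in> W \<Longrightarrow> a \<in> W"
    and clR: "\<And>a b. (a, b) \<in> E \<Longrightarrow> a \<in> V \<Longrightarrow> b \<in> V - W - C \<Longrightarrow> a \<in> V - W - C"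
    and mod: "lyap_model V E s"
  shows "lyap_model V (reverse_edge i j E) s"
proof -
  interpret ranked V E f by (rule rk)
  obtain m where pd: "pos_def V s" and sup: "supported V E m" and eq: "lyap_eq V m s"
    using mod unfolding lyap_model_def by blast
  have iV: "i \<in> V" and jV: "j \<in> V" using ij W by auto
  have "\<forall>a. \<exists>p. (\<forall>k. k \<notin> W \<longrightarrow> p k = 0) \<and>
      (\<forall>w\<in>W. (\<Sum>l\<in>V. s w l * p l) = (if w = a then 1 else 0))"
    by (intro allI pos_def_solve[OF fin pd W])
  from choice[OF this] obtain p where p': "\<forall>a. (\<forall>k. k \<notin> W \<longrightarrow> p a k = 0) \<and>
      (\<forall>w\<in>W. (\<Sum>l\<in>V. s w l * p a l) = (if w = a then 1 else 0))" ..
  have p: "\<And>a k. k \<notin> W \<Longrightarrow> p a k = 0"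
      "\<And>a w. w \<in> W \<Longrightarrow> (\<Sum>l\<in>V. s w l * p a l) = (if w = a then 1 else 0)"
    by (rule p'[rule_format, THEN conjunct1, rule_format], assumption)
      (rule p'[rule_format, THEN conjunct2, rule_format], assumption)
  define x where "x a k = (\<Sum>l\<in>V. s k l * p a l)" for a k
  have xW: "x a w = (if w = a then 1 else 0)" if "w \<in> W" for a w using p(2) that by (simp add: x_def)
  \<comment> \<open>\<open>W\<close> and the rest are disjoint ancestral sets, so \<open>s\<close>
    vanishes between them, and \<open>x a\<close> is a combination of columns of \<open>s\<close>
    indexed by \<open>W\<close>.\<close>
  have xR: "x a r = 0" if "r \<in> V - W - C" for a r
  proof -
    have "s r w = 0" if "w \<in> W" for w
    proof -
      have "s w r = 0"
        by (rule independent_blocks[OF pd sup eq W, of "V - W - C"])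
          (use clW clR that \<open>r \<in> V - W - C\<close> in auto)
      then show ?thesis using pos_defD(2)[OF pd, of w r] W that \<open>r \<in> V - W - C\<close> by auto
    qed
    then have "s r l * p a l = 0" for l using p(1)[of l a] by (cases "l \<in> W") auto
    then show ?thesis unfolding x_def by (intro sum.neutral) blast
  qed
  have pii: "p i i > 0"
  proof -
    have "\<exists>l\<in>V. p i l \<noteq> 0"
    proof (rule ccontr)
      assume "\<not> ?thesis"
      then have "x i i = 0" unfolding x_def by simp
      then show False using xW[OF ij(1), of i] by simp
    qed
    then obtain l where "l \<in> V" "p i l \<noteq> 0" by blast
    then have "0 < (\<Sum>k\<in>V. \<Sum>j\<in>V. p i k * s k j * p i j)" by (rule pos_defD(1)[OF pd])
    also have "\<dots> = (\<Sum>k\<in>V. p i k * x i k)"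
      unfolding x_def by (simp add: sum_distrib_left mult.assoc)
    also have "\<dots> = (\<Sum>k\<in>V. if k = i then p i i else 0)"
    proof (intro sum.cong refl)
      fix k show "p i k * x i k = (if k = i then p i i else 0)"
        using p(1)[of k i] xW[of k i] ij(1) by (cases "k \<in> W") auto
    qed
    finally show ?thesis using fin iV by (simp add: sum.delta)
  qed
  \<comment> \<open>At row \<open>j\<close> and column \<open>i\<close> the added matrix has the
    entry \<open>x i j * p j i - x j j * p i i = - p i i\<close>.\<close>
  define t where "t = m j i / p i i"
  define m' where "m' k l = m k l + t * (x i k * p j l - x j k * p i l)" for k l
  have m'0: "m' j i = 0"
    using xW ij pii unfolding m'_def t_def by simp
  have "supported V (reverse_edge i j E) m'"
    unfolding supported_def
  proof (intro ballI impI)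
    fix l k assume l: "l \<in> V" and k: "k \<in> V" and lk: "(l, k) \<notin> reverse_edge i j E"
    show "m' k l = 0"
    proof (cases "(l, k) = (i, j)")
      case True
      then show ?thesis using m'0 by simp
    next
      case False
      then have E: "(l, k) \<notin> E" and ji: "(l, k) \<noteq> (j, i)" using lk by (auto simp: reverse_edge_def)
      \<comment> \<open>Only columns in \<open>W\<close> and rows in \<open>C\<close> or equal to
        \<open>i\<close> or \<open>j\<close> can change. All these entries carry edges of
        \<open>E\<close>, except that \<open>(j, i)\<close> is the new edge and
        \<open>(i, j)\<close> has just been treated.\<close>
      have "x i k * p j l - x j k * p i l = 0"
      proof (cases "l \<in> W")
        case lW: True
        then have "k \<notin> C" using WtoC E by blast
        moreover have "k \<noteq> i" using Wi lW E ji by blast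
        moreover have "k \<noteq> j" using Wj lW E False by blast
        ultimately show ?thesis using k xW[of k] xR[of k] by (cases "k \<in> W") auto
      qed (simp add: p(1))
      then show ?thesis using supportedD[OF sup l k E] unfolding m'_def by simp
    qed
  qed
  moreover have "lyap_eq V m' s"
    unfolding lyap_eq_def
  proof (intro ballI)
    fix a b assume a: "a \<in> V" and b: "b \<in> V"
    have sx: "(\<Sum>l\<in>V. p c l * s l d) = x c d" if "d \<in> V" for c d
      unfolding x_def by (intro sum.cong refl) (simp add: pos_defD(2)[OF pd] that mult.commute)
    have xs: "(\<Sum>l\<in>V. s d l * p c l) = x c d" for c d by (simp add: x_def)
    have "(\<Sum>k\<in>V. m' a k * s k b) = (\<Sum>k\<in>V. m a k * s k b) + t * (x i a * x j b - x j a * x i b)"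
      unfolding m'_def sx[OF b, symmetric]
      by (simp add: sum.distrib sum_subtractf sum_distrib_left algebra_simps)
    moreover have "(\<Sum>k\<in>V. s a k * m' b k) = (\<Sum>k\<in>V. s a k * m b k) + t * (x i b * x j a - x j b * x i a)"
      unfolding m'_def xs[symmetric, of _ a]
      by (simp add: sum.distrib sum_subtractf sum_distrib_left algebra_simps)
    ultimately show "(\<Sum>k\<in>V. m' a k * s k b) + (\<Sum>k\<in>V. s a k * m' b k) = (if a = b then - 2 else 0)"
      using lyap_eqD[OF eq a b] by (simp add: algebra_simps)
  qed
  ultimately show ?thesis using pd unfolding lyap_model_def by blast
qed

section \<open>Induced subgraphs\<close>

lemma pos_def_mat_iff:
  "S \<in> pd_matrices n \<longleftrightarrow> S \<in> carrier_mat n n \<and> pos_def {..<n} (\<lambda>i j. S $$ (i, j))"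
proof (cases "S \<in> carrier_mat n n")
  case True
  have sym: "transpose_mat S = S \<longleftrightarrow> (\<forall>i\<in>{..<n}. \<forall>j\<in>{..<n}. S $$ (i, j) = S $$ (j, i))"
  proof
    assume S: "transpose_mat S = S"
    show "\<forall>i\<in>{..<n}. \<forall>j\<in>{..<n}. S $$ (i, j) = S $$ (j, i)"
    proof (intro ballI)
      fix i j assume "i \<in> {..<n}" "j \<in> {..<n}"
      then have "transpose_mat S $$ (i, j) = S $$ (j, i)" using True by simp
      then show "S $$ (i, j) = S $$ (j, i)" using S by simp
    qed
  qed (use True in \<open>auto intro!: eq_matI\<close>)
  have quad: "v \<bullet> (S *\<^sub>v v) = (\<Sum>i<n. \<Sum>j<n. v $ i * S $$ (i, j) * v $ j)"
    if "v \<in> carrier_vec n" for v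
  proof -
    have "v \<bullet> (S *\<^sub>v v) = (\<Sum>i<n. v $ i * (\<Sum>j<n. S $$ (i, j) * v $ j))"
      using True that by (auto simp: scalar_prod_def lessThan_atLeast0 intro!: sum.cong)
    then show ?thesis by (simp add: sum_distrib_left mult.assoc)
  qed
  have pos: "(\<forall>v\<in>carrier_vec n. v \<noteq> 0\<^sub>v n \<longrightarrow> 0 < v \<bullet> (S *\<^sub>v v)) \<longleftrightarrow>
    (\<forall>v. (\<exists>i\<in>{..<n}. v i \<noteq> 0) \<longrightarrow> 0 < (\<Sum>i<n. \<Sum>j<n. v i * S $$ (i, j) * v j))" (is "?l = ?r")
  proof
    assume l: ?l
    show ?r
    proof (intro allI impI)
      fix v :: "nat \<Rightarrow> real" assume "\<exists>i\<in>{..<n}. v i \<noteq> 0"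
      then have "vec n v \<noteq> 0\<^sub>v n" by (auto simp: vec_eq_iff)
      then show "0 < (\<Sum>i<n. \<Sum>j<n. v i * S $$ (i, j) * v j)"
        using l quad[of "vec n v"] by auto
    qed
  next
    assume r: ?r
    show ?l
    proof (intro ballI impI)
      fix v :: "real vec" assume v: "v \<in> carrier_vec n" and "v \<noteq> 0\<^sub>v n"
      then have "\<exists>i\<in>{..<n}. v $ i \<noteq> 0" by (auto simp: vec_eq_iff)
      then show "0 < v \<bullet> (S *\<^sub>v v)" using r quad[OF v] by simp
    qed
  qed
  show ?thesis unfolding pd_matrices_def pos_def_def mem_Collect_eq sym pos by (rule refl)
qed (auto simp: pd_matrices_def)

lemma lyap_eq_mat_iff:
  assumes M: "M \<in> carrier_mat n n" and S: "S \<in> carrier_mat n n"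
  shows "M * S + S * transpose_mat M + 2 \<cdot>\<^sub>m 1\<^sub>m n = 0\<^sub>m n n \<longleftrightarrow>
    lyap_eq {..<n} (\<lambda>i j. M $$ (i, j)) (\<lambda>i j. S $$ (i, j))"
proof -
  have "(M * S + S * transpose_mat M + 2 \<cdot>\<^sub>m 1\<^sub>m n) $$ (i, j) =
      (\<Sum>k<n. M $$ (i, k) * S $$ (k, j)) + (\<Sum>k<n. S $$ (i, k) * M $$ (j, k)) +
        (if i = j then 2 else 0)" if "i < n" "j < n" for i j
    using M S that by (auto simp: scalar_prod_def lessThan_atLeast0)
  then show ?thesis
    using M S by (auto simp: mat_eq_iff lyap_eq_def algebra_simps add_eq_0_iff)
qed

text \<open>Let \<open>a\<close> and \<open>b\<close> be the real and imaginary parts of a left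
  eigenvector of \<open>M\<close>. In the sum of the quadratic identities for \<open>a\<close> and
  \<open>b\<close> the terms with \<open>Im z\<close> cancel by symmetry of \<open>s\<close>; what
  remains equates \<open>Re z\<close> times a positive number with a negative number.\<close>

lemma lyap_eq_imp_stable:
  assumes M: "M \<in> carrier_mat n n" and pd: "pos_def {..<n} s"
    and eq: "lyap_eq {..<n} (\<lambda>i j. M $$ (i, j)) s"
  shows "stable_mat M"
  unfolding stable_mat_def
proof (intro allI impI)
  fix z assume ev: "eigenvalue (map_mat complex_of_real M) z"
  let ?M = "map_mat complex_of_real M"
  have cM: "?M \<in> carrier_mat n n" using M by simp
  \<comment> \<open>The quadratic identity applies the vector to \<open>M\<close> from the left, so
    an eigenvector of the transpose is wanted; the characteristic polynomial is the same.\<close>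
  have "eigenvalue (transpose_mat ?M) z"
    using ev cM eigenvalue_root_char_poly[of ?M n z] eigenvalue_root_char_poly[of "transpose_mat ?M" n z]
    by (simp add: char_poly_transpose_mat)
  then obtain u where u: "u \<in> carrier_vec n" "u \<noteq> 0\<^sub>v n" "transpose_mat ?M *\<^sub>v u = z \<cdot>\<^sub>v u"
    using cM unfolding eigenvalue_def eigenvector_def by auto
  have uu: "(\<Sum>i<n. complex_of_real (M $$ (i, k)) * u $ i) = z * u $ k" if k: "k < n" for k
  proof -
    have "(transpose_mat ?M *\<^sub>v u) $ k = (\<Sum>i<n. complex_of_real (M $$ (i, k)) * u $ i)"
      using k M u(1) by (auto simp: scalar_prod_def lessThan_atLeast0)
    then show ?thesis using u k by simp
  qed
  define a where "a k = Re (u $ k)" for k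
  define b where "b k = Im (u $ k)" for k
  have Ma: "(\<Sum>i<n. M $$ (i, k) * a i) = Re z * a k - Im z * b k" if "k < n" for k
    using arg_cong[OF uu[OF that], of Re] by (simp add: a_def b_def)
  have Mb: "(\<Sum>i<n. M $$ (i, k) * b i) = Im z * a k + Re z * b k" if "k < n" for k
    using arg_cong[OF uu[OF that], of Im] by (simp add: a_def b_def algebra_simps)
  define Q where "Q v w = (\<Sum>k<n. v k * (\<Sum>j<n. s k j * w j))" for v w :: "nat \<Rightarrow> real"
  have Qsym: "Q v w = Q w v" for v w
  proof -
    have "Q v w = (\<Sum>k<n. \<Sum>j<n. v k * (s k j * w j))"
      unfolding Q_def by (simp add: sum_distrib_left)
    also have "\<dots> = (\<Sum>j<n. \<Sum>k<n. v k * (s k j * w j))" by (rule sum.swap)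
    also have "\<dots> = (\<Sum>j<n. \<Sum>k<n. w j * (s j k * v k))"
      by (intro sum.cong refl) (simp add: pos_defD(2)[OF pd] mult_ac)
    finally show ?thesis unfolding Q_def by (simp add: sum_distrib_left)
  qed
  have Qpos: "Q v v > 0" if "i < n" "v i \<noteq> 0" for v i
    using pos_defD(1)[OF pd, of i v] that unfolding Q_def by (simp add: sum_distrib_left mult.assoc)
  have Qnn: "Q v v \<ge> 0" for v
  proof (cases "\<exists>i<n. v i \<noteq> 0")
    case True then show ?thesis using Qpos less_imp_le by blast
  qed (simp add: Q_def)
  have quad: "(\<Sum>k<n. (\<Sum>i<n. M $$ (i, k) * v i) * (\<Sum>j<n. s k j * v j)) = - (\<Sum>i<n. (v i)\<^sup>2)" for v
  proof -
    have "(\<Sum>k<n. (\<Sum>i<n. M $$ (i, k) * v i) * (\<Sum>j<n. s k j * v j)) =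
        (\<Sum>k<n. \<Sum>i<n. v i * M $$ (i, k) * (\<Sum>j<n. s k j * v j))"
      by (intro sum.cong refl, subst sum_distrib_right) (simp add: mult.commute)
    also have "\<dots> = (\<Sum>i<n. \<Sum>k<n. v i * M $$ (i, k) * (\<Sum>j<n. s k j * v j))" by (rule sum.swap)
    finally show ?thesis using lyap_quadratic[OF _ pd eq, of v] by simp
  qed
  have "Re z * Q a a - Im z * Q b a = - (\<Sum>i<n. (a i)\<^sup>2)"
    using quad[of a] by (simp add: Ma Q_def sum_subtractf left_diff_distrib sum_distrib_left mult.assoc)
  moreover have "Im z * Q a b + Re z * Q b b = - (\<Sum>i<n. (b i)\<^sup>2)"
    using quad[of b] by (simp add: Mb Q_def sum.distrib distrib_right sum_distrib_left mult.assoc)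
  ultimately have e: "Re z * (Q a a + Q b b) = - ((\<Sum>i<n. (a i)\<^sup>2) + (\<Sum>i<n. (b i)\<^sup>2))"
    using Qsym[of a b] by (simp add: algebra_simps)
  obtain i where i: "i < n" "u $ i \<noteq> 0" using u(1,2) by (auto simp: vec_eq_iff)
  then have ab: "a i \<noteq> 0 \<or> b i \<noteq> 0" by (simp add: a_def b_def complex_eq_iff)
  have "Q a a + Q b b > 0" using ab Qpos[OF i(1)] Qnn by (meson add_nonneg_pos add_pos_nonneg)
  moreover have "(\<Sum>i<n. (a i)\<^sup>2) + (\<Sum>i<n. (b i)\<^sup>2) > 0"
  proof -
    have "(\<Sum>i<n. (v i)\<^sup>2) > 0" if "v i \<noteq> 0" for v :: "nat \<Rightarrow> real"
      using i that by (intro sum_pos2[of _ i]) auto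
    then show ?thesis using ab by (meson add_nonneg_pos add_pos_nonneg sum_nonneg zero_le_power2)
  qed
  ultimately show "Re z < 0"
    using e by (metis mult_less_0_iff neg_less_0_iff_less not_less_iff_gr_or_eq)
qed

lemma lyapunov_model_iff:
  "S \<in> lyapunov_model n E \<longleftrightarrow>
     S \<in> carrier_mat n n \<and> lyap_model {..<n} E (\<lambda>i j. S $$ (i, j))"
proof
  assume "S \<in> lyapunov_model n E"
  then obtain M where S: "S \<in> pd_matrices n" and M: "M \<in> drift_matrices n E"
      and eq: "M * S + S * transpose_mat M + 2 \<cdot>\<^sub>m 1\<^sub>m n = 0\<^sub>m n n"
    unfolding lyapunov_model_def by blast
  have cM: "M \<in> carrier_mat n n" and sup: "supported {..<n} E (\<lambda>i j. M $$ (i, j))"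
    using M by (auto simp: drift_matrices_def supported_def)
  have cS: "S \<in> carrier_mat n n" using S pos_def_mat_iff by blast
  show "S \<in> carrier_mat n n \<and> lyap_model {..<n} E (\<lambda>i j. S $$ (i, j))"
    using S sup cS eq unfolding pos_def_mat_iff lyap_eq_mat_iff[OF cM cS] lyap_model_def by blast
next
  assume "S \<in> carrier_mat n n \<and> lyap_model {..<n} E (\<lambda>i j. S $$ (i, j))"
  then obtain m where S: "S \<in> carrier_mat n n" and pd: "pos_def {..<n} (\<lambda>i j. S $$ (i, j))"
      and sup: "supported {..<n} E m" and eq: "lyap_eq {..<n} m (\<lambda>i j. S $$ (i, j))"
    unfolding lyap_model_def by blast
  define M where "M = mat n n (\<lambda>(i, j). m i j)"
  have M: "M \<in> carrier_mat n n" by (simp add: M_def)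
  have eq': "lyap_eq {..<n} (\<lambda>i j. M $$ (i, j)) (\<lambda>i j. S $$ (i, j))"
    using eq by (simp add: lyap_eq_def M_def)
  have "M \<in> drift_matrices n E"
    using sup by (simp add: drift_matrices_def M_def supported_def)
  then show "S \<in> lyapunov_model n E"
    unfolding lyapunov_model_def
    using pd S lyap_eq_imp_stable[OF M pd eq'] lyap_eq_mat_iff[OF M S] eq' pos_def_mat_iff
    by blast
qed

lemma lyap_model_cong:
  assumes "\<And>i j. i \<in> V \<Longrightarrow> j \<in> V \<Longrightarrow> s i j = s' i j"
  shows "lyap_model V E s = lyap_model V E s'"
  unfolding lyap_model_def pos_def_def lyap_eq_def using assms by (simp cong: sum.cong)

lemma lyapunov_model_eq_iff:
  "lyapunov_model n E = lyapunov_model n E' \<longleftrightarrow>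
     (\<forall>s. lyap_model {..<n} E s = lyap_model {..<n} E' s)"
proof
  assume eq: "lyapunov_model n E = lyapunov_model n E'"
  show "\<forall>s. lyap_model {..<n} E s = lyap_model {..<n} E' s"
  proof
    fix s
    have "lyap_model {..<n} F s \<longleftrightarrow> mat n n (\<lambda>(i, j). s i j) \<in> lyapunov_model n F" for F
      unfolding lyapunov_model_iff by (simp, rule lyap_model_cong) simp
    then show "lyap_model {..<n} E s = lyap_model {..<n} E' s" using eq by simp
  qed
qed (auto simp: lyapunov_model_iff)

section \<open>Covariances that are the identity off a vertex subset\<close>

definition extend_id :: "nat set \<Rightarrow> (nat \<Rightarrow> nat \<Rightarrow> real) \<Rightarrow> nat \<Rightarrow> nat \<Rightarrow> real" where
  "extend_id A s i j = (if i \<in> A \<and> j \<in> A then s i j else if i = j then 1 else 0)"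

text \<open>Downward, the covariance vanishes between \<open>A\<close> and its complement, so the
  equations on \<open>A\<close> only see the block of \<open>m\<close> on \<open>A\<close>. Upward,
  the drift is padded with \<open>- 1\<close> on the diagonal, which solves the equation for the
  identity covariance; this is where the self-loops enter.\<close>

lemma lyap_model_extend_id:
  assumes fin: "finite V" and A: "A \<subseteq> V" and loops: "\<And>v. v \<in> V \<Longrightarrow> (v, v) \<in> E"
  shows "lyap_model V E (extend_id A s) \<longleftrightarrow> lyap_model A E s"
proof -
  have finA: "finite A" using fin A finite_subset by blast
  have restrict: "(\<Sum>k\<in>V. if k \<in> A then g k else 0) = (\<Sum>k\<in>A. g k)" for g :: "nat \<Rightarrow> real"
    using fin A by (simp add: sum.inter_restrict[symmetric] Int_absorb1)
  show ?thesis
  proof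
    assume "lyap_model V E (extend_id A s)"
    then obtain m where pd: "pos_def V (extend_id A s)" and sup: "supported V E m"
        and eq: "lyap_eq V m (extend_id A s)" unfolding lyap_model_def by blast
    have "pos_def A s"
      unfolding pos_def_def
    proof (intro conjI ballI allI impI)
      fix i j assume "i \<in> A" "j \<in> A"
      then show "s i j = s j i"
        using pos_defD(2)[OF pd, of i j] A by (auto simp: extend_id_def)
    next
      fix v :: "nat \<Rightarrow> real" assume "\<exists>i\<in>A. v i \<noteq> 0"
      then obtain i where i: "i \<in> A" "v i \<noteq> 0" by blast
      let ?v = "\<lambda>k. if k \<in> A then v k else 0"
      have "0 < (\<Sum>i\<in>V. \<Sum>j\<in>V. ?v i * extend_id A s i j * ?v j)"
        by (rule pos_defD(1)[OF pd, of i]) (use i A in auto)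
      also have "\<dots> = (\<Sum>i\<in>V. if i \<in> A then (\<Sum>j\<in>V. if j \<in> A then v i * s i j * v j else 0) else 0)"
        by (intro sum.cong refl) (auto simp: extend_id_def intro!: sum.cong)
      finally show "0 < (\<Sum>i\<in>A. \<Sum>j\<in>A. v i * s i j * v j)" by (simp only: restrict)
    qed
    moreover have "supported A E m" using sup A unfolding supported_def by blast
    moreover have "lyap_eq A m s"
      unfolding lyap_eq_def
    proof (intro ballI)
      fix i j assume i: "i \<in> A" and j: "j \<in> A"
      have "(\<Sum>k\<in>V. m i k * extend_id A s k j) = (\<Sum>k\<in>V. if k \<in> A then m i k * s k j else 0)"
        "(\<Sum>k\<in>V. extend_id A s i k * m j k) = (\<Sum>k\<in>V. if k \<in> A then s i k * m j k else 0)"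
        using i j by (auto simp: extend_id_def intro!: sum.cong)
      then show "(\<Sum>k\<in>A. m i k * s k j) + (\<Sum>k\<in>A. s i k * m j k) = (if i = j then - 2 else 0)"
        using lyap_eqD[OF eq subsetD[OF A i] subsetD[OF A j]] by (simp only: restrict)
    qed
    ultimately show "lyap_model A E s" unfolding lyap_model_def by blast
  next
    assume "lyap_model A E s"
    then obtain m where pd: "pos_def A s" and sup: "supported A E m" and eq: "lyap_eq A m s"
      unfolding lyap_model_def by blast
    define m' where "m' i j = (if i \<in> A \<and> j \<in> A then m i j else if i = j then - 1 else 0)" for i j
    have "pos_def V (extend_id A s)"
      unfolding pos_def_def
    proof (intro conjI ballI allI impI)
      fix i j show "extend_id A s i j = extend_id A s j i"
        using pos_defD(2)[OF pd, of i j] by (auto simp: extend_id_def)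
    next
      fix v :: "nat \<Rightarrow> real" assume "\<exists>i\<in>V. v i \<noteq> 0"
      then obtain i where i: "i \<in> V" "v i \<noteq> 0" by blast
      have "(\<Sum>i\<in>V. \<Sum>j\<in>V. v i * extend_id A s i j * v j) =
        (\<Sum>i\<in>V. (if i \<in> A then (\<Sum>j\<in>V. if j \<in> A then v i * s i j * v j else 0) else 0) +
           (if i \<in> A then 0 else (v i)\<^sup>2))"
      proof (rule sum.cong[OF refl])
        fix i assume i: "i \<in> V"
        show "(\<Sum>j\<in>V. v i * extend_id A s i j * v j) =
          (if i \<in> A then (\<Sum>j\<in>V. if j \<in> A then v i * s i j * v j else 0) else 0) +
           (if i \<in> A then 0 else (v i)\<^sup>2)"
        proof (cases "i \<in> A")
          case True
          then show ?thesis by (auto simp: extend_id_def intro!: sum.cong)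
        next
          case False
          then have "(\<Sum>j\<in>V. v i * extend_id A s i j * v j) = (\<Sum>j\<in>V. if j = i then (v i)\<^sup>2 else 0)"
            by (auto simp: extend_id_def power2_eq_square intro!: sum.cong)
          then show ?thesis using False fin i by (simp add: sum.delta)
        qed
      qed
      also have "\<dots> = (\<Sum>i\<in>A. \<Sum>j\<in>A. v i * s i j * v j) + (\<Sum>i\<in>V. if i \<in> A then 0 else (v i)\<^sup>2)"
        by (simp only: sum.distrib restrict)
      also have "\<dots> > 0"
      proof (cases "\<exists>i\<in>A. v i \<noteq> 0")
        case True
        then obtain k where "k \<in> A" "v k \<noteq> 0" by blast
        then have "(\<Sum>i\<in>A. \<Sum>j\<in>A. v i * s i j * v j) > 0" by (rule pos_defD(1)[OF pd])
        moreover have "(\<Sum>i\<in>V. if i \<in> A then 0 else (v i)\<^sup>2) \<ge> 0" by (intro sum_nonneg) simp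
        ultimately show ?thesis by linarith
      next
        case False
        then have "(\<Sum>i\<in>A. \<Sum>j\<in>A. v i * s i j * v j) = 0" by simp
        moreover have "(\<Sum>i\<in>V. if i \<in> A then 0 else (v i)\<^sup>2) > 0"
          using i fin False by (intro sum_pos2[of _ i]) auto
        ultimately show ?thesis by linarith
      qed
      finally show "0 < (\<Sum>i\<in>V. \<Sum>j\<in>V. v i * extend_id A s i j * v j)" .
    qed
    moreover have "supported V E m'"
      using sup loops unfolding supported_def m'_def by auto
    moreover have "lyap_eq V m' (extend_id A s)"
      unfolding lyap_eq_def
    proof (intro ballI)
      fix i j assume i: "i \<in> V" and j: "j \<in> V"
      have 1: "(\<Sum>k\<in>V. m' i k * extend_id A s k j) =
         (if i \<in> A \<and> j \<in> A then (\<Sum>k\<in>A. m i k * s k j) else if i = j then - 1 else 0)"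
      proof (cases "i \<in> A \<and> j \<in> A")
        case True
        then have "(\<Sum>k\<in>V. m' i k * extend_id A s k j) = (\<Sum>k\<in>V. if k \<in> A then m i k * s k j else 0)"
          by (intro sum.cong refl) (auto simp: extend_id_def m'_def)
        then show ?thesis using True by (simp only: restrict) simp
      next
        case False
        have "(\<Sum>k\<in>V. m' i k * extend_id A s k j) =
            (\<Sum>k\<in>V. if k = i then (if i = j then - 1 else 0) else 0)"
        proof (rule sum.cong[OF refl])
          fix k
          show "m' i k * extend_id A s k j = (if k = i then (if i = j then - 1 else 0) else 0)"
            using False unfolding extend_id_def m'_def
            by (cases "i \<in> A"; cases "j \<in> A"; cases "k \<in> A"; cases "k = i"; auto)
        qed
        then show ?thesis using fin i False by (auto simp: sum.delta)
      qed
      have 2: "(\<Sum>k\<in>V. extend_id A s i k * m' j k) =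
         (if i \<in> A \<and> j \<in> A then (\<Sum>k\<in>A. s i k * m j k) else if i = j then - 1 else 0)"
      proof (cases "i \<in> A \<and> j \<in> A")
        case True
        then have "(\<Sum>k\<in>V. extend_id A s i k * m' j k) = (\<Sum>k\<in>V. if k \<in> A then s i k * m j k else 0)"
          by (intro sum.cong refl) (auto simp: extend_id_def m'_def)
        then show ?thesis using True by (simp only: restrict) simp
      next
        case False
        have "(\<Sum>k\<in>V. extend_id A s i k * m' j k) =
            (\<Sum>k\<in>V. if k = i then (if i = j then - 1 else 0) else 0)"
        proof (rule sum.cong[OF refl])
          fix k
          show "extend_id A s i k * m' j k = (if k = i then (if i = j then - 1 else 0) else 0)"
            using False unfolding extend_id_def m'_def
            by (cases "i \<in> A"; cases "j \<in> A"; cases "k \<in> A"; cases "k = i"; auto)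
        qed
        then show ?thesis using fin i False by (auto simp: sum.delta)
      qed
      show "(\<Sum>k\<in>V. m' i k * extend_id A s k j) + (\<Sum>k\<in>V. extend_id A s i k * m' j k) =
          (if i = j then - 2 else 0)"
        unfolding 1 2 using lyap_eqD[OF eq, of i j] by auto
    qed
    ultimately show "lyap_model V E (extend_id A s)" unfolding lyap_model_def by blast
  qed
qed

section \<open>Relabelling the vertices of an induced subgraph\<close>

definition pullback :: "(nat \<Rightarrow> nat) \<Rightarrow> nat rel \<Rightarrow> nat rel" where
  "pullback g E = {(a, b). (g a, g b) \<in> E}"

lemma lyap_model_pullback:
  assumes inj: "inj_on g I"
  shows "lyap_model I (pullback g E) (\<lambda>i j. s (g i) (g j)) \<longleftrightarrow> lyap_model (g ` I) E s"
proof -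
  have reindex: "(\<Sum>k\<in>g ` I. h k) = (\<Sum>k\<in>I. h (g k))" for h :: "nat \<Rightarrow> real"
    using inj by (simp add: sum.reindex)
  have inv: "inv_into I g (g i) = i" if "i \<in> I" for i using inj that by simp
  show ?thesis
  proof
    assume "lyap_model I (pullback g E) (\<lambda>i j. s (g i) (g j))"
    then obtain m where pd: "pos_def I (\<lambda>i j. s (g i) (g j))" and sup: "supported I (pullback g E) m"
      and eq: "lyap_eq I m (\<lambda>i j. s (g i) (g j))" unfolding lyap_model_def by blast
    let ?m = "\<lambda>a b. m (inv_into I g a) (inv_into I g b)"
    have "pos_def (g ` I) s"
      unfolding pos_def_def reindex
    proof (intro conjI allI impI)
      fix v :: "nat \<Rightarrow> real" assume "\<exists>i\<in>g ` I. v i \<noteq> 0"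
      then obtain i where "i \<in> I" "v (g i) \<noteq> 0" by blast
      then show "0 < (\<Sum>i\<in>I. \<Sum>j\<in>I. v (g i) * s (g i) (g j) * v (g j))"
        using pos_defD(1)[OF pd, of i "\<lambda>i. v (g i)"] by blast
    qed (use pos_defD(2)[OF pd] in auto)
    moreover have "supported (g ` I) E ?m"
      using sup by (auto simp: supported_def pullback_def inv)
    moreover have "lyap_eq (g ` I) ?m s"
      using eq inj_on_eq_iff[OF inj] by (simp add: lyap_eq_def reindex inv cong: sum.cong)
    ultimately show "lyap_model (g ` I) E s" unfolding lyap_model_def by blast
  next
    assume "lyap_model (g ` I) E s"
    then obtain m where pd: "pos_def (g ` I) s" and sup: "supported (g ` I) E m"
      and eq: "lyap_eq (g ` I) m s" unfolding lyap_model_def by blast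
    have "pos_def I (\<lambda>i j. s (g i) (g j))"
      unfolding pos_def_def
    proof (intro conjI allI impI)
      fix v :: "nat \<Rightarrow> real" assume "\<exists>i\<in>I. v i \<noteq> 0"
      then obtain i where i: "i \<in> I" "v i \<noteq> 0" by blast
      show "0 < (\<Sum>i\<in>I. \<Sum>j\<in>I. v i * s (g i) (g j) * v j)"
        using pos_defD(1)[OF pd, of "g i" "\<lambda>a. v (inv_into I g a)"] i
        by (simp add: reindex inv cong: sum.cong)
    qed (use pos_defD(2)[OF pd] in auto)
    moreover have "supported I (pullback g E) (\<lambda>i j. m (g i) (g j))"
      using sup by (auto simp: supported_def pullback_def)
    moreover have "lyap_eq I (\<lambda>i j. m (g i) (g j)) (\<lambda>i j. s (g i) (g j))"
      using eq inj_on_eq_iff[OF inj] by (simp add: lyap_eq_def reindex)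
    ultimately show "lyap_model I (pullback g E) (\<lambda>i j. s (g i) (g j))"
      unfolding lyap_model_def by blast
  qed
qed

text \<open>This lets one fixed matrix on a small index set be tested anywhere in a large graph:
  \<open>s\<close> is carried to the image of \<open>g\<close> and padded by the identity to a
  covariance on \<open>V\<close>, where the two models agree.\<close>

lemma induced_lyap_model_eq:
  assumes fin: "finite V" and inj: "inj_on g I" and sub: "g ` I \<subseteq> V"
    and loops: "\<And>v. v \<in> V \<Longrightarrow> (v, v) \<in> E" "\<And>v. v \<in> V \<Longrightarrow> (v, v) \<in> E'"
    and eq: "\<And>s. lyap_model V E s = lyap_model V E' s"
  shows "lyap_model I (pullback g E) s = lyap_model I (pullback g E') s"
proof -
  let ?s = "\<lambda>a b. s (inv_into I g a) (inv_into I g b)"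
  have "lyap_model I (pullback g F) s = lyap_model (g ` I) F ?s" for F
    unfolding lyap_model_pullback[OF inj, symmetric] using inj by (auto intro!: lyap_model_cong)
  then show ?thesis
    using lyap_model_extend_id[OF fin sub] loops eq by metis
qed

text \<open>The form is the sum of \<open>d k\<close> times the squared entries of
  \<open>L v\<close>. As \<open>L\<close> is upper unitriangular, the entry of \<open>L v\<close> at
  the last nonzero position of \<open>v\<close> equals that entry of \<open>v\<close>, so at least
  one square is positive.\<close>

lemma pos_def_LDL:
  fixes L :: "nat \<Rightarrow> nat \<Rightarrow> real"
  assumes s: "\<And>i j. i < n \<Longrightarrow> j < n \<Longrightarrow> s i j = (\<Sum>k<n. d k * L k i * L k j)"
    and d: "\<And>k. k < n \<Longrightarrow> d k > 0"
    and L1: "\<And>k. k < n \<Longrightarrow> L k k = 1" and L0: "\<And>k l. k < n \<Longrightarrow> l < k \<Longrightarrow> L k l = 0"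
  shows "pos_def {..<n} s"
  unfolding pos_def_def
proof (intro conjI ballI allI impI)
  fix i j assume "i \<in> {..<n}" "j \<in> {..<n}"
  then show "s i j = s j i" by (simp add: s mult_ac)
next
  fix v :: "nat \<Rightarrow> real" assume "\<exists>i\<in>{..<n}. v i \<noteq> 0"
  then obtain i0 where i0: "i0 < n \<and> v i0 \<noteq> 0" by blast
  define i where "i = (GREATEST i. i < n \<and> v i \<noteq> 0)"
  have i: "i < n" "v i \<noteq> 0"
    using GreatestI_nat[of "\<lambda>i. i < n \<and> v i \<noteq> 0", OF i0, of n] unfolding i_def by auto
  have above: "v l = 0" if "i < l" "l < n" for l
  proof (rule ccontr)
    assume "v l \<noteq> 0"
    then have "l \<le> i" unfolding i_def using that by (intro Greatest_le_nat[of _ _ n]) auto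
    then show False using that by simp
  qed
  let ?y = "\<lambda>k. \<Sum>i<n. L k i * v i"
  have "(\<Sum>i<n. \<Sum>j<n. v i * s i j * v j) =
      (\<Sum>i<n. \<Sum>j<n. \<Sum>k<n. d k * ((L k i * v i) * (L k j * v j)))"
    by (intro sum.cong refl) (simp add: s sum_distrib_left sum_distrib_right mult_ac)
  also have "\<dots> = (\<Sum>k<n. \<Sum>i<n. \<Sum>j<n. d k * ((L k i * v i) * (L k j * v j)))"
    by (subst (2) sum.swap, subst sum.swap) simp
  also have "\<dots> = (\<Sum>k<n. d k * (?y k)\<^sup>2)"
    unfolding power2_eq_square sum_product by (simp only: sum_distrib_left)
  also have "\<dots> > 0"
  proof (rule sum_pos2[of _ i])
    have "?y i = (\<Sum>l<n. if l = i then v i else 0)"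
    proof (intro sum.cong refl)
      fix l assume "l \<in> {..<n}"
      then show "L i l * v l = (if l = i then v i else 0)"
        using above[of l] L0[OF i(1), of l] L1[OF i(1)] by (cases l i rule: linorder_cases) auto
    qed
    then have "?y i = v i" using i by (simp add: sum.delta)
    then show "0 < d i * (?y i)\<^sup>2" using d i by simp
    show "0 \<le> d k * (?y k)\<^sup>2" if "k \<in> {..<n}" for k
      using d[of k] that by (simp add: less_imp_le)
  qed (use i in auto)
  finally show "0 < (\<Sum>i<n. \<Sum>j<n. v i * s i j * v j)" .
qed

section \<open>Separating examples on at most four vertices\<close>

definition entries :: "real list list \<Rightarrow> nat \<Rightarrow> nat \<Rightarrow> real" where
  "entries xss i j = xss ! i ! j"

lemma lyap_modelI_LDL:
  fixes L :: "nat \<Rightarrow> nat \<Rightarrow> real"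
  assumes "supported {..<n} E m" "lyap_eq {..<n} m s"
    and "\<forall>i\<in>{..<n}. \<forall>j\<in>{..<n}. s i j = (\<Sum>k<n. d k * L k i * L k j)"
    and "\<forall>k\<in>{..<n}. d k > 0 \<and> L k k = 1"
    and "\<forall>k\<in>{..<n}. \<forall>l\<in>{..<n}. l < k \<longrightarrow> L k l = 0"
  shows "lyap_model {..<n} E s"
  unfolding lyap_model_def using assms by (auto intro!: pos_def_LDL[of n s d L])

lemma all_lt_2: "(\<forall>i\<in>{..<2::nat}. P i) \<longleftrightarrow> P 0 \<and> P 1"
  and all_lt_3: "(\<forall>i\<in>{..<3::nat}. P i) \<longleftrightarrow> P 0 \<and> P 1 \<and> P 2"
  and all_lt_4: "(\<forall>i\<in>{..<4::nat}. P i) \<longleftrightarrow> P 0 \<and> P 1 \<and> P 2 \<and> P 3"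
  by (auto simp: eval_nat_numeral less_Suc_eq)

lemma sum_lt_2: "(\<Sum>i<2::nat. f i) = (f 0 + f 1 :: real)"
  and sum_lt_3: "(\<Sum>i<3::nat. f i) = (f 0 + f 1 + f 2 :: real)"
  and sum_lt_4: "(\<Sum>i<4::nat. f i) = (f 0 + f 1 + f 2 + f 3 :: real)"
  by (simp_all add: eval_nat_numeral)

text \<open>The covariance matrices below were found by computer search, together with a drift matrix
  and the factors of the decomposition \<open>L\<^sup>T D L\<close> that certifies positive definiteness. In the examples on
  four vertices the reversed edge is \<open>0 \<rightarrow> 1\<close>.\<close>

lemma edge_model:
  assumes "{(0, 0), (1, 1), (0, 1)} \<subseteq> E"
  shows "lyap_model {..<2} E (entries [[1, 1], [1, 3]])"
  by (rule lyap_modelI_LDL[where m = "entries [[- 1, 0], [2, - 1]]"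
      and d = "\<lambda>k. [1, 2] ! k"
      and L = "entries [[1, 1], [0, 1]]"])
    (use assms in \<open>simp_all add: lyap_eq_def supported_def entries_def all_lt_2 sum_lt_2\<close>)

text \<open>All refutations below work alike: nonadjacent pairs leave fewer free drift entries than
  there are equations, and linear arithmetic exposes the inconsistency. Only absent edges are
  assumed, so every subgraph is refuted as well. Here the diagonal equations make both diagonal
  entries negative, which forces covariance zero.\<close>

lemma edge_not_isolated_model:
  assumes "{(0, 1), (1, 0)} \<inter> E = {}"
  shows "\<not> lyap_model {..<2} E (entries [[1, 1], [1, 3]])"
proof
  assume "lyap_model {..<2} E (entries [[1, 1], [1, 3]])"
  then obtain m where "supported {..<2} E m" and "lyap_eq {..<2} m (entries [[1, 1], [1, 3]])"
    unfolding lyap_model_def by blast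
  then show False
    using assms by (simp add: lyap_eq_def supported_def entries_def all_lt_2 sum_lt_2) (elim conjE, linarith)
qed

text \<open>A single covariance of the chain \<open>0 -> 1 -> 2\<close> serves against the collider,
  the fork and the reversed chain. As Bayesian networks, chain, fork and reversed chain would be
  indistinguishable.\<close>

lemma chain_model:
  assumes "{(0, 0), (1, 1), (2, 2), (0, 1), (1, 2)} \<subseteq> E"
  shows "lyap_model {..<3} E (entries [[1, 1, 1 / 2], [1, 3, 2], [1 / 2, 2, 3]])"
  by (rule lyap_modelI_LDL[where m = "entries [[- 1, 0, 0], [2, - 1, 0], [0, 1, - 1]]"
      and d = "\<lambda>k. [1, 2, 13 / 8] ! k"
      and L = "entries [[1, 1, 1 / 2], [0, 1, 3 / 4], [0, 0, 1]]"])
    (use assms in \<open>simp_all add: lyap_eq_def supported_def entries_def all_lt_3 sum_lt_3\<close>)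

text \<open>In the collider \<open>0\<close> and \<open>2\<close> have no common ancestor, so their
  covariance would vanish; here it is \<open>1 / 2\<close>.\<close>

lemma chain_not_collider_model:
  assumes "{(0, 2), (1, 0), (1, 2), (2, 0)} \<inter> E = {}"
  shows "\<not> lyap_model {..<3} E (entries [[1, 1, 1 / 2], [1, 3, 2], [1 / 2, 2, 3]])"
proof
  assume "lyap_model {..<3} E (entries [[1, 1, 1 / 2], [1, 3, 2], [1 / 2, 2, 3]])"
  then obtain m where "supported {..<3} E m" and "lyap_eq {..<3} m (entries [[1, 1, 1 / 2], [1, 3, 2], [1 / 2, 2, 3]])"
    unfolding lyap_model_def by blast
  then show False
    using assms by (simp add: lyap_eq_def supported_def entries_def all_lt_3 sum_lt_3) (elim conjE, linarith)
qed

lemma chain_not_fork_model: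
  assumes "{(0, 1), (0, 2), (2, 0), (2, 1)} \<inter> E = {}"
  shows "\<not> lyap_model {..<3} E (entries [[1, 1, 1 / 2], [1, 3, 2], [1 / 2, 2, 3]])"
proof
  assume "lyap_model {..<3} E (entries [[1, 1, 1 / 2], [1, 3, 2], [1 / 2, 2, 3]])"
  then obtain m where "supported {..<3} E m" and "lyap_eq {..<3} m (entries [[1, 1, 1 / 2], [1, 3, 2], [1 / 2, 2, 3]])"
    unfolding lyap_model_def by blast
  then show False
    using assms by (simp add: lyap_eq_def supported_def entries_def all_lt_3 sum_lt_3) (elim conjE, linarith)
qed

lemma chain_not_reverse_model:
  assumes "{(0, 1), (0, 2), (1, 2), (2, 0)} \<inter> E = {}"
  shows "\<not> lyap_model {..<3} E (entries [[1, 1, 1 / 2], [1, 3, 2], [1 / 2, 2, 3]])"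
proof
  assume "lyap_model {..<3} E (entries [[1, 1, 1 / 2], [1, 3, 2], [1 / 2, 2, 3]])"
  then obtain m where "supported {..<3} E m" and "lyap_eq {..<3} m (entries [[1, 1, 1 / 2], [1, 3, 2], [1 / 2, 2, 3]])"
    unfolding lyap_model_def by blast
  then show False
    using assms by (simp add: lyap_eq_def supported_def entries_def all_lt_3 sum_lt_3) (elim conjE, linarith)
qed

text \<open>Used against the collider, in which the ends \<open>0\<close> and \<open>2\<close> would
  be uncorrelated; here their covariance is \<open>2\<close>.\<close>

lemma fork_model:
  assumes "{(0, 0), (1, 1), (2, 2), (1, 0), (1, 2)} \<subseteq> E"
  shows "lyap_model {..<3} E (entries [[3, 1, 2], [1, 1, 1], [2, 1, 3]])"
  by (rule lyap_modelI_LDL[where m = "entries [[- 1, 2, 0], [0, - 1, 0], [0, 2, - 1]]"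
      and d = "\<lambda>k. [3, 2 / 3, 3 / 2] ! k"
      and L = "entries [[1, 1 / 3, 2 / 3], [0, 1, 1 / 2], [0, 0, 1]]"])
    (use assms in \<open>simp_all add: lyap_eq_def supported_def entries_def all_lt_3 sum_lt_3\<close>)

lemma fork_not_collider_model:
  assumes "{(0, 2), (1, 0), (1, 2), (2, 0)} \<inter> E = {}"
  shows "\<not> lyap_model {..<3} E (entries [[3, 1, 2], [1, 1, 1], [2, 1, 3]])"
proof
  assume "lyap_model {..<3} E (entries [[3, 1, 2], [1, 1, 1], [2, 1, 3]])"
  then obtain m where "supported {..<3} E m" and "lyap_eq {..<3} m (entries [[3, 1, 2], [1, 1, 1], [2, 1, 3]])"
    unfolding lyap_model_def by blast
  then show False
    using assms by (simp add: lyap_eq_def supported_def entries_def all_lt_3 sum_lt_3) (elim conjE, linarith)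
qed

text \<open>\<open>2\<close> is a common parent of \<open>0\<close> and \<open>1\<close>, and
  \<open>3\<close> is a child of \<open>2\<close> adjacent to neither: a violation of the third
  clause of \<open>twin_condition\<close>.\<close>

lemma twin_parent_out_model:
  assumes "{(0, 0), (1, 1), (2, 2), (3, 3), (0, 1), (2, 0), (2, 1), (2, 3)} \<subseteq> E"
  shows "lyap_model {..<4} E (entries [[3, 1, 1, 2], [1, 2, 0, 1 / 2], [1, 0, 1, 1], [2, 1 / 2, 1, 3]])"
  by (rule lyap_modelI_LDL[where m = "entries [[- 1, 0, 2, 0], [1, - 1, - 1, 0], [0, 0, - 1, 0], [0, 0, 2, - 1]]"
      and d = "\<lambda>k. [3, 5 / 3, 3 / 5, 3 / 2] ! k"
      and L = "entries [[1, 1 / 3, 1 / 3, 2 / 3], [0, 1, - 1 / 5, - 1 / 10], [0, 0, 1, 1 / 2], [0, 0, 0, 1]]"])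
    (use assms in \<open>simp_all add: lyap_eq_def supported_def entries_def all_lt_4 sum_lt_4\<close>)

lemma twin_parent_out_not_flip_model:
  assumes "{(0, 1), (0, 2), (0, 3), (1, 2), (1, 3), (3, 0), (3, 1), (3, 2)} \<inter> E = {}"
  shows "\<not> lyap_model {..<4} E (entries [[3, 1, 1, 2], [1, 2, 0, 1 / 2], [1, 0, 1, 1], [2, 1 / 2, 1, 3]])"
proof
  assume "lyap_model {..<4} E (entries [[3, 1, 1, 2], [1, 2, 0, 1 / 2], [1, 0, 1, 1], [2, 1 / 2, 1, 3]])"
  then obtain m where "supported {..<4} E m" and "lyap_eq {..<4} m (entries [[3, 1, 1, 2], [1, 2, 0, 1 / 2], [1, 0, 1, 1], [2, 1 / 2, 1, 3]])"
    unfolding lyap_model_def by blast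
  then show False
    using assms by (simp add: lyap_eq_def supported_def entries_def all_lt_4 sum_lt_4) (elim conjE, linarith)
qed

text \<open>The same violation with the outer edge turned round: \<open>3\<close> is now a parent of
  the common parent \<open>2\<close>.\<close>

lemma twin_parent_in_model:
  assumes "{(0, 0), (1, 1), (2, 2), (3, 3), (0, 1), (2, 0), (2, 1), (3, 2)} \<subseteq> E"
  shows "lyap_model {..<4} E (entries [[9, 3, 4, 1], [3, 7 / 2, 1 / 2, 0], [4, 1 / 2, 3, 1], [1, 0, 1, 1]])"
  by (rule lyap_modelI_LDL[where m = "entries [[- 1, 0, 2, 0], [1, - 1, - 1, 0], [0, 0, - 1, 2], [0, 0, 0, - 1]]"
      and d = "\<lambda>k. [9, 5 / 2, 17 / 18, 54 / 85] ! k"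
      and L = "entries [[1, 1 / 3, 4 / 9, 1 / 9], [0, 1, - 1 / 3, - 2 / 15], [0, 0, 1, 8 / 17], [0, 0, 0, 1]]"])
    (use assms in \<open>simp_all add: lyap_eq_def supported_def entries_def all_lt_4 sum_lt_4\<close>)

lemma twin_parent_in_not_flip_model:
  assumes "{(0, 1), (0, 2), (0, 3), (1, 2), (1, 3), (2, 3), (3, 0), (3, 1)} \<inter> E = {}"
  shows "\<not> lyap_model {..<4} E (entries [[9, 3, 4, 1], [3, 7 / 2, 1 / 2, 0], [4, 1 / 2, 3, 1], [1, 0, 1, 1]])"
proof
  assume "lyap_model {..<4} E (entries [[9, 3, 4, 1], [3, 7 / 2, 1 / 2, 0], [4, 1 / 2, 3, 1], [1, 0, 1, 1]])"
  then obtain m where "supported {..<4} E m" and "lyap_eq {..<4} m (entries [[9, 3, 4, 1], [3, 7 / 2, 1 / 2, 0], [4, 1 / 2, 3, 1], [1, 0, 1, 1]])"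
    unfolding lyap_model_def by blast
  then show False
    using assms by (simp add: lyap_eq_def supported_def entries_def all_lt_4 sum_lt_4) (elim conjE, linarith)
qed

text \<open>\<open>2\<close> is a common child of \<open>0\<close> and \<open>1\<close> with a
  further child \<open>3\<close> adjacent to neither. There is no companion example with
  \<open>3 -> 2\<close>, because such an edge does not obstruct the reversal.\<close>

lemma twin_child_out_model:
  assumes "{(0, 0), (1, 1), (2, 2), (3, 3), (0, 1), (0, 2), (1, 2), (2, 3)} \<subseteq> E"
  shows "lyap_model {..<4} E (entries [[1, 1, 0, 0], [1, 3, - 1, - 1], [0, - 1, 2, 5 / 2], [0, - 1, 5 / 2, 6]])"
  by (rule lyap_modelI_LDL[where m = "entries [[- 1, 0, 0, 0], [2, - 1, 0, 0], [1, - 1, - 1, 0], [0, 0, 2, - 1]]"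
      and d = "\<lambda>k. [1, 2, 3 / 2, 17 / 6] ! k"
      and L = "entries [[1, 1, 0, 0], [0, 1, - 1 / 2, - 1 / 2], [0, 0, 1, 4 / 3], [0, 0, 0, 1]]"])
    (use assms in \<open>simp_all add: lyap_eq_def supported_def entries_def all_lt_4 sum_lt_4\<close>)

lemma twin_child_out_not_flip_model:
  assumes "{(0, 1), (0, 3), (1, 3), (2, 0), (2, 1), (3, 0), (3, 1), (3, 2)} \<inter> E = {}"
  shows "\<not> lyap_model {..<4} E (entries [[1, 1, 0, 0], [1, 3, - 1, - 1], [0, - 1, 2, 5 / 2], [0, - 1, 5 / 2, 6]])"
proof
  assume "lyap_model {..<4} E (entries [[1, 1, 0, 0], [1, 3, - 1, - 1], [0, - 1, 2, 5 / 2], [0, - 1, 5 / 2, 6]])"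
  then obtain m where "supported {..<4} E m" and "lyap_eq {..<4} m (entries [[1, 1, 0, 0], [1, 3, - 1, - 1], [0, - 1, 2, 5 / 2], [0, - 1, 5 / 2, 6]])"
    unfolding lyap_model_def by blast
  then show False
    using assms by (simp add: lyap_eq_def supported_def entries_def all_lt_4 sum_lt_4) (elim conjE, linarith)
qed

text \<open>\<open>2\<close> is a common parent and \<open>3\<close> a common child of
  \<open>0\<close> and \<open>1\<close>, not adjacent to each other: a violation of the second
  clause of \<open>twin_condition\<close>.\<close>

lemma twin_mid_model:
  assumes "{(0, 0), (1, 1), (2, 2), (3, 3), (0, 1), (2, 0), (2, 1), (0, 3), (1, 3)} \<subseteq> E"
  shows "lyap_model {..<4} E (entries [[3, 3, 1, 0], [3, 5, 1, - 1], [1, 1, 1, 0], [0, - 1, 0, 2]])"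
  by (rule lyap_modelI_LDL[where m = "entries [[- 1, 0, 2, 0], [1, - 1, 1, 0], [0, 0, - 1, 0], [1, - 1, 0, - 1]]"
      and d = "\<lambda>k. [3, 2, 2 / 3, 3 / 2] ! k"
      and L = "entries [[1, 1, 1 / 3, 0], [0, 1, 0, - 1 / 2], [0, 0, 1, 0], [0, 0, 0, 1]]"])
    (use assms in \<open>simp_all add: lyap_eq_def supported_def entries_def all_lt_4 sum_lt_4\<close>)

lemma twin_mid_not_flip_model:
  assumes "{(0, 1), (0, 2), (1, 2), (2, 3), (3, 0), (3, 1), (3, 2)} \<inter> E = {}"
  shows "\<not> lyap_model {..<4} E (entries [[3, 3, 1, 0], [3, 5, 1, - 1], [1, 1, 1, 0], [0, - 1, 0, 2]])"
proof
  assume "lyap_model {..<4} E (entries [[3, 3, 1, 0], [3, 5, 1, - 1], [1, 1, 1, 0], [0, - 1, 0, 2]])"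
  then obtain m where "supported {..<4} E m" and "lyap_eq {..<4} m (entries [[3, 3, 1, 0], [3, 5, 1, - 1], [1, 1, 1, 0], [0, - 1, 0, 2]])"
    unfolding lyap_model_def by blast
  then show False
    using assms by (simp add: lyap_eq_def supported_def entries_def all_lt_4 sum_lt_4) (elim conjE, linarith)
qed

section \<open>Combinatorial characterisations\<close>

definition adjacent :: "nat rel \<Rightarrow> nat \<Rightarrow> nat \<Rightarrow> bool" where
  "adjacent E a b \<longleftrightarrow> (a, b) \<in> E \<or> (b, a) \<in> E"

text \<open>With self-loops present, the first clause compares closed neighbourhoods. The others
  join parents of \<open>i\<close> to children of \<open>i\<close> and keep edges from leading to
  vertices not adjacent to \<open>i\<close>. Parents may not receive edges from such vertices
  either, whereas children may; hence the asymmetry of the last two clauses.\<close>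

definition twin_condition :: "nat rel \<Rightarrow> nat \<Rightarrow> nat \<Rightarrow> bool" where
  "twin_condition E i j \<longleftrightarrow>
     (\<forall>k. adjacent E k i \<longleftrightarrow> adjacent E k j) \<and>
     (\<forall>u c. (u, i) \<in> E \<and> (i, c) \<in> E \<longrightarrow> adjacent E u c) \<and>
     (\<forall>u r. (u, i) \<in> E \<and> adjacent E u r \<longrightarrow> adjacent E r i) \<and>
     (\<forall>c r. (i, c) \<in> E \<and> (c, r) \<in> E \<longrightarrow> adjacent E r i)"

definition same_skeleton :: "nat rel \<Rightarrow> nat rel \<Rightarrow> bool" where
  "same_skeleton E\<^sub>1 E\<^sub>2 \<longleftrightarrow> (\<forall>a b. adjacent E\<^sub>1 a b \<longleftrightarrow> adjacent E\<^sub>2 a b)"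

definition equivalence_criterion :: "nat rel \<Rightarrow> nat rel \<Rightarrow> bool" where
  "equivalence_criterion E\<^sub>1 E\<^sub>2 \<longleftrightarrow> same_skeleton E\<^sub>1 E\<^sub>2 \<and>
     (\<forall>i j. i \<noteq> j \<and> (i, j) \<in> E\<^sub>1 \<and> (j, i) \<in> E\<^sub>2 \<longrightarrow> twin_condition E\<^sub>1 i j)"

text \<open>In a DAG this is a covered edge in the sense of Bayesian networks (the parents of
  \<open>j\<close> are \<open>i\<close> and the parents of \<open>i\<close>) that also satisfies the
  twin condition.\<close>

definition reversible :: "nat rel \<Rightarrow> nat \<Rightarrow> nat \<Rightarrow> bool" where
  "reversible E i j \<longleftrightarrow> i \<noteq> j \<and> (i, j) \<in> E \<and> twin_condition E i j \<and>
     (\<forall>k. (k, i) \<in> E \<longrightarrow> (k, j) \<in> E) \<and> (\<forall>k. k \<noteq> i \<and> (i, k) \<in> E \<longrightarrow> (j, k) \<in> E)"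

lemma dag_onD:
  assumes "dag_on n E"
  shows "(a, b) \<in> E \<Longrightarrow> a < n" "(a, b) \<in> E \<Longrightarrow> b < n" "i < n \<Longrightarrow> (i, i) \<in> E"
  using assms unfolding dag_on_def digraph_on_def by auto

section \<open>Reversible edges in DAGs\<close>

lemma dag_on_ranked:
  assumes "dag_on n E"
  obtains f where "ranked {..<n} E f"
proof -
  have "finite (E - Id)"
    using assms finite_subset[of E "{..<n} \<times> {..<n}"] unfolding dag_on_def digraph_on_def by auto
  then obtain f :: "nat \<Rightarrow> nat" where f: "\<And>a b. (a, b) \<in> E - Id \<Longrightarrow> f a < f b"
    using finite_acyclic_rank assms unfolding dag_on_def by metis
  have "f a < f b" if "(a, b) \<in> E" "a \<noteq> b" for a b using f[of a b] that by simp
  then have "ranked {..<n} E f" by (rule ranked.intro[OF finite_lessThan])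
  then show thesis by (rule that)
qed

lemma dag_onI_rank:
  assumes "digraph_on n E" and "\<And>a b. (a, b) \<in> E \<Longrightarrow> a \<noteq> b \<Longrightarrow> f a < (f b :: nat)"
  shows "dag_on n E"
proof -
  have "E - Id \<subseteq> measure f" by (rule subrelI) (simp add: assms(2))
  then show ?thesis
    using assms(1) acyclic_subset[OF wf_acyclic[OF wf_measure]] unfolding dag_on_def by blast
qed

text \<open>By the twin condition a parent \<open>k\<close> of \<open>j\<close> is adjacent to
  \<open>i\<close>; as a child of \<open>i\<close> it would also be a child of \<open>j\<close>,
  closing a cycle.\<close>

lemma reversible_neighbours:
  assumes dag: "dag_on n E" and rev: "reversible E i j"
  shows "(k, j) \<in> E \<Longrightarrow> k \<noteq> j \<Longrightarrow> (k, i) \<in> E"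
proof -
  obtain f where "ranked {..<n} E f" using dag_on_ranked[OF dag] .
  then interpret ranked "{..<n}" E f .
  assume kj: "(k, j) \<in> E" "k \<noteq> j"
  show "(k, i) \<in> E"
  proof (cases "k = i")
    case True
    then show ?thesis using kj dag_onD[OF dag] by auto
  next
    case False
    have "adjacent E k i" using kj rev by (auto simp: reversible_def twin_condition_def adjacent_def)
    moreover have "(i, k) \<notin> E"
    proof
      assume "(i, k) \<in> E"
      then have "(j, k) \<in> E" using rev False by (auto simp: reversible_def)
      then show False using rank[of j k] rank[of k j] kj by auto
    qed
    ultimately show ?thesis by (simp add: adjacent_def)
  qed
qed

lemma dag_on_reverse_edge:
  assumes dag: "dag_on n E" and rev: "reversible E i j"
  shows "dag_on n (reverse_edge i j E)"
proof -
  obtain f where "ranked {..<n} E f" using dag_on_ranked[OF dag] .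
  then interpret ranked "{..<n}" E f .
  have ij: "i \<noteq> j" "(i, j) \<in> E" "f i < f j" using rev rank by (auto simp: reversible_def)
  \<comment> \<open>Exchanging the ranks of \<open>i\<close> and \<open>j\<close> is enough: every
    other parent of \<open>j\<close> is a parent of \<open>i\<close>, and every other child of
    \<open>i\<close> is a child of \<open>j\<close>.\<close>
  show ?thesis
  proof (rule dag_onI_rank[where f = "f(i := f j, j := f i)"])
    show "digraph_on n (reverse_edge i j E)"
      using dag ij by (auto simp: dag_on_def digraph_on_def reverse_edge_def)
    fix a b assume ab: "(a, b) \<in> reverse_edge i j E" "a \<noteq> b"
    show "(f(i := f j, j := f i)) a < (f(i := f j, j := f i)) b"
    proof (cases "(a, b) = (j, i)")
      case False
      then have E: "(a, b) \<in> E" and nij: "(a, b) \<noteq> (i, j)" using ab by (auto simp: reverse_edge_def)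
      have "f a < f b" using rank E ab by blast
      moreover have "f a < f i" if "b = j"
        using reversible_neighbours[OF dag rev, of a] rank that E ab nij by auto
      moreover have "f j < f b" if "a = i" using rev rank[of j b] that E ab nij by (auto simp: reversible_def)
      ultimately show ?thesis using ij by (auto simp: False)
    qed (use ij in simp)
  qed
qed

text \<open>Supplies the hypotheses of \<open>lyap_model_reverse_edge\<close>. The loop at
  \<open>j\<close> puts \<open>j\<close> into \<open>W\<close>. The core is that every neighbour of
  a vertex of \<open>W\<close> lies in \<open>W\<close> or \<open>C\<close>, and that no edge leads
  from \<open>C\<close> to the rest.\<close>

lemma reversible_blocks:
  assumes dag: "dag_on n E" and rev: "reversible E i j"
    and W_def: "W = {w. (w, j) \<in> E}" and C_def: "C = {c. (i, c) \<in> E} - {i, j}"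
  shows "W \<subseteq> {..<n}" "C \<subseteq> {..<n}" "W \<inter> C = {}" "i \<in> W" "j \<in> W"
    "\<And>w. w \<in> W \<Longrightarrow> w \<noteq> j \<Longrightarrow> (w, i) \<in> E"
    "\<And>w c. w \<in> W \<Longrightarrow> c \<in> C \<Longrightarrow> (w, c) \<in> E"
    "\<And>a b. (a, b) \<in> E \<Longrightarrow> b \<in> W \<Longrightarrow> a \<in> W"
    "\<And>a b. (a, b) \<in> E \<Longrightarrow> b \<in> {..<n} - W - C \<Longrightarrow> a \<in> {..<n} - W - C"
proof -
  obtain f where "ranked {..<n} E f" using dag_on_ranked[OF dag] .
  then interpret ranked "{..<n}" E f .
  have ij: "i \<noteq> j" "(i, j) \<in> E" and tw: "twin_condition E i j"
    and out: "\<And>k. k \<noteq> i \<Longrightarrow> (i, k) \<in> E \<Longrightarrow> (j, k) \<in> E"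
    using rev by (auto simp: reversible_def)
  have twin: "adjacent E k i \<longleftrightarrow> adjacent E k j" for k using tw by (simp add: twin_condition_def)
  have parent_child: "adjacent E u c" if "(u, i) \<in> E" "(i, c) \<in> E" for u c
    using tw that by (auto simp: twin_condition_def)
  have parent: "adjacent E r i" if "(u, i) \<in> E" "adjacent E u r" for u r
    using tw that by (auto simp: twin_condition_def)
  have child: "adjacent E r i" if "(i, c) \<in> E" "(c, r) \<in> E" for c r
    using tw that by (auto simp: twin_condition_def)
  note Wi = reversible_neighbours[OF dag rev]
  show "W \<subseteq> {..<n}" "C \<subseteq> {..<n}" "i \<in> W" "j \<in> W"
    using dag_onD[OF dag] ij by (auto simp: W_def C_def)
  show WC: "W \<inter> C = {}"
  proof -
    have False if "(w, j) \<in> E" "(i, w) \<in> E" "w \<noteq> i" "w \<noteq> j" for w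
      using out[of w] rank[of w j] rank[of j w] that by auto
    then show ?thesis by (auto simp: W_def C_def)
  qed
  show "(w, i) \<in> E" if "w \<in> W" "w \<noteq> j" for w using Wi that by (auto simp: W_def)
  show WtoC: "(w, c) \<in> E" if w: "w \<in> W" and c: "c \<in> C" for w c
  proof (cases "w = j")
    case True
    then show ?thesis using out c by (auto simp: C_def)
  next
    case False
    then have wi: "(w, i) \<in> E" using Wi w by (auto simp: W_def)
    have ic: "(i, c) \<in> E" "c \<noteq> i" using c by (auto simp: C_def)
    have "(c, w) \<notin> E"
    proof
      assume cw: "(c, w) \<in> E"
      have "c \<noteq> w" using WC w c by blast
      then have "f c < f w" using rank cw by blast
      moreover have "f i < f c" using rank ic by blast
      moreover have "f w \<le> f i" using rank[OF wi] by (cases "w = i") auto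
      ultimately show False by simp
    qed
    then show ?thesis using parent_child[OF wi ic(1)] by (simp add: adjacent_def)
  qed
  have near: "k \<in> W \<union> C" if "adjacent E k i" for k
    using that rev by (auto simp: adjacent_def W_def C_def reversible_def)
  have nearj: "k \<in> W \<union> C" if "adjacent E k j" for k using near twin that by blast
  have nearW: "k \<in> W \<union> C" if "w \<in> W" "adjacent E w k" for w k
  proof (cases "w = j")
    case True
    then show ?thesis using nearj that by (auto simp: adjacent_def)
  next
    case False
    then have "(w, i) \<in> E" using Wi that by (auto simp: W_def)
    then show ?thesis using parent near that by blast
  qed
  show "a \<in> W" if ab: "(a, b) \<in> E" and b: "b \<in> W" for a b
  proof -
    have "a \<in> W \<union> C" using nearW[OF b, of a] ab by (auto simp: adjacent_def)
    moreover have "a \<notin> C"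
    proof
      assume a: "a \<in> C"
      then have "(b, a) \<in> E" "a \<noteq> b" using WtoC b WC by auto
      then show False using rank ab by (metis less_asym)
    qed
    ultimately show ?thesis by blast
  qed
  show "a \<in> {..<n} - W - C" if ab: "(a, b) \<in> E" and b: "b \<in> {..<n} - W - C" for a b
  proof -
    have "a \<notin> W" using nearW[of a b] ab b by (auto simp: adjacent_def)
    moreover have "a \<notin> C"
    proof
      assume "a \<in> C"
      then have "adjacent E b i" using child[of a b] ab by (auto simp: C_def)
      then show False using near b by blast
    qed
    ultimately show ?thesis using dag_onD[OF dag] ab by auto
  qed
qed

text \<open>The construction yields one inclusion. For the other it is applied to the reversed graph
  with \<open>i\<close> and \<open>j\<close> exchanged: \<open>W\<close> and \<open>C\<close> stay
  the same, and reversing twice restores \<open>E\<close>.\<close>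

lemma lyap_model_reversible:
  assumes dag: "dag_on n E" and rev: "reversible E i j"
  shows "lyap_model {..<n} (reverse_edge i j E) s \<longleftrightarrow> lyap_model {..<n} E s"
proof -
  define W where "W = {w. (w, j) \<in> E}"
  define C where "C = {c. (i, c) \<in> E} - {i, j}"
  note blocks = reversible_blocks[OF dag rev W_def C_def]
  have ij: "i \<noteq> j" "(i, j) \<in> E" using rev by (auto simp: reversible_def)
  obtain f where f: "ranked {..<n} E f" using dag_on_ranked[OF dag] .
  obtain f' where f': "ranked {..<n} (reverse_edge i j E) f'"
    using dag_on_ranked[OF dag_on_reverse_edge[OF dag rev]] .
  have "(j, i) \<notin> E" using ranked.rank[OF f] ij by (metis less_asym)
  then have undo: "reverse_edge j i (reverse_edge i j E) = E"
    using ij by (auto simp: reverse_edge_def)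
  show ?thesis
  proof
    assume mod: "lyap_model {..<n} E s"
    show "lyap_model {..<n} (reverse_edge i j E) s"
    proof (rule lyap_model_reverse_edge[OF f blocks(1,2,3,4,5) ij(1) blocks(6) _ blocks(7)])
      show "(w, j) \<in> E" if "w \<in> W" for w using that by (simp add: W_def)
    qed (use blocks(8,9) mod in auto)
  next
    assume mod: "lyap_model {..<n} (reverse_edge i j E) s"
    have "lyap_model {..<n} (reverse_edge j i (reverse_edge i j E)) s"
    proof (rule lyap_model_reverse_edge[OF f' blocks(1,2,3,5,4) ij(1)[symmetric]])
      show "(w, j) \<in> reverse_edge i j E" if "w \<in> W" "w \<noteq> i" for w
        using that by (auto simp: reverse_edge_def W_def)
      show "(w, i) \<in> reverse_edge i j E" if "w \<in> W" "w \<noteq> j" for w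
        using blocks(6)[OF that] ij by (auto simp: reverse_edge_def)
      show "(w, c) \<in> reverse_edge i j E" if "w \<in> W" "c \<in> C" for w c
        using blocks(7)[OF that] that by (auto simp: reverse_edge_def C_def)
      show "a \<in> W" if "(a, b) \<in> reverse_edge i j E" "b \<in> W" for a b
        using blocks(8)[of a b] blocks(5) that by (auto simp: reverse_edge_def)
      show "a \<in> {..<n} - W - C" if "(a, b) \<in> reverse_edge i j E" "b \<in> {..<n} - W - C" for a b
        using blocks(9)[of a b] blocks(4) that by (auto simp: reverse_edge_def)
    qed (rule mod)
    then show "lyap_model {..<n} E s" by (simp only: undo)
  qed
qed

text \<open>Among the edges oriented differently in the two graphs, one of minimal length in a topological
  ranking is reversible: a vertex strictly between its end points would close a directed triangle in
  the second graph.\<close>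

lemma exists_reversible:
  assumes dag: "dag_on n E\<^sub>1" "dag_on n E\<^sub>2" and crit: "equivalence_criterion E\<^sub>1 E\<^sub>2" and ne: "E\<^sub>1 \<noteq> E\<^sub>2"
  obtains i j where "reversible E\<^sub>1 i j" "(j, i) \<in> E\<^sub>2"
proof -
  obtain f where "ranked {..<n} E\<^sub>1 f" using dag_on_ranked[OF dag(1)] .
  then interpret r1: ranked "{..<n}" E\<^sub>1 f .
  obtain g where "ranked {..<n} E\<^sub>2 g" using dag_on_ranked[OF dag(2)] .
  then interpret r2: ranked "{..<n}" E\<^sub>2 g .
  let ?D = "\<lambda>(i, j). i \<noteq> j \<and> (i, j) \<in> E\<^sub>1 \<and> (j, i) \<in> E\<^sub>2"
  have skel: "adjacent E\<^sub>1 a b \<longleftrightarrow> adjacent E\<^sub>2 a b" for a b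
    using crit by (simp add: equivalence_criterion_def same_skeleton_def)
  have "\<exists>e. ?D e"
  proof (rule ccontr)
    assume none: "\<not> ?thesis"
    have "(a, b) \<in> E\<^sub>1 \<longleftrightarrow> (a, b) \<in> E\<^sub>2" for a b
    proof (cases "a = b")
      case True
      then show ?thesis using dag_onD[OF dag(1)] dag_onD[OF dag(2)] by blast
    next
      case False
      then show ?thesis using none skel[of a b] by (fastforce simp: adjacent_def)
    qed
    then show False using ne by auto
  qed
  \<comment> \<open>Pairs satisfying \<open>?D\<close> go up in \<open>f\<close>, so the truncated
    difference is a genuine length.\<close>
  then obtain e where e: "?D e" and min: "\<And>e'. ?D e' \<Longrightarrow> f (snd e) - f (fst e) \<le> f (snd e') - f (fst e')"
    using ex_has_least_nat[of ?D _ "\<lambda>e. f (snd e) - f (fst e)"] by blast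
  obtain i j where [simp]: "e = (i, j)" by fastforce
  have ij: "i \<noteq> j" "(i, j) \<in> E\<^sub>1" "(j, i) \<in> E\<^sub>2" using e by auto
  have tw: "twin_condition E\<^sub>1 i j" using crit ij by (auto simp: equivalence_criterion_def)
  have twin: "adjacent E\<^sub>1 k i \<longleftrightarrow> adjacent E\<^sub>1 k j" for k using tw by (simp add: twin_condition_def)
  have between: False if ik: "(i, k) \<in> E\<^sub>1" and kj: "(k, j) \<in> E\<^sub>1" and k: "k \<noteq> i" "k \<noteq> j" for k
  proof -
    have lt: "f i < f k" "f k < f j" using r1.rank that by auto
    have "\<not> ?D (i, k)" using min[of "(i, k)"] lt by auto
    then have "(i, k) \<in> E\<^sub>2" using skel[of i k] ik k by (auto simp: adjacent_def)
    moreover have "\<not> ?D (k, j)" using min[of "(k, j)"] lt by auto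
    then have "(k, j) \<in> E\<^sub>2" using skel[of k j] kj k by (auto simp: adjacent_def)
    ultimately have "g i < g k" "g k < g j" using r2.rank k by auto
    moreover have "g j < g i" using r2.rank ij by auto
    ultimately show False by simp
  qed
  have "(k, j) \<in> E\<^sub>1" if ki: "(k, i) \<in> E\<^sub>1" for k
  proof (cases "k = i")
    case False
    have "(j, k) \<notin> E\<^sub>1"
    proof
      assume jk: "(j, k) \<in> E\<^sub>1"
      have "f k < f i" "f i < f j" using r1.rank ki False ij by auto
      moreover have "f j \<le> f k" using r1.rank[OF jk] by (cases "j = k") auto
      ultimately show False by simp
    qed
    then show ?thesis using twin[of k] ki by (auto simp: adjacent_def)
  qed (use ij in simp)
  moreover have "(j, k) \<in> E\<^sub>1" if "k \<noteq> i" "(i, k) \<in> E\<^sub>1" for k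
  proof (cases "k = j")
    case True
    then show ?thesis using dag_onD[OF dag(1)] that by blast
  next
    case False
    then show ?thesis using between[of k] twin[of k] that by (auto simp: adjacent_def)
  qed
  ultimately have "reversible E\<^sub>1 i j" using ij tw unfolding reversible_def by blast
  then show thesis using ij that by blast
qed

text \<open>Reversal keeps all adjacencies, so only instances of the twin clauses that use the edge
  between \<open>i\<close> and \<open>j\<close> need care; there adjacency to \<open>i\<close> and
  adjacency to \<open>j\<close> are interchangeable.\<close>

lemma equivalence_criterion_reverse_edge:
  assumes anti: "\<And>a b. (a, b) \<in> E\<^sub>2 \<Longrightarrow> (b, a) \<in> E\<^sub>2 \<Longrightarrow> a = b"
    and crit: "equivalence_criterion E\<^sub>1 E\<^sub>2"
    and ij: "i \<noteq> j" "(i, j) \<in> E\<^sub>1" "(j, i) \<in> E\<^sub>2"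
  shows "equivalence_criterion (reverse_edge i j E\<^sub>1) E\<^sub>2"
proof -
  let ?E = "reverse_edge i j E\<^sub>1"
  have adj: "adjacent ?E a b \<longleftrightarrow> adjacent E\<^sub>1 a b" for a b
    using ij by (auto simp: adjacent_def reverse_edge_def)
  have adj_sym: "adjacent E\<^sub>1 a b \<longleftrightarrow> adjacent E\<^sub>1 b a" for a b by (auto simp: adjacent_def)
  have twin: "adjacent E\<^sub>1 k i \<longleftrightarrow> adjacent E\<^sub>1 k j" for k
    using crit ij by (auto simp: equivalence_criterion_def twin_condition_def)
  have E: "(a, b) \<in> ?E \<longleftrightarrow> (a, b) = (j, i) \<or> (a, b) \<in> E\<^sub>1 \<and> (a, b) \<noteq> (i, j)" for a b
    by (auto simp: reverse_edge_def)
  have "twin_condition ?E a b" if ab: "a \<noteq> b" "(a, b) \<in> ?E" "(b, a) \<in> E\<^sub>2" for a b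
  proof -
    have "(a, b) \<noteq> (j, i)" using ab anti ij by auto
    then have ab1: "(a, b) \<in> E\<^sub>1" using ab E by auto
    then have tw: "twin_condition E\<^sub>1 a b" using crit ab by (auto simp: equivalence_criterion_def)
    have "adjacent E\<^sub>1 u c" if h: "(u, a) \<in> ?E" "(a, c) \<in> ?E" for u c
    proof -
      have a1: "adjacent E\<^sub>1 u a" "adjacent E\<^sub>1 c a" using h adj by (auto simp: adjacent_def)
      consider "(u, a) = (j, i)" | "(a, c) = (j, i)" | "(u, a) \<in> E\<^sub>1" "(a, c) \<in> E\<^sub>1"
        using h unfolding E by blast
      then show ?thesis
      proof cases
        case 1 then show ?thesis using a1 twin[of c] adj_sym by auto
      next
        case 2 then show ?thesis using a1 twin[of u] by auto
      next
        case 3 then show ?thesis using tw by (auto simp: twin_condition_def)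
      qed
    qed
    moreover have "adjacent E\<^sub>1 r a" if "(u, a) \<in> ?E" "adjacent E\<^sub>1 u r" for u r
    proof (cases "(u, a) = (j, i)")
      case True then show ?thesis using that twin[of r] adj_sym by auto
    next
      case False
      then have "(u, a) \<in> E\<^sub>1" using that E by auto
      then show ?thesis using tw that by (auto simp: twin_condition_def)
    qed
    moreover have "adjacent E\<^sub>1 r a" if h: "(a, c) \<in> ?E" "(c, r) \<in> ?E" for c r
    proof -
      have a1: "adjacent E\<^sub>1 c a" "adjacent E\<^sub>1 r c" using h adj by (auto simp: adjacent_def)
      consider "(a, c) = (j, i)" | "(c, r) = (j, i)" | "(a, c) \<in> E\<^sub>1" "(c, r) \<in> E\<^sub>1"
        using h unfolding E by blast
      then show ?thesis
      proof cases
        case 1 then show ?thesis using a1 twin[of r] by auto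
      next
        case 2 then show ?thesis using a1 twin[of a] adj_sym by auto
      next
        case 3 then show ?thesis using tw by (auto simp: twin_condition_def)
      qed
    qed
    moreover have "adjacent E\<^sub>1 k a \<longleftrightarrow> adjacent E\<^sub>1 k b" for k using tw by (simp add: twin_condition_def)
    ultimately show ?thesis unfolding twin_condition_def adj by blast
  qed
  then show ?thesis using crit adj by (auto simp: equivalence_criterion_def same_skeleton_def)
qed

text \<open>Reversing an edge that \<open>E\<^sub>2\<close> orients the other way shrinks
  \<open>E\<^sub>1 - E\<^sub>2\<close> and keeps the criterion, so the process ends at
  \<open>E\<^sub>2\<close>.\<close>

lemma equivalence_criterion_imp_lyap_model_eq:
  assumes "dag_on n E\<^sub>1" "dag_on n E\<^sub>2" "equivalence_criterion E\<^sub>1 E\<^sub>2"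
  shows "lyap_model {..<n} E\<^sub>1 s \<longleftrightarrow> lyap_model {..<n} E\<^sub>2 s"
  using assms(1,3)
proof (induction "card (E\<^sub>1 - E\<^sub>2)" arbitrary: E\<^sub>1 rule: less_induct)
  case less
  show ?case
  proof (cases "E\<^sub>1 = E\<^sub>2")
    case False
    obtain i j where rev: "reversible E\<^sub>1 i j" and ji: "(j, i) \<in> E\<^sub>2"
      using exists_reversible[OF less.prems(1) assms(2) less.prems(2) False] .
    obtain g where g: "ranked {..<n} E\<^sub>2 g" using dag_on_ranked[OF assms(2)] .
    have anti: "a = b" if "(a, b) \<in> E\<^sub>2" "(b, a) \<in> E\<^sub>2" for a b
      using ranked.rank[OF g] that by (metis less_asym)
    have ij: "i \<noteq> j" "(i, j) \<in> E\<^sub>1" using rev by (auto simp: reversible_def)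
    have "finite (E\<^sub>1 - E\<^sub>2)"
      using less.prems(1) finite_subset[of "E\<^sub>1" "{..<n} \<times> {..<n}"]
      unfolding dag_on_def digraph_on_def by auto
    moreover have "reverse_edge i j E\<^sub>1 - E\<^sub>2 \<subset> E\<^sub>1 - E\<^sub>2"
      using ij ji anti[of i j] by (auto simp: reverse_edge_def)
    ultimately have "card (reverse_edge i j E\<^sub>1 - E\<^sub>2) < card (E\<^sub>1 - E\<^sub>2)" by (rule psubset_card_mono)
    then show ?thesis
      using less.hyps[OF _ dag_on_reverse_edge[OF less.prems(1) rev]
          equivalence_criterion_reverse_edge[OF anti less.prems(2) ij ji]]
        lyap_model_reversible[OF less.prems(1) rev] by blast
  qed simp
qed

section \<open>Equivalent DAGs satisfy the criterion\<close>

lemma same_lyap_model_on_list: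
  assumes dag: "dag_on n E\<^sub>1" "dag_on n E\<^sub>2"
    and eq: "\<And>s. lyap_model {..<n} E\<^sub>1 s = lyap_model {..<n} E\<^sub>2 s"
    and vs: "distinct vs" "set vs \<subseteq> {..<n}" "length vs = k"
    and mem: "lyap_model {..<k} (pullback ((!) vs) E\<^sub>1) s"
  shows "lyap_model {..<k} (pullback ((!) vs) E\<^sub>2) s"
proof -
  have "lyap_model {..<k} (pullback ((!) vs) E\<^sub>1) s = lyap_model {..<k} (pullback ((!) vs) E\<^sub>2) s"
  proof (rule induced_lyap_model_eq)
    show "inj_on ((!) vs) {..<k}" using vs by (simp add: inj_on_nth)
    show "(!) vs ` {..<k} \<subseteq> {..<n}" using vs by (auto simp: set_conv_nth)
  qed (use dag_onD[OF dag(1)] dag_onD[OF dag(2)] eq in auto)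
  then show ?thesis using mem by simp
qed

text \<open>The assumptions are symmetric in the two graphs, so \<open>swap\<close> turns each
  result about \<open>E\<^sub>1\<close> into one about \<open>E\<^sub>2\<close>.\<close>

locale same_model =
  fixes n :: nat and E\<^sub>1 E\<^sub>2 :: "nat rel"
  assumes dag1: "dag_on n E\<^sub>1" and dag2: "dag_on n E\<^sub>2"
    and model_eq: "lyap_model {..<n} E\<^sub>1 s = lyap_model {..<n} E\<^sub>2 s"
begin

lemma swap: "same_model n E\<^sub>2 E\<^sub>1"
  using dag1 dag2 model_eq by unfold_locales auto

lemma antisym: "(a, b) \<in> E\<^sub>1 \<Longrightarrow> (b, a) \<in> E\<^sub>1 \<Longrightarrow> a = b"
proof -
  obtain f where "ranked {..<n} E\<^sub>1 f" using dag_on_ranked[OF dag1] .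
  then interpret ranked "{..<n}" E\<^sub>1 f .
  show "(a, b) \<in> E\<^sub>1 \<Longrightarrow> (b, a) \<in> E\<^sub>1 \<Longrightarrow> a = b" using rank by (metis less_asym)
qed

lemma acyclic3: "(a, b) \<in> E\<^sub>1 \<Longrightarrow> (b, c) \<in> E\<^sub>1 \<Longrightarrow> (c, a) \<in> E\<^sub>1 \<Longrightarrow> a = b"
proof -
  obtain f where "ranked {..<n} E\<^sub>1 f" using dag_on_ranked[OF dag1] .
  then interpret ranked "{..<n}" E\<^sub>1 f .
  assume *: "(a, b) \<in> E\<^sub>1" "(b, c) \<in> E\<^sub>1" "(c, a) \<in> E\<^sub>1"
  have "f x \<le> f y" if "(x, y) \<in> E\<^sub>1" for x y using rank[OF that] by (cases "x = y") auto
  then have "f a \<le> f b" "f b \<le> f c" "f c \<le> f a" using * by auto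
  then show "a = b" using rank[OF *(1)] by linarith
qed

lemmas transfer = same_lyap_model_on_list[OF dag1 dag2 model_eq]
lemmas bounds = dag_onD[OF dag1]

lemma edge_imp_adjacent: "(i, j) \<in> E\<^sub>1 \<Longrightarrow> adjacent E\<^sub>2 i j"
proof (rule ccontr)
  assume ij: "(i, j) \<in> E\<^sub>1" and n: "\<not> adjacent E\<^sub>2 i j"
  have v: "i < n" "j < n" using bounds ij by auto
  have "i \<noteq> j" using n v dag_onD[OF dag2] by (auto simp: adjacent_def)
  then show False
    using edge_not_isolated_model[of "pullback ((!) [i, j]) E\<^sub>2"]
      transfer[of "[i, j]" 2, OF _ _ _ edge_model] ij n v bounds
    by (simp add: pullback_def adjacent_def)
qed

lemma adjacent_eq: "adjacent E\<^sub>1 a b \<longleftrightarrow> adjacent E\<^sub>2 a b"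
  using edge_imp_adjacent[of a b] edge_imp_adjacent[of b a]
    same_model.edge_imp_adjacent[OF swap, of a b] same_model.edge_imp_adjacent[OF swap, of b a]
  by (auto simp: adjacent_def)

text \<open>On a path \<open>i - j - k\<close> with nonadjacent ends the four orientations have
  different models. If \<open>j\<close> is a collider in \<open>E\<^sub>1\<close>, the separating
  covariance is taken from \<open>E\<^sub>2\<close>, where the ends are correlated; otherwise a
  chain in \<open>E\<^sub>1\<close> provides it.\<close>

lemma path_edge:
  assumes ij: "(i, j) \<in> E\<^sub>1" and jk: "adjacent E\<^sub>1 j k" and ik: "\<not> adjacent E\<^sub>1 i k"
  shows "(i, j) \<in> E\<^sub>2"
proof (rule ccontr)
  assume n: "(i, j) \<notin> E\<^sub>2"
  have v: "i < n" "j < n" "k < n" using bounds ij jk by (auto simp: adjacent_def)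
  have d: "i \<noteq> j" "j \<noteq> k" "i \<noteq> k"
    using n v dag_onD[OF dag2] ij ik jk bounds by (auto simp: adjacent_def)
  have ik2: "(i, k) \<notin> E\<^sub>2" "(k, i) \<notin> E\<^sub>2" using ik adjacent_eq by (auto simp: adjacent_def)
  have ik1: "(i, k) \<notin> E\<^sub>1" "(k, i) \<notin> E\<^sub>1" using ik by (auto simp: adjacent_def)
  have ji: "(j, i) \<in> E\<^sub>2" using edge_imp_adjacent[OF ij] n by (simp add: adjacent_def)
  have ji1: "(j, i) \<notin> E\<^sub>1" using antisym ij d by blast
  have jk2: "(j, k) \<in> E\<^sub>2 \<or> (k, j) \<in> E\<^sub>2" using jk adjacent_eq by (auto simp: adjacent_def)
  have anti2: "\<not> ((j, k) \<in> E\<^sub>2 \<and> (k, j) \<in> E\<^sub>2)" using same_model.antisym[OF swap] d by blast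
  have loops: "(v, v) \<in> E\<^sub>1" "(v, v) \<in> E\<^sub>2" if "v < n" for v
    using that dag_onD[OF dag1] dag_onD[OF dag2] by auto
  note transfer2 = same_model.transfer[OF swap]
  show False
  proof (cases "(j, k) \<in> E\<^sub>1")
    case True
    then have kj: "(k, j) \<notin> E\<^sub>1" using antisym d by blast
    show False
    proof (cases "(j, k) \<in> E\<^sub>2")
      case True
      then show False
        using chain_not_fork_model[of "pullback ((!) [i, j, k]) E\<^sub>2"]
          transfer[of "[i, j, k]" 3, OF _ _ _ chain_model] ij \<open>(j, k) \<in> E\<^sub>1\<close> n ik2 anti2 v d loops
        by (simp add: pullback_def)
    next
      case False
      then show False
        using chain_not_reverse_model[of "pullback ((!) [i, j, k]) E\<^sub>2"]
          transfer[of "[i, j, k]" 3, OF _ _ _ chain_model] ij \<open>(j, k) \<in> E\<^sub>1\<close> n ik2 v d loops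
        by (simp add: pullback_def)
    qed
  next
    case nk: False
    show False
    proof (cases "(j, k) \<in> E\<^sub>2")
      case True
      then show False
        using fork_not_collider_model[of "pullback ((!) [i, j, k]) E\<^sub>1"]
          transfer2[of "[i, j, k]" 3, OF _ _ _ fork_model] nk ji ji1 ik1 v d loops
        by (simp add: pullback_def)
    next
      case False
      \<comment> \<open>Read from \<open>k\<close> to \<open>i\<close> the path is a chain in
        \<open>E\<^sub>2\<close>, hence the reversed vertex list.\<close>
      then show False
        using chain_not_collider_model[of "pullback ((!) [k, j, i]) E\<^sub>1"]
          transfer2[of "[k, j, i]" 3, OF _ _ _ chain_model] nk ji ji1 ik1 jk2 v d loops
        by (simp add: pullback_def)
    qed
  qed
qed

lemma path_edge_iff:
  assumes adj: "adjacent E\<^sub>1 i j" "adjacent E\<^sub>1 j k" "\<not> adjacent E\<^sub>1 i k"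
  shows "(i, j) \<in> E\<^sub>1 \<longleftrightarrow> (i, j) \<in> E\<^sub>2" "(j, i) \<in> E\<^sub>1 \<longleftrightarrow> (j, i) \<in> E\<^sub>2"
proof -
  have "i \<noteq> j" using adj by auto
  have 1: "(i, j) \<in> E\<^sub>1 \<Longrightarrow> (i, j) \<in> E\<^sub>2" using path_edge adj by blast
  have 2: "(i, j) \<in> E\<^sub>2 \<Longrightarrow> (i, j) \<in> E\<^sub>1"
    using same_model.path_edge[OF swap] adj adjacent_eq by blast
  show "(i, j) \<in> E\<^sub>1 \<longleftrightarrow> (i, j) \<in> E\<^sub>2" using 1 2 by blast
  then show "(j, i) \<in> E\<^sub>1 \<longleftrightarrow> (j, i) \<in> E\<^sub>2"
    using antisym[of i j] same_model.antisym[OF swap, of i j] \<open>i \<noteq> j\<close> adj(1) adjacent_eq[of i j]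
    by (auto simp: adjacent_def)
qed

lemma loops: "v < n \<Longrightarrow> (v, v) \<in> E\<^sub>1"
  using bounds by blast

text \<open>A vertex adjacent to only one end point would fix the orientation of the edge itself by
  \<open>path_edge_iff\<close>. A violation of another clause leaves a nonadjacent pair that fixes
  the orientation of all other edges among the four vertices involved; the two induced subgraphs
  then differ exactly in the edge between \<open>i\<close> and \<open>j\<close>, which the examples
  on four vertices exclude.\<close>

lemma twin_condition_of_flip:
  assumes ne: "i \<noteq> j" and ij: "(i, j) \<in> E\<^sub>1" and ji: "(j, i) \<in> E\<^sub>2"
  shows "twin_condition E\<^sub>1 i j"
proof -
  have v: "i < n" "j < n" using bounds ij by auto
  have ji1: "(j, i) \<notin> E\<^sub>1" using antisym ij ne by blast
  have ij2: "(i, j) \<notin> E\<^sub>2" using same_model.antisym[OF swap] ji ne by blast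
  have adj_sym: "adjacent E\<^sub>1 a b \<longleftrightarrow> adjacent E\<^sub>1 b a" for a b by (auto simp: adjacent_def)
  have aij: "adjacent E\<^sub>1 i j" using ij by (simp add: adjacent_def)
  have twin: "adjacent E\<^sub>1 k i \<longleftrightarrow> adjacent E\<^sub>1 k j" for k
  proof (rule ccontr)
    assume "\<not> ?thesis"
    then consider "adjacent E\<^sub>1 i k" "\<not> adjacent E\<^sub>1 j k" | "adjacent E\<^sub>1 j k" "\<not> adjacent E\<^sub>1 i k"
      using adj_sym[of k i] adj_sym[of k j] by blast
    then show False
    proof cases
      case 1
      then show False using path_edge_iff(2)[of j i k] aij adj_sym ij ij2 by blast
    next
      case 2
      then show False using path_edge_iff(1)[of i j k] aij ij ij2 by blast
    qed
  qed
  \<comment> \<open>Together with \<open>j -> i\<close> such a vertex closes a directed triangle in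
    \<open>E\<^sub>2\<close>. This later orients the edge between \<open>j\<close> and a child of
    \<open>i\<close>.\<close>
  have no_between: False if "(i, c) \<in> E\<^sub>2" "(c, j) \<in> E\<^sub>2" "c \<noteq> i" for c
    using same_model.acyclic3[OF swap, of i c j] that ji by blast
  have mid: "adjacent E\<^sub>1 u c" if ui: "(u, i) \<in> E\<^sub>1" and ic: "(i, c) \<in> E\<^sub>1" for u c
  proof (rule ccontr)
    assume nuc: "\<not> adjacent E\<^sub>1 u c"
    have vs: "u < n" "c < n" using ui ic bounds by auto
    have aui: "adjacent E\<^sub>1 u i" "adjacent E\<^sub>1 c i" using ui ic by (auto simp: adjacent_def)
    then have auj: "adjacent E\<^sub>1 u j" "adjacent E\<^sub>1 c j" using twin by auto
    have d: "u \<noteq> i" "c \<noteq> i" "u \<noteq> c" "u \<noteq> j" "c \<noteq> j"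
      using nuc aui auj vs bounds adj_sym[of j c] adj_sym[of c i] by (auto simp: adjacent_def)
    have uj: "(u, j) \<in> E\<^sub>1" using auj(1) acyclic3[of u i j] ui ij d by (auto simp: adjacent_def)
    have agree: "(x, y) \<in> E\<^sub>1 \<longleftrightarrow> (x, y) \<in> E\<^sub>2"
      if "x \<in> {u, c} \<and> y \<in> {i, j} \<or> x \<in> {i, j} \<and> y \<in> {u, c}" for x y
    proof -
      have "(u, y) \<in> E\<^sub>1 \<longleftrightarrow> (u, y) \<in> E\<^sub>2" "(y, u) \<in> E\<^sub>1 \<longleftrightarrow> (y, u) \<in> E\<^sub>2" if "y \<in> {i, j}" for y
        using path_edge_iff[of u y c] that aui auj nuc adj_sym by blast+
      moreover have "(c, y) \<in> E\<^sub>1 \<longleftrightarrow> (c, y) \<in> E\<^sub>2" "(y, c) \<in> E\<^sub>1 \<longleftrightarrow> (y, c) \<in> E\<^sub>2" if "y \<in> {i, j}" for y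
        using path_edge_iff[of c y u] that aui auj nuc adj_sym by blast+
      ultimately show ?thesis using that by blast
    qed
    have "(c, j) \<notin> E\<^sub>1" using no_between[of c] agree ic d by blast
    then have jc: "(j, c) \<in> E\<^sub>1" using auj(2) by (auto simp: adjacent_def)
    have neg1: "(i, u) \<notin> E\<^sub>1" "(j, u) \<notin> E\<^sub>1" "(c, i) \<notin> E\<^sub>1" "(c, j) \<notin> E\<^sub>1"
      using antisym ui uj ic jc d by blast+
    then have neg2: "(i, u) \<notin> E\<^sub>2" "(j, u) \<notin> E\<^sub>2" "(c, i) \<notin> E\<^sub>2" "(c, j) \<notin> E\<^sub>2"
      using agree by blast+
    have uc2: "(u, c) \<notin> E\<^sub>2" "(c, u) \<notin> E\<^sub>2" using nuc adjacent_eq by (auto simp: adjacent_def)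
    \<comment> \<open>The order of the list matches the roles of the example vertices 0, 1, 2, 3:
      the flipped edge, its common parent, its common child.\<close>
    show False
      using twin_mid_not_flip_model[of "pullback ((!) [i, j, u, c]) E\<^sub>2"]
        transfer[of "[i, j, u, c]" 4, OF _ _ _ twin_mid_model]
        ij ij2 ui uj ic jc neg2 uc2 ne d v vs loops
      by (simp add: pullback_def)
  qed
  have parent: "adjacent E\<^sub>1 r i" if ui: "(u, i) \<in> E\<^sub>1" and ur: "adjacent E\<^sub>1 u r" for u r
  proof (rule ccontr)
    assume nri: "\<not> adjacent E\<^sub>1 r i"
    then have nrj: "\<not> adjacent E\<^sub>1 r j" using twin by simp
    have vs: "u < n" "r < n" using ui ur bounds by (auto simp: adjacent_def)
    have aui: "adjacent E\<^sub>1 u i" using ui by (auto simp: adjacent_def)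
    then have auj: "adjacent E\<^sub>1 u j" using twin by auto
    have d: "u \<noteq> i" "r \<noteq> i" "u \<noteq> r" "u \<noteq> j" "r \<noteq> j"
      using nri nrj aui ur ui ji1 vs v loops adj_sym[of r u] by (auto simp: adjacent_def)
    have uj: "(u, j) \<in> E\<^sub>1" using auj(1) acyclic3[of u i j] ui ij d by (auto simp: adjacent_def)
    have neg1: "(i, u) \<notin> E\<^sub>1" "(j, u) \<notin> E\<^sub>1" using antisym ui uj d by blast+
    have neg2: "(i, u) \<notin> E\<^sub>2" "(j, u) \<notin> E\<^sub>2"
      using path_edge_iff(1)[of i u r] path_edge_iff(1)[of j u r] neg1 aui auj nri nrj ur adj_sym by blast+
    have no2: "(r, i) \<notin> E\<^sub>2" "(i, r) \<notin> E\<^sub>2" "(r, j) \<notin> E\<^sub>2" "(j, r) \<notin> E\<^sub>2"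
      using nri nrj adjacent_eq by (auto simp: adjacent_def)
    have ur_agree: "(u, r) \<in> E\<^sub>1 \<longleftrightarrow> (u, r) \<in> E\<^sub>2" "(r, u) \<in> E\<^sub>1 \<longleftrightarrow> (r, u) \<in> E\<^sub>2"
      using path_edge_iff[of r u i] aui nri ur adj_sym by blast+
    show False
    proof (cases "(u, r) \<in> E\<^sub>1")
      case True
      then have "(r, u) \<notin> E\<^sub>2" using antisym d ur_agree by blast
      then show False
        using twin_parent_out_not_flip_model[of "pullback ((!) [i, j, u, r]) E\<^sub>2"]
          transfer[of "[i, j, u, r]" 4, OF _ _ _ twin_parent_out_model]
          True ij ij2 ui uj neg2 no2 ne d v vs loops
        by (simp add: pullback_def)
    next
      case False
      then have "(u, r) \<notin> E\<^sub>2" "(r, u) \<in> E\<^sub>1" using ur_agree ur by (auto simp: adjacent_def)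
      then show False
        using twin_parent_in_not_flip_model[of "pullback ((!) [i, j, u, r]) E\<^sub>2"]
          transfer[of "[i, j, u, r]" 4, OF _ _ _ twin_parent_in_model]
          ij ij2 ui uj neg2 no2 ne d v vs loops
        by (simp add: pullback_def)
    qed
  qed
  have child: "adjacent E\<^sub>1 r i" if ic: "(i, c) \<in> E\<^sub>1" and cr: "(c, r) \<in> E\<^sub>1" for c r
  proof (rule ccontr)
    assume nri: "\<not> adjacent E\<^sub>1 r i"
    then have nrj: "\<not> adjacent E\<^sub>1 r j" using twin by simp
    have vs: "c < n" "r < n" using ic cr bounds by auto
    have aci: "adjacent E\<^sub>1 c i" using ic by (auto simp: adjacent_def)
    then have acj: "adjacent E\<^sub>1 c j" using twin by auto
    have acr: "adjacent E\<^sub>1 c r" using cr by (simp add: adjacent_def)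
    have d: "c \<noteq> i" "r \<noteq> i" "c \<noteq> r" "c \<noteq> j" "r \<noteq> j"
      using nri nrj aci ic cr vs v loops by (auto simp: adjacent_def)
    have agree: "(i, c) \<in> E\<^sub>1 \<longleftrightarrow> (i, c) \<in> E\<^sub>2" "(c, i) \<in> E\<^sub>1 \<longleftrightarrow> (c, i) \<in> E\<^sub>2"
      "(j, c) \<in> E\<^sub>1 \<longleftrightarrow> (j, c) \<in> E\<^sub>2" "(c, j) \<in> E\<^sub>1 \<longleftrightarrow> (c, j) \<in> E\<^sub>2"
      using path_edge_iff[of i c r] path_edge_iff[of j c r] aci acj nri nrj acr adj_sym by blast+
    have "(c, j) \<notin> E\<^sub>1" using no_between[of c] agree ic d by blast
    then have jc: "(j, c) \<in> E\<^sub>1" using acj by (auto simp: adjacent_def)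
    have "(c, i) \<notin> E\<^sub>1" "(c, j) \<notin> E\<^sub>1" using antisym ic jc d by blast+
    then have neg2: "(c, i) \<notin> E\<^sub>2" "(c, j) \<notin> E\<^sub>2" using agree by blast+
    have no2: "(r, i) \<notin> E\<^sub>2" "(i, r) \<notin> E\<^sub>2" "(r, j) \<notin> E\<^sub>2" "(j, r) \<notin> E\<^sub>2"
      using nri nrj adjacent_eq by (auto simp: adjacent_def)
    have "(r, c) \<notin> E\<^sub>1" using antisym cr d by blast
    moreover have "(r, c) \<in> E\<^sub>1 \<longleftrightarrow> (r, c) \<in> E\<^sub>2"
      using path_edge_iff(1)[of r c i] aci acr nri adj_sym by blast
    ultimately have "(r, c) \<notin> E\<^sub>2" by blast
    then show False
      using twin_child_out_not_flip_model[of "pullback ((!) [i, j, c, r]) E\<^sub>2"]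
        transfer[of "[i, j, c, r]" 4, OF _ _ _ twin_child_out_model]
        cr ij ij2 ic jc neg2 no2 ne d v vs loops
      by (simp add: pullback_def)
  qed
  show ?thesis unfolding twin_condition_def using twin mid parent child by blast
qed

lemma equivalence_criterion: "equivalence_criterion E\<^sub>1 E\<^sub>2"
  unfolding equivalence_criterion_def same_skeleton_def
  using adjacent_eq twin_condition_of_flip by blast

end

section \<open>The two characterisations\<close>

lemma model_equivalent_iff:
  assumes "dag_on n E\<^sub>1" "dag_on n E\<^sub>2"
  shows "model_equivalent n E\<^sub>1 E\<^sub>2 \<longleftrightarrow> equivalence_criterion E\<^sub>1 E\<^sub>2"
proof
  assume "model_equivalent n E\<^sub>1 E\<^sub>2"
  then have "same_model n E\<^sub>1 E\<^sub>2"
    using assms unfolding model_equivalent_def lyapunov_model_eq_iff by unfold_locales auto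
  then show "equivalence_criterion E\<^sub>1 E\<^sub>2" by (rule same_model.equivalence_criterion)
next
  assume "equivalence_criterion E\<^sub>1 E\<^sub>2"
  then show "model_equivalent n E\<^sub>1 E\<^sub>2"
    using equivalence_criterion_imp_lyap_model_eq[OF assms]
    unfolding model_equivalent_def lyapunov_model_eq_iff by blast
qed

text \<open>The quantification over all DAGs disappears because the first reversal on the way from
  \<open>E\<close> to a different equivalent DAG is already a reversible edge of
  \<open>E\<close>.\<close>

lemma dag_structurally_identifiable_iff:
  assumes dag: "dag_on n E"
  shows "dag_structurally_identifiable n E \<longleftrightarrow> (\<nexists>i j. reversible E i j)"
proof
  assume ident: "dag_structurally_identifiable n E"
  show "\<nexists>i j. reversible E i j"
  proof
    assume "\<exists>i j. reversible E i j"
    then obtain i j where rev: "reversible E i j" by blast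
    have "reverse_edge i j E = E"
      using ident dag_on_reverse_edge[OF dag rev] lyap_model_reversible[OF dag rev]
      unfolding dag_structurally_identifiable_def lyapunov_model_eq_iff by blast
    then have "(j, i) \<in> E" "(i, j) \<in> E" "i \<noteq> j"
      using rev by (auto simp: reverse_edge_def reversible_def)
    moreover obtain f where "ranked {..<n} E f" using dag_on_ranked[OF dag] .
    ultimately show False by (metis ranked.rank less_asym)
  qed
next
  assume none: "\<nexists>i j. reversible E i j"
  show "dag_structurally_identifiable n E"
    unfolding dag_structurally_identifiable_def
  proof (intro allI impI, elim conjE)
    fix E' assume dag': "dag_on n E'" and "lyapunov_model n E' = lyapunov_model n E"
    then have "equivalence_criterion E E'"
      using model_equivalent_iff[OF dag dag'] by (simp add: model_equivalent_def)
    then show "E' = E" using exists_reversible[OF dag dag'] none by metis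
  qed
qed

section \<open>Structured programs for Turing machines\<close>

text \<open>Guards and actions are functions of the symbols under all heads, so each takes one
  transition and the machine states serve merely as a program counter.\<close>

datatype com =
    Act "nat list \<Rightarrow> (nat \<times> head_move) list"
  | Seq com com
  | Cond "nat list \<Rightarrow> bool" com com
  | Loop "nat list \<Rightarrow> bool" com

definition keep :: "nat list \<Rightarrow> (nat \<times> head_move) list" where
  "keep ss = map (\<lambda>s. (s, Stay)) ss"

fun code_length :: "com \<Rightarrow> nat" where
  "code_length (Act g) = 1"
| "code_length (Seq c d) = code_length c + code_length d"
| "code_length (Cond P c d) = code_length c + code_length d + 2"
| "code_length (Loop P c) = code_length c + 2"

text \<open>Code placed at state \<open>a\<close> is left in state \<open>a + code_length c\<close>.
  The two extra instructions of \<open>Cond\<close> and \<open>Loop\<close> are the test and the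
  jump, past the second branch or back to the test.\<close>

fun code :: "com \<Rightarrow> nat \<Rightarrow> (nat list \<Rightarrow> nat \<times> (nat \<times> head_move) list) list" where
  "code (Act g) a = [\<lambda>ss. (a + 1, g ss)]"
| "code (Seq c d) a = code c a @ code d (a + code_length c)"
| "code (Cond P c d) a =
     [\<lambda>ss. (if P ss then a + 1 else a + code_length c + 2, keep ss)] @ code c (a + 1) @
     [\<lambda>ss. (a + code_length c + code_length d + 2, keep ss)] @ code d (a + code_length c + 2)"
| "code (Loop P c) a =
     [\<lambda>ss. (if P ss then a + 1 else a + code_length c + 2, keep ss)] @ code c (a + 1) @
     [\<lambda>ss. (a, keep ss)]"

lemma length_code [simp]: "length (code c a) = code_length c"
  by (induction c arbitrary: a) auto

text \<open>Halting states are excluded because \<open>tm_step\<close> freezes there whatever the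
  transition function says.\<close>

definition installed ::
  "turing_machine \<Rightarrow> nat \<Rightarrow> (nat list \<Rightarrow> nat \<times> (nat \<times> head_move) list) list \<Rightarrow> bool" where
  "installed M a is \<longleftrightarrow> (\<forall>i < length is. a + i \<noteq> accept_state M \<and> a + i \<noteq> reject_state M \<and>
     trans_fun M (a + i) = is ! i)"

lemma installed_append:
  "installed M a (xs @ ys) \<longleftrightarrow> installed M a xs \<and> installed M (a + length xs) ys"
proof
  assume l: "installed M a (xs @ ys)"
  have "installed M (a + length xs) ys"
    unfolding installed_def
  proof (intro allI impI)
    fix i assume "i < length ys"
    then show "a + length xs + i \<noteq> accept_state M \<and> a + length xs + i \<noteq> reject_state M \<and>
        trans_fun M (a + length xs + i) = ys ! i"
      using l[unfolded installed_def, rule_format, of "length xs + i"] by (simp add: add.assoc)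
  qed
  moreover have "installed M a xs"
    unfolding installed_def
  proof (intro allI impI)
    fix i assume "i < length xs"
    then show "a + i \<noteq> accept_state M \<and> a + i \<noteq> reject_state M \<and> trans_fun M (a + i) = xs ! i"
      using l[unfolded installed_def, rule_format, of i] by (simp add: nth_append)
  qed
  ultimately show "installed M a xs \<and> installed M (a + length xs) ys" by blast
next
  assume r: "installed M a xs \<and> installed M (a + length xs) ys"
  show "installed M a (xs @ ys)"
    unfolding installed_def
  proof (intro allI impI)
    fix i assume i: "i < length (xs @ ys)"
    show "a + i \<noteq> accept_state M \<and> a + i \<noteq> reject_state M \<and> trans_fun M (a + i) = (xs @ ys) ! i"
    proof (cases "i < length xs")
      case True
      then show ?thesis using r by (simp add: installed_def nth_append)
    next
      case False
      then obtain k where "i = length xs + k" "k < length ys"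
        using i by (metis add_diff_inverse_nat length_append nat_add_left_cancel_less)
      then show ?thesis using r by (auto simp: installed_def add.assoc)
    qed
  qed
qed

lemma installed_singleton:
  "installed M a [f] \<longleftrightarrow> a \<noteq> accept_state M \<and> a \<noteq> reject_state M \<and> trans_fun M a = f"
  by (simp add: installed_def)

lemma installed_Cons:
  "installed M a (f # is) \<longleftrightarrow>
     a \<noteq> accept_state M \<and> a \<noteq> reject_state M \<and> trans_fun M a = f \<and> installed M (a + 1) is"
  using installed_append[of M a "[f]" "is"] by (simp add: installed_singleton)

text \<open>Quantifying over all machines and start addresses makes the statement compositional: no
  state layout has to be tracked when programs are combined.\<close>

definition runs :: "com \<Rightarrow> tape list \<Rightarrow> tape list \<Rightarrow> nat \<Rightarrow> bool" where
  "runs c ts ts' t \<longleftrightarrow>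
     (\<forall>M a. installed M a (code c a) \<longrightarrow> (tm_step M ^^ t) (a, ts) = (a + code_length c, ts'))"

lemma map2_tape_act_keep: "map2 tape_act (keep (map tape_read ts)) ts = ts"
proof -
  have "tape_act (tape_read t, Stay) t = t" for t by (cases t) simp
  then show ?thesis by (induction ts) (auto simp: keep_def)
qed

lemma runs_Act: "runs (Act g) ts (map2 tape_act (g (map tape_read ts)) ts) 1"
  by (simp add: runs_def installed_singleton)

lemma funpow_add_apply: "(f ^^ t) x = y \<Longrightarrow> (f ^^ u) y = z \<Longrightarrow> (f ^^ (t + u)) x = z"
  by (metis add.commute comp_apply funpow_add)

lemma runs_Seq:
  assumes "runs c ts ts' t" "runs d ts' ts'' u"
  shows "runs (Seq c d) ts ts'' (t + u)"
  unfolding runs_def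
proof (intro allI impI)
  fix M a assume "installed M a (code (Seq c d) a)"
  then have "(tm_step M ^^ t) (a, ts) = (a + code_length c, ts')"
    "(tm_step M ^^ u) (a + code_length c, ts') = (a + code_length c + code_length d, ts'')"
    using assms by (simp_all add: runs_def installed_append)
  then show "(tm_step M ^^ (t + u)) (a, ts) = (a + code_length (Seq c d), ts'')"
    using funpow_add_apply by (simp add: add.assoc)
qed

lemma runs_Cond_True:
  assumes P: "P (map tape_read ts)" and c: "runs c ts ts' t"
  shows "runs (Cond P c d) ts ts' (t + 2)"
  unfolding runs_def
proof (intro allI impI)
  fix M a assume inst: "installed M a (code (Cond P c d) a)"
  have "(tm_step M ^^ 1) (a, ts) = (a + 1, ts)"
    using inst P by (simp add: installed_Cons map2_tape_act_keep)
  moreover have "(tm_step M ^^ t) (a + 1, ts) = (a + 1 + code_length c, ts')"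
    using inst c by (simp add: runs_def installed_Cons installed_append)
  moreover have "(tm_step M ^^ 1) (a + 1 + code_length c, ts') = (a + code_length (Cond P c d), ts')"
    using inst by (simp add: installed_Cons installed_append map2_tape_act_keep add_ac)
  ultimately have "(tm_step M ^^ (1 + (t + 1))) (a, ts) = (a + code_length (Cond P c d), ts')"
    by (intro funpow_add_apply)
  moreover have "1 + (t + 1) = t + 2" by simp
  ultimately show "(tm_step M ^^ (t + 2)) (a, ts) = (a + code_length (Cond P c d), ts')"
    by (simp only:)
qed

lemma runs_Cond_False:
  assumes P: "\<not> P (map tape_read ts)" and d: "runs d ts ts' t"
  shows "runs (Cond P c d) ts ts' (t + 1)"
  unfolding runs_def
proof (intro allI impI)
  fix M a assume inst: "installed M a (code (Cond P c d) a)"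
  have "(tm_step M ^^ 1) (a, ts) = (a + code_length c + 2, ts)"
    using inst P by (simp add: installed_Cons map2_tape_act_keep)
  moreover have "installed M (a + code_length c + 2) (code d (a + code_length c + 2))"
    using inst by (simp add: installed_Cons installed_append add_ac)
  then have "(tm_step M ^^ t) (a + code_length c + 2, ts) = (a + code_length c + 2 + code_length d, ts')"
    using d by (simp add: runs_def)
  ultimately have "(tm_step M ^^ (1 + t)) (a, ts) = (a + code_length c + 2 + code_length d, ts')"
    by (rule funpow_add_apply)
  moreover have "1 + t = t + 1" "a + code_length c + 2 + code_length d = a + code_length (Cond P c d)"
    by simp_all
  ultimately show "(tm_step M ^^ (t + 1)) (a, ts) = (a + code_length (Cond P c d), ts')"
    by (simp only:)
qed

lemma runs_Loop_False:
  assumes "\<not> P (map tape_read ts)"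
  shows "runs (Loop P c) ts ts 1"
  using assms by (simp add: runs_def installed_Cons map2_tape_act_keep)

lemma runs_Loop_True:
  assumes P: "P (map tape_read ts)" and c: "runs c ts ts' t" and l: "runs (Loop P c) ts' ts'' u"
  shows "runs (Loop P c) ts ts'' (t + 2 + u)"
  unfolding runs_def
proof (intro allI impI)
  fix M a assume inst: "installed M a (code (Loop P c) a)"
  have "(tm_step M ^^ 1) (a, ts) = (a + 1, ts)"
    using inst P by (simp add: installed_Cons map2_tape_act_keep)
  moreover have "(tm_step M ^^ t) (a + 1, ts) = (a + 1 + code_length c, ts')"
    using inst c by (simp add: runs_def installed_Cons installed_append)
  moreover have "(tm_step M ^^ 1) (a + 1 + code_length c, ts') = (a, ts')"
    using inst by (simp add: installed_Cons installed_append map2_tape_act_keep add_ac)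
  moreover have "(tm_step M ^^ u) (a, ts') = (a + code_length (Loop P c), ts'')"
    using inst l by (simp only: runs_def)
  ultimately have "(tm_step M ^^ (1 + (t + (1 + u)))) (a, ts) = (a + code_length (Loop P c), ts'')"
    by (intro funpow_add_apply)
  moreover have "1 + (t + (1 + u)) = t + 2 + u" by simp
  ultimately show "(tm_step M ^^ (t + 2 + u)) (a, ts) = (a + code_length (Loop P c), ts'')"
    by (simp only:)
qed

section \<open>Well-formedness and verdict of the compiled machine\<close>

fun wf_com :: "nat \<Rightarrow> com \<Rightarrow> bool" where
  "wf_com k (Act g) \<longleftrightarrow> (\<forall>ss. length ss = k \<and> set ss \<subseteq> {..<3} \<longrightarrow>
     length (g ss) = k \<and> fst ` set (g ss) \<subseteq> {..<3})"
| "wf_com k (Seq c d) \<longleftrightarrow> wf_com k c \<and> wf_com k d"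
| "wf_com k (Cond P c d) \<longleftrightarrow> wf_com k c \<and> wf_com k d"
| "wf_com k (Loop P c) \<longleftrightarrow> wf_com k c"

text \<open>The bound on the next state is inclusive, since code may exit to the state just behind
  it.\<close>

lemma code_wf:
  assumes "wf_com k c" "length ss = k" "set ss \<subseteq> {..<3}" "f \<in> set (code c a)"
  shows "fst (f ss) \<le> a + code_length c \<and> length (snd (f ss)) = k \<and> fst ` set (snd (f ss)) \<subseteq> {..<3}"
  using assms
proof (induction c arbitrary: a f)
  case (Seq c d)
  from Seq.prems(4) consider "f \<in> set (code c a)" | "f \<in> set (code d (a + code_length c))" by auto
  then show ?case using Seq.IH[of f] Seq.prems by cases fastforce+
next
  case (Cond P c d)
  have "length (keep ss) = k \<and> fst ` set (keep ss) \<subseteq> {..<3}"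
    using Cond.prems by (auto simp: keep_def image_image)
  then show ?case using Cond.IH[of f] Cond.prems by (auto; fastforce)
next
  case (Loop P c)
  have "length (keep ss) = k \<and> fst ` set (keep ss) \<subseteq> {..<3}"
    using Loop.prems by (auto simp: keep_def image_image)
  then show ?case using Loop.IH[of f] Loop.prems by (auto; fastforce)
qed auto

text \<open>State \<open>code_length c\<close> follows the program and reads the verdict off tape 1;
  the next two are the halting states. Hence the three additional states.\<close>

definition machine :: "nat \<Rightarrow> com \<Rightarrow> turing_machine" where
  "machine k c = \<lparr>num_tapes = k, num_states = code_length c + 3, num_symbols = 3,
     start_state = 0, accept_state = code_length c + 1, reject_state = code_length c + 2,
     trans_fun = (\<lambda>q. if q < code_length c then code c 0 ! q
       else (\<lambda>ss. (if ss ! 1 \<noteq> 0 then code_length c + 1 else code_length c + 2, keep ss)))\<rparr>"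

lemma wf_tm_machine:
  assumes "wf_com k c" "1 \<le> k"
  shows "wf_tm (machine k c)"
proof -
  have "case trans_fun (machine k c) q ss of (q', acts) \<Rightarrow>
      q' < code_length c + 3 \<and> length acts = k \<and> (\<forall>(s, d) \<in> set acts. s < 3)"
    if "length ss = k" "set ss \<subseteq> {..<3}" for q ss
  proof (cases "q < code_length c")
    case True
    then have "code c 0 ! q \<in> set (code c 0)" by simp
    from code_wf[OF assms(1) that this] show ?thesis
      using True by (fastforce simp: machine_def image_subset_iff split: prod.splits)
  next
    case False
    then show ?thesis using that by (auto simp: machine_def keep_def)
  qed
  then show ?thesis using assms(2) by (simp add: wf_tm_def machine_def)
qed

lemma machine_run:
  assumes run: "runs c (snd (tm_init (machine k c) w)) ts t" and T: "t + 1 \<le> T" and k: "1 < length ts"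
  shows "fst ((tm_step (machine k c) ^^ T) (tm_init (machine k c) w)) =
    (if tape_read (ts ! 1) \<noteq> 0 then accept_state (machine k c) else reject_state (machine k c))"
proof -
  let ?M = "machine k c"
  define q where "q = (if tape_read (ts ! 1) \<noteq> 0 then accept_state ?M else reject_state ?M)"
  have inst: "installed ?M 0 (code c 0)" by (auto simp: installed_def machine_def)
  have "(tm_step ?M ^^ t) (tm_init ?M w) = (code_length c, ts)"
    using run inst by (auto simp: runs_def tm_init_def machine_def)
  moreover have "(tm_step ?M ^^ 1) (code_length c, ts) = (q, ts)"
    using k by (simp add: machine_def q_def map2_tape_act_keep)
  ultimately have 1: "(tm_step ?M ^^ (t + 1)) (tm_init ?M w) = (q, ts)" by (rule funpow_add_apply)
  have fixed: "(tm_step ?M ^^ u) (q, ts) = (q, ts)" for u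
    by (induction u) (auto simp: q_def)
  have "(tm_step ?M ^^ (t + 1 + (T - (t + 1)))) (tm_init ?M w) = (q, ts)"
    using 1 fixed by (rule funpow_add_apply)
  then show ?thesis using T by (simp add: q_def)
qed

section \<open>Programs that move heads over fixed tape contents\<close>

definition conf :: "(int \<Rightarrow> nat) list \<Rightarrow> (nat \<Rightarrow> int) \<Rightarrow> tape list" where
  "conf cs h = map (\<lambda>i. (cs ! i, h i)) [0..<length cs]"

text \<open>Once the tapes are initialised no cell changes any more, so a configuration is just a
  vector of head positions. The time is an upper bound here, which lets branches of different length
  be merged.\<close>

definition exec :: "(int \<Rightarrow> nat) list \<Rightarrow> com \<Rightarrow> (nat \<Rightarrow> int) \<Rightarrow> (nat \<Rightarrow> int) \<Rightarrow> nat \<Rightarrow> bool" where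
  "exec cs c h h' T \<longleftrightarrow> (\<exists>t\<le>T. runs c (conf cs h) (conf cs h') t)"

definition symbols :: "(int \<Rightarrow> nat) list \<Rightarrow> (nat \<Rightarrow> int) \<Rightarrow> nat list" where
  "symbols cs h = map (\<lambda>i. (cs ! i) (h i)) [0..<length cs]"

lemma read_conf: "map tape_read (conf cs h) = symbols cs h"
  by (simp add: conf_def symbols_def)

lemma nth_symbols [simp]: "i < length cs \<Longrightarrow> symbols cs h ! i = (cs ! i) (h i)"
  by (simp add: symbols_def)

lemma exec_mono: "exec cs c h h' T \<Longrightarrow> T \<le> T' \<Longrightarrow> exec cs c h h' T'"
  unfolding exec_def using order_trans by blast

lemma exec_Seq:
  assumes "exec cs c h h' T" "exec cs d h' h'' U"
  shows "exec cs (Seq c d) h h'' (T + U)"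
  using assms runs_Seq unfolding exec_def by (meson add_le_mono)

lemma exec_Cond:
  assumes "P (symbols cs h) \<Longrightarrow> exec cs c h h' T" "\<not> P (symbols cs h) \<Longrightarrow> exec cs d h h' T"
  shows "exec cs (Cond P c d) h h' (T + 2)"
proof (cases "P (symbols cs h)")
  case True
  then show ?thesis
    using assms(1) runs_Cond_True[of P "conf cs h" c _ _ d] unfolding exec_def read_conf
    by (meson add_le_mono1)
next
  case False
  then obtain t where "t \<le> T" "runs d (conf cs h) (conf cs h') t" using assms(2) by (auto simp: exec_def)
  then show ?thesis
    using runs_Cond_False[of P "conf cs h" d _ _ c] False unfolding exec_def read_conf
    by (intro exI[of _ "t + 1"]) auto
qed

lemma exec_Loop:
  assumes step: "\<And>i. i < N \<Longrightarrow> P (symbols cs (s i)) \<and> exec cs c (s i) (s (Suc i)) T"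
    and stop: "\<not> P (symbols cs (s N))"
  shows "exec cs (Loop P c) (s 0) (s N) (N * (T + 2) + 1)"
  using assms
proof (induction N arbitrary: s)
  case 0
  then show ?case using runs_Loop_False[of P "conf cs (s 0)" c] unfolding exec_def read_conf by auto
next
  case (Suc N)
  have "exec cs (Loop P c) (s (Suc 0)) (s (Suc N)) (N * (T + 2) + 1)"
    using Suc.IH[of "\<lambda>i. s (Suc i)"] Suc.prems by auto
  then obtain u where u: "u \<le> N * (T + 2) + 1" "runs (Loop P c) (conf cs (s (Suc 0))) (conf cs (s (Suc N))) u"
    unfolding exec_def by blast
  obtain t where t: "t \<le> T" "runs c (conf cs (s 0)) (conf cs (s (Suc 0))) t"
    using Suc.prems(1)[of 0] unfolding exec_def by blast
  have "runs (Loop P c) (conf cs (s 0)) (conf cs (s (Suc N))) (t + 2 + u)"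
    by (rule runs_Loop_True[OF _ t(2) u(2)]) (use Suc.prems(1)[of 0] in \<open>simp add: read_conf\<close>)
  then show ?case unfolding exec_def using t u by (intro exI[of _ "t + 2 + u"]) auto
qed

definition Move :: "(nat \<Rightarrow> head_move) \<Rightarrow> com" where
  "Move m = Act (\<lambda>ss. map (\<lambda>i. (ss ! i, m i)) [0..<length ss])"

lemma wf_Move [simp]: "wf_com k (Move m)"
  by (auto simp: Move_def image_subset_iff) (meson lessThan_iff nth_mem subset_iff)

lemma exec_Move: "exec cs (Move m) h (\<lambda>i. h i + head_shift (m i)) 1"
proof -
  have "map2 tape_act (map (\<lambda>i. (symbols cs h ! i, m i)) [0..<length cs]) (conf cs h) =
      conf cs (\<lambda>i. h i + head_shift (m i))"
    by (intro nth_equalityI) (auto simp: conf_def)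
  then have "runs (Move m) (conf cs h) (conf cs (\<lambda>i. h i + head_shift (m i))) 1"
    using runs_Act[of "\<lambda>ss. map (\<lambda>i. (ss ! i, m i)) [0..<length ss]" "conf cs h"]
    unfolding Move_def read_conf by (simp add: symbols_def)
  then show ?thesis unfolding exec_def by blast
qed

definition right :: "nat \<Rightarrow> com" where
  "right i = Move (\<lambda>j. if j = i then Move_Right else Stay)"

definition left :: "nat \<Rightarrow> com" where
  "left i = Move (\<lambda>j. if j = i then Move_Left else Stay)"

definition skip :: com where
  "skip = Move (\<lambda>_. Stay)"

lemma wf_moves [simp]: "wf_com k (right i)" "wf_com k (left i)" "wf_com k skip"
  by (simp_all add: right_def left_def skip_def)

lemma exec_right:
  assumes "h' = h(i := h i + 1)" "1 \<le> T"
  shows "exec cs (right i) h h' T"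
proof -
  have "(\<lambda>j. h j + head_shift (if j = i then Move_Right else Stay)) = h'" using assms by auto
  then have "exec cs (right i) h h' 1"
    using exec_Move[of cs _ h] unfolding right_def by metis
  then show ?thesis using assms(2) by (rule exec_mono)
qed

lemma exec_left:
  assumes "h' = h(i := h i - 1)" "1 \<le> T"
  shows "exec cs (left i) h h' T"
proof -
  have "(\<lambda>j. h j + head_shift (if j = i then Move_Left else Stay)) = h'" using assms by auto
  then have "exec cs (left i) h h' 1"
    using exec_Move[of cs _ h] unfolding left_def by metis
  then show ?thesis using assms(2) by (rule exec_mono)
qed

lemma exec_skip:
  assumes "1 \<le> T"
  shows "exec cs skip h h T"
  using exec_Move[of cs "\<lambda>_. Stay" h] exec_mono[OF _ assms] by (simp add: skip_def)

definition nonblank :: "nat \<Rightarrow> nat list \<Rightarrow> bool" where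
  "nonblank i ss \<longleftrightarrow> ss ! i \<noteq> 0"

text \<open>A move precedes the first test because the head may stand on the blank just past the
  right end of its word. The final position is cell -1.\<close>

definition rewind :: "nat \<Rightarrow> com" where
  "rewind i = Seq (left i) (Loop (nonblank i) (left i))"

lemma wf_rewind [simp]: "wf_com k (rewind i)"
  by (simp add: rewind_def)

lemma exec_rewind:
  assumes i: "i < length cs" and p: "h i = int p" "p \<le> L"
    and nz: "\<And>q. 0 \<le> q \<Longrightarrow> q < int p \<Longrightarrow> (cs ! i) q \<noteq> 0" and z: "(cs ! i) (- 1) = 0"
  shows "exec cs (rewind i) h (h(i := - 1)) (3 * L + 2)"
proof -
  have 1: "exec cs (left i) h (h(i := int p - 1 - int 0)) 1" using p by (intro exec_left) auto
  have 2: "exec cs (Loop (nonblank i) (left i)) (h(i := int p - 1 - int 0)) (h(i := int p - 1 - int p)) (p * (1 + 2) + 1)"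
  proof (rule exec_Loop[where s = "\<lambda>j. h(i := int p - 1 - int j)"])
    fix j assume "j < p"
    then show "nonblank i (symbols cs (h(i := int p - 1 - int j))) \<and>
        exec cs (left i) (h(i := int p - 1 - int j)) (h(i := int p - 1 - int (Suc j))) 1"
      using i nz[of "int p - 1 - int j"]
      by (intro conjI exec_left) (auto simp: nonblank_def fun_eq_iff)
  qed (use i z in \<open>simp add: nonblank_def\<close>)
  have "exec cs (rewind i) h (h(i := int p - 1 - int p)) (3 * L + 2)"
    unfolding rewind_def by (rule exec_mono[OF exec_Seq[OF 1 2]]) (use p in simp)
  then show ?thesis by simp
qed

definition unary :: "nat \<Rightarrow> int \<Rightarrow> nat" where
  "unary n i = (if 0 \<le> i \<and> i < int n then 1 else 0)"

text \<open>Tape 0 is the read-only input. Tape 1 holds a Boolean: its only nonblank cell is cell 0, and the head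
  is there for true, one cell left of it for false. All other tapes are copies of the unary counter
  of length \<open>n\<close>: tapes 2 and 3 are scratch counters, and tape \<open>v + 4\<close> has its head at the value of the
  variable \<open>v\<close>.\<close>

definition contents :: "(int \<Rightarrow> nat) \<Rightarrow> nat \<Rightarrow> nat \<Rightarrow> (int \<Rightarrow> nat) list" where
  "contents inp D n = [inp, unary 1] @ replicate (D + 2) (unary n)"

lemma length_contents [simp]: "length (contents inp D n) = D + 4"
  by (simp add: contents_def)

lemma nth_contents [simp]:
  "contents inp D n ! 0 = inp" "contents inp D n ! Suc 0 = unary 1"
  "2 \<le> i \<Longrightarrow> i < D + 4 \<Longrightarrow> contents inp D n ! i = unary n"
  by (auto simp: contents_def nth_append nth_Cons split: nat.split)

definition count_loop :: "nat \<Rightarrow> com \<Rightarrow> com" where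
  "count_loop w c = Seq (right w) (Seq (Loop (nonblank w) (Seq c (right w))) (rewind w))"

lemma wf_count_loop [simp]: "wf_com k (count_loop w c) \<longleftrightarrow> wf_com k c"
  by (simp add: count_loop_def)

lemma exec_count_loop:
  assumes w: "2 \<le> w" "w < D + 4" and n: "n \<le> L" and g: "\<And>j. g j w = - 1"
    and body: "\<And>j. j < n \<Longrightarrow> exec (contents inp D n) c ((g j)(w := int j)) ((g (Suc j))(w := int j)) T"
  shows "exec (contents inp D n) (count_loop w c) (g 0) (g n) (L * (T + 6) + 4)"
proof -
  let ?cs = "contents inp D n"
  have 1: "exec ?cs (right w) (g 0) ((g 0)(w := int 0)) 1" using g by (intro exec_right) auto
  have 2: "exec ?cs (Loop (nonblank w) (Seq c (right w))) ((g 0)(w := int 0)) ((g n)(w := int n)) (n * (T + 1 + 2) + 1)"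
  proof (rule exec_Loop[where s = "\<lambda>j. (g j)(w := int j)"])
    fix j assume j: "j < n"
    have "nonblank w (symbols ?cs ((g j)(w := int j)))" using w j by (simp add: nonblank_def unary_def)
    moreover have "exec ?cs (right w) ((g (Suc j))(w := int j)) ((g (Suc j))(w := int (Suc j))) 1"
      by (intro exec_right) auto
    ultimately show "nonblank w (symbols ?cs ((g j)(w := int j))) \<and>
        exec ?cs (Seq c (right w)) ((g j)(w := int j)) ((g (Suc j))(w := int (Suc j))) (T + 1)"
      using exec_Seq[OF body[OF j]] by blast
  qed (use w in \<open>simp add: nonblank_def unary_def\<close>)
  have "exec ?cs (rewind w) ((g n)(w := int n)) (((g n)(w := int n))(w := - 1)) (3 * n + 2)"
    by (rule exec_rewind[of _ _ _ n]) (use w in \<open>auto simp: unary_def\<close>)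
  moreover have "((g n)(w := int n))(w := - 1) = g n" using g by (auto simp: fun_eq_iff)
  ultimately have 3: "exec ?cs (rewind w) ((g n)(w := int n)) (g n) (3 * n + 2)" by simp
  have "n * (T + 6) \<le> L * (T + 6)" using n by simp
  then have "1 + (n * (T + 1 + 2) + 1 + (3 * n + 2)) \<le> L * (T + 6) + 4" by (simp add: algebra_simps)
  then show ?thesis
    unfolding count_loop_def using exec_Seq[OF 1 exec_Seq[OF 2 3]] exec_mono by blast
qed

section \<open>Moving the input head by multiples of the number of vertices\<close>

definition advance_n :: com where
  "advance_n = count_loop 3 (right 0)"

lemma exec_advance_n:
  assumes "n \<le> L" "h 3 = - 1"
  shows "exec (contents inp D n) advance_n h (h(0 := h 0 + int n)) (7 * L + 4)"
proof -
  have "exec (contents inp D n) (count_loop 3 (right 0)) (h(0 := h 0 + int 0)) (h(0 := h 0 + int n)) (L * (1 + 6) + 4)"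
    by (rule exec_count_loop[where g = "\<lambda>j. h(0 := h 0 + int j)"])
      (use assms in \<open>auto simp: fun_eq_iff intro!: exec_right\<close>)
  then show ?thesis by (simp add: advance_n_def mult.commute)
qed

definition advance_nn :: com where
  "advance_nn = count_loop 2 advance_n"

lemma exec_advance_nn:
  assumes n: "n \<le> L" and h: "h 2 = - 1" "h 3 = - 1"
  shows "exec (contents inp D n) advance_nn h (h(0 := h 0 + int (n * n))) (L * (7 * L + 10) + 4)"
proof -
  have "exec (contents inp D n) (count_loop 2 advance_n) (h(0 := h 0 + int (0 * n))) (h(0 := h 0 + int (n * n)))
      (L * ((7 * L + 4) + 6) + 4)"
  proof (rule exec_count_loop[where g = "\<lambda>j. h(0 := h 0 + int (j * n))"])
    fix j
    let ?h = "(h(0 := h 0 + int (j * n)))(2 := int j)"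
    have "(h(0 := h 0 + int (Suc j * n)))(2 := int j) = ?h(0 := ?h 0 + int n)"
      by (auto simp: fun_eq_iff algebra_simps)
    then show "exec (contents inp D n) advance_n ?h ((h(0 := h 0 + int (Suc j * n)))(2 := int j)) (7 * L + 4)"
      using exec_advance_n[of n L ?h] n h by simp
  qed (use n h in auto)
  then show ?thesis by (simp add: advance_nn_def add.assoc)
qed

text \<open>Reading a counter moves its head to the left end. Meanwhile the head of tape 2 walks
  right by the same number of steps, and the second loop uses this record to restore both heads. So
  the body may use tape 3 but not tape 2.\<close>

definition repeat_Suc :: "nat \<Rightarrow> com \<Rightarrow> com" where
  "repeat_Suc x c = Seq
     (Loop (nonblank x) (Seq (Move (\<lambda>i. if i = x then Move_Left else if i = 2 then Move_Right else Stay)) c))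
     (Loop (nonblank 2) (Move (\<lambda>i. if i = x then Move_Right else if i = 2 then Move_Left else Stay)))"

lemma wf_repeat_Suc [simp]: "wf_com k (repeat_Suc x c) \<longleftrightarrow> wf_com k c"
  by (simp add: repeat_Suc_def)

lemma exec_repeat_Suc:
  assumes x: "4 \<le> x" "x < D + 4" and h: "h x = int v" "v < n" "h 2 = - 1" "h 3 = - 1" and n: "n \<le> L"
    and body: "\<And>h. h 3 = - 1 \<Longrightarrow> exec (contents inp D n) c h (h(0 := h 0 + int s)) T"
  shows "exec (contents inp D n) (repeat_Suc x c) h (h(0 := h 0 + int (Suc v * s))) (L * (T + 6) + 2)"
proof -
  let ?cs = "contents inp D n"
  define g where "g j = h(x := int v - int j, 2 := - 1 + int j, 0 := h 0 + int (j * s))" for j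
  define b where "b j = h(x := - 1 + int j, 2 := int v - int j, 0 := h 0 + int (Suc v * s))" for j
  have g0: "g 0 = h" using h x by (auto simp: g_def fun_eq_iff)
  have gb: "g (Suc v) = b 0" by (auto simp: g_def b_def fun_eq_iff)
  have bv: "b (Suc v) = h(0 := h 0 + int (Suc v * s))" using h x by (auto simp: b_def fun_eq_iff)
  have 1: "exec ?cs (Loop (nonblank x) (Seq (Move (\<lambda>i. if i = x then Move_Left else if i = 2 then Move_Right else Stay)) c))
      (g 0) (g (Suc v)) (Suc v * (1 + T + 2) + 1)"
  proof (rule exec_Loop)
    fix j assume j: "j < Suc v"
    let ?h = "(g j)(x := int v - int (Suc j), 2 := int j)"
    have "nonblank x (symbols ?cs (g j))" using x h j by (simp add: nonblank_def g_def unary_def)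
    moreover have "(\<lambda>i. g j i + head_shift (if i = x then Move_Left else if i = 2 then Move_Right else Stay)) = ?h"
      using x by (auto simp: g_def fun_eq_iff)
    then have "exec ?cs (Move (\<lambda>i. if i = x then Move_Left else if i = 2 then Move_Right else Stay)) (g j) ?h 1"
      using exec_Move[of ?cs _ "g j"] by metis
    moreover have "?h(0 := ?h 0 + int s) = g (Suc j)"
      using x by (auto simp: g_def fun_eq_iff algebra_simps)
    then have "exec ?cs c ?h (g (Suc j)) T" using body[of ?h] x h by (simp add: g_def)
    ultimately show "nonblank x (symbols ?cs (g j)) \<and> exec ?cs
        (Seq (Move (\<lambda>i. if i = x then Move_Left else if i = 2 then Move_Right else Stay)) c) (g j) (g (Suc j)) (1 + T)"
      using exec_Seq by blast
  qed (use x in \<open>simp add: nonblank_def g_def unary_def\<close>)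
  have 2: "exec ?cs (Loop (nonblank 2) (Move (\<lambda>i. if i = x then Move_Right else if i = 2 then Move_Left else Stay)))
      (b 0) (b (Suc v)) (Suc v * (1 + 2) + 1)"
  proof (rule exec_Loop)
    fix j assume j: "j < Suc v"
    have "nonblank 2 (symbols ?cs (b j))" using x h j by (simp add: nonblank_def b_def unary_def)
    moreover have "(\<lambda>i. b j i + head_shift (if i = x then Move_Right else if i = 2 then Move_Left else Stay)) = b (Suc j)"
      using x by (auto simp: b_def fun_eq_iff)
    then have "exec ?cs (Move (\<lambda>i. if i = x then Move_Right else if i = 2 then Move_Left else Stay)) (b j) (b (Suc j)) 1"
      using exec_Move[of ?cs _ "b j"] by metis
    ultimately show "nonblank 2 (symbols ?cs (b j)) \<and>
        exec ?cs (Move (\<lambda>i. if i = x then Move_Right else if i = 2 then Move_Left else Stay)) (b j) (b (Suc j)) 1"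
      by blast
  qed (use x in \<open>simp add: nonblank_def b_def unary_def\<close>)
  have "Suc v * (T + 6) \<le> L * (T + 6)" using h n by (intro mult_le_mono1) simp
  then have "(Suc v * (1 + T + 2) + 1) + (Suc v * (1 + 2) + 1) \<le> L * (T + 6) + 2" by (simp add: algebra_simps)
  then show ?thesis
    using exec_Seq[OF 1 2[folded gb]] exec_mono unfolding repeat_Suc_def g0 bv by blast
qed

section \<open>First-order formulas and their evaluation\<close>

datatype fm = Edge bool nat nat | Neg fm | Conj fm fm | Ex fm

text \<open>Bound variables are de Bruijn levels: at depth \<open>d\<close> the variables are \<open>0, \<dots>, d - 1\<close>, and
  \<open>Ex\<close> binds variable \<open>d\<close>.\<close>

fun holds :: "nat \<Rightarrow> (bool \<Rightarrow> nat rel) \<Rightarrow> nat \<Rightarrow> fm \<Rightarrow> (nat \<Rightarrow> nat) \<Rightarrow> bool" where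
  "holds n R d (Edge b x y) e \<longleftrightarrow> (e x, e y) \<in> R b"
| "holds n R d (Neg p) e \<longleftrightarrow> \<not> holds n R d p e"
| "holds n R d (Conj p q) e \<longleftrightarrow> holds n R d p e \<and> holds n R d q e"
| "holds n R d (Ex p) e \<longleftrightarrow> (\<exists>v<n. holds n R (Suc d) p (e(d := v)))"

text \<open>\<open>B\<close> names the relations present in the encoding, one graph or two;
  \<open>D\<close> bounds the quantifier depth and thereby the number of variable tapes.\<close>

fun scoped :: "bool set \<Rightarrow> nat \<Rightarrow> nat \<Rightarrow> fm \<Rightarrow> bool" where
  "scoped B D d (Edge b x y) \<longleftrightarrow> b \<in> B \<and> x < d \<and> y < d"
| "scoped B D d (Neg p) \<longleftrightarrow> scoped B D d p"
| "scoped B D d (Conj p q) \<longleftrightarrow> scoped B D d p \<and> scoped B D d q"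
| "scoped B D d (Ex p) \<longleftrightarrow> d < D \<and> scoped B D (Suc d) p"

definition flag :: "bool \<Rightarrow> int" where
  "flag b = (if b then 0 else - 1)"

text \<open>Head moves are relative, so the present value has to be tested before a new one can be
  set.\<close>

definition set_flag :: "bool \<Rightarrow> com" where
  "set_flag b = (if b then Cond (nonblank 1) skip (right 1) else Cond (nonblank 1) (left 1) skip)"

lemma wf_set_flag [simp]: "wf_com k (set_flag b)"
  by (simp add: set_flag_def)

lemma nonblank_flag: "h 1 = flag b \<Longrightarrow> nonblank 1 (symbols (contents inp D n) h) \<longleftrightarrow> b"
  by (simp add: nonblank_def unary_def flag_def)

lemma exec_set_flag:
  assumes "h 1 = flag b'"
  shows "exec (contents inp D n) (set_flag b) h (h(1 := flag b)) 3"
proof -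
  have same: "h(1 := flag b) = h" if "b = b'" using assms that by auto
  have "exec (contents inp D n) (set_flag b) h (h(1 := flag b)) (1 + 2)"
  proof (cases b)
    case True
    have "exec (contents inp D n) (Cond (nonblank 1) skip (right 1)) h (h(1 := flag b)) (1 + 2)"
    proof (rule exec_Cond)
      assume "nonblank 1 (symbols (contents inp D n) h)"
      then show "exec (contents inp D n) skip h (h(1 := flag b)) 1"
        using same nonblank_flag[where h = h and b = b', OF assms] True exec_skip[of 1] by simp
    next
      assume "\<not> nonblank 1 (symbols (contents inp D n) h)"
      then show "exec (contents inp D n) (right 1) h (h(1 := flag b)) 1"
        using nonblank_flag[where h = h and b = b', OF assms] assms True by (intro exec_right) (auto simp: flag_def)
    qed
    then show ?thesis using True by (simp add: set_flag_def)
  next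
    case False
    have "exec (contents inp D n) (Cond (nonblank 1) (left 1) skip) h (h(1 := flag b)) (1 + 2)"
    proof (rule exec_Cond)
      assume "nonblank 1 (symbols (contents inp D n) h)"
      then show "exec (contents inp D n) (left 1) h (h(1 := flag b)) 1"
        using nonblank_flag[where h = h and b = b', OF assms] assms False by (intro exec_left) (auto simp: flag_def)
    next
      assume "\<not> nonblank 1 (symbols (contents inp D n) h)"
      then show "exec (contents inp D n) skip h (h(1 := flag b)) 1"
        using same nonblank_flag[where h = h and b = b', OF assms] False exec_skip[of 1] by simp
    qed
    then show ?thesis using False by (simp add: set_flag_def)
  qed
  then show ?thesis by (rule exec_mono) simp
qed

text \<open>A counter at value \<open>v\<close> is read off in \<open>v + 1\<close> steps, since its head has to fall off the left end. The
  input head, which starts on cell 0, therefore ends on cell \<open>(x + 1) n + (y + 1) = (n + 1) + (x n + y)\<close>,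
  which is where the bit of \<open>(x, y)\<close> lies behind the unary prefix and the separator.\<close>

definition query :: "bool \<Rightarrow> nat \<Rightarrow> nat \<Rightarrow> com" where
  "query b x y = Seq (if b then advance_nn else skip) (Seq (repeat_Suc (x + 4) advance_n)
     (Seq (repeat_Suc (y + 4) (right 0)) (Seq (Cond (\<lambda>ss. ss ! 0 = 2) (set_flag True) (set_flag False))
       (Seq (rewind 0) (right 0)))))"

text \<open>Evaluation overwrites the flag whatever its previous value. \<open>Conj\<close> and
  \<open>Ex\<close> stop as soon as the outcome is known, which then already stands in the flag.
  \<open>Ex\<close> clears the flag first, both to pass its own guard and to answer false on an
  empty range.\<close>

fun compile :: "nat \<Rightarrow> fm \<Rightarrow> com" where
  "compile d (Edge b x y) = query b x y"
| "compile d (Neg p) = Seq (compile d p) (Cond (nonblank 1) (set_flag False) (set_flag True))"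
| "compile d (Conj p q) = Seq (compile d p) (Cond (nonblank 1) (compile d q) skip)"
| "compile d (Ex p) = Seq (set_flag False) (Seq (right (d + 4))
     (Seq (Loop (\<lambda>ss. nonblank (d + 4) ss \<and> \<not> nonblank 1 ss) (Seq (compile (Suc d) p) (right (d + 4))))
       (rewind (d + 4))))"

lemma wf_compile [simp]: "wf_com k (compile d p)"
  by (induction p arbitrary: d) (simp_all add: query_def advance_nn_def advance_n_def)

text \<open>Head positions while evaluating a formula at depth \<open>d\<close>: heads 2 and 3 and those of the unbound
  variables rest one cell left of their counters.\<close>

definition heads :: "(nat \<Rightarrow> nat) \<Rightarrow> bool \<Rightarrow> nat \<Rightarrow> nat \<Rightarrow> int" where
  "heads e b d i = (if i = 0 then 0 else if i = 1 then flag b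
     else if 4 \<le> i \<and> i < d + 4 then int (e (i - 4)) else - 1)"

text \<open>The argument is the input length, which exceeds \<open>n\<close>. Each quantifier costs
  one factor of it, so the degree depends only on the quantifier depth of the fixed formula.\<close>

fun time_poly :: "fm \<Rightarrow> nat poly" where
  "time_poly (Edge b x y) = [:30, 30, 14:]"
| "time_poly (Neg p) = time_poly p + [:5:]"
| "time_poly (Conj p q) = time_poly p + time_poly q + [:3:]"
| "time_poly (Ex p) = [:0, 1:] * (time_poly p + [:6:]) + [:10:]"

text \<open>Isolates what evaluation uses of an encoding, so that single graphs and pairs are
  treated at once. The offset \<open>n * n\<close> skips the first adjacency matrix.\<close>

locale encoded_structure =
  fixes w :: "bool list" and n :: nat and B :: "bool set" and R :: "bool \<Rightarrow> nat rel" and D :: nat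
  assumes prefix: "take (Suc n) w = replicate n True @ [False]"
    and query_bit: "\<And>b x y. b \<in> B \<Longrightarrow> x < n \<Longrightarrow> y < n \<Longrightarrow>
      (if b then n * n else 0) + Suc x * n + Suc y < length w \<and>
      w ! ((if b then n * n else 0) + Suc x * n + Suc y) = ((x, y) \<in> R b)"
begin

abbreviation L :: nat where "L \<equiv> length w"
abbreviation inp :: "int \<Rightarrow> nat" where "inp \<equiv> fst (input_tape w)"
abbreviation cs :: "(int \<Rightarrow> nat) list" where "cs \<equiv> contents inp D n"

lemma n_less: "n < L"
  using arg_cong[OF prefix, of length] by (simp add: min_def split: if_splits)

lemma inp_nth: "i < L \<Longrightarrow> inp (int i) = bit_symbol (w ! i)"
  by (simp add: input_tape_def)

lemma inp_nonzero: "0 \<le> q \<Longrightarrow> q < int L \<Longrightarrow> inp q \<noteq> 0"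
  by (simp add: input_tape_def bit_symbol_def)

lemma inp_left: "inp (- 1) = 0"
  by (simp add: input_tape_def)

lemma exec_query:
  assumes b: "b \<in> B" and xy: "x < d" "y < d" "d \<le> D" and e: "\<And>i. i < d \<Longrightarrow> e i < n"
  shows "exec cs (query b x y) (heads e f d) (heads e ((e x, e y) \<in> R b) d) (14 * L * L + 30 * L + 30)"
proof -
  let ?h = "heads e f d"
  \<comment> \<open>Positions of the input head after the optional skip of a matrix, after the row
    steps and after the column steps.\<close>
  define p0 where "p0 = (if b then n * n else 0)"
  define p1 where "p1 = p0 + Suc (e x) * n"
  define p2 where "p2 = p1 + Suc (e y)"
  have nL: "n \<le> L" using n_less by simp
  have p2: "p2 < L" "w ! p2 = ((e x, e y) \<in> R b)"
    using query_bit[OF b e[OF xy(1)] e[OF xy(2)]] by (auto simp: p2_def p1_def p0_def)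
  have 0: "exec cs (if b then advance_nn else skip) ?h (?h(0 := int p0)) (L * (7 * L + 10) + 4)"
  proof (cases b)
    case True
    then show ?thesis using exec_advance_nn[OF nL, of ?h] by (simp add: heads_def p0_def)
  next
    case False
    have "?h(0 := int p0) = ?h" using False by (auto simp: heads_def p0_def)
    then show ?thesis using False exec_skip by simp
  qed
  have 1: "exec cs (repeat_Suc (x + 4) advance_n) (?h(0 := int p0)) (?h(0 := int p1)) (L * (7 * L + 4 + 6) + 2)"
    using exec_repeat_Suc[of "x + 4" D "?h(0 := int p0)" "e x" n L inp advance_n n "7 * L + 4"]
      xy e nL exec_advance_n by (simp add: heads_def p1_def)
  have 2: "exec cs (repeat_Suc (y + 4) (right 0)) (?h(0 := int p1)) (?h(0 := int p2)) (L * (1 + 6) + 2)"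
    using exec_repeat_Suc[of "y + 4" D "?h(0 := int p1)" "e y" n L inp "right 0" 1 1]
      xy e nL by (simp add: exec_right heads_def p2_def add_ac)
  let ?r = "(e x, e y) \<in> R b"
  have 3: "exec cs (Cond (\<lambda>ss. ss ! 0 = 2) (set_flag True) (set_flag False)) (?h(0 := int p2))
      ((?h(0 := int p2))(1 := flag ?r)) (3 + 2)"
  proof (rule exec_Cond)
    have h1: "(?h(0 := int p2)) 1 = flag f" by (simp add: heads_def)
    have sym: "symbols cs (?h(0 := int p2)) ! 0 = 2 \<longleftrightarrow> ?r"
      using p2 by (simp add: inp_nth bit_symbol_def)
    show "exec cs (set_flag True) (?h(0 := int p2)) ((?h(0 := int p2))(1 := flag ?r)) 3"
      if "symbols cs (?h(0 := int p2)) ! 0 = 2"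
      using exec_set_flag[where h = "?h(0 := int p2)" and b' = f, OF h1, of inp D n True] that sym by simp
    show "exec cs (set_flag False) (?h(0 := int p2)) ((?h(0 := int p2))(1 := flag ?r)) 3"
      if "symbols cs (?h(0 := int p2)) ! 0 \<noteq> 2"
      using exec_set_flag[where h = "?h(0 := int p2)" and b' = f, OF h1, of inp D n False] that sym by simp
  qed
  have 4: "exec cs (rewind 0) ((?h(0 := int p2))(1 := flag ?r)) (((?h(0 := int p2))(1 := flag ?r))(0 := - 1)) (3 * L + 2)"
    by (rule exec_rewind[of _ _ _ p2]) (use p2 inp_nonzero inp_left in auto)
  have 5: "exec cs (right 0) (((?h(0 := int p2))(1 := flag ?r))(0 := - 1)) (heads e ?r d) 1"
    by (rule exec_right) (auto simp: heads_def fun_eq_iff)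
  have "exec cs (query b x y) (heads e f d) (heads e ?r d)
     (L * (7 * L + 10) + 4 + (L * (7 * L + 4 + 6) + 2 + (L * (1 + 6) + 2 + (3 + 2 + (3 * L + 2 + 1)))))"
    unfolding query_def by (intro exec_Seq[OF 0] exec_Seq[OF 1] exec_Seq[OF 2] exec_Seq[OF 3] exec_Seq[OF 4 5])
  then show ?thesis by (rule exec_mono) (simp add: algebra_simps)
qed

lemma exec_compile:
  assumes "scoped B D d p" "d \<le> D" "\<And>i. i < d \<Longrightarrow> e i < n"
  shows "exec cs (compile d p) (heads e f d) (heads e (holds n R d p e) d) (poly (time_poly p) L)"
  using assms
proof (induction p arbitrary: d e f)
  case (Edge b x y)
  then have "exec cs (query b x y) (heads e f d) (heads e ((e x, e y) \<in> R b) d) (14 * L * L + 30 * L + 30)"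
    by (intro exec_query) auto
  then show ?case by (simp add: algebra_simps)
next
  case (Neg p)
  let ?r = "holds n R d p e"
  have upd: "(heads e ?r d)(1 := flag (\<not> ?r)) = heads e (\<not> ?r) d" by (auto simp: heads_def fun_eq_iff)
  have h1: "heads e ?r d 1 = flag ?r" by (simp add: heads_def)
  have "exec cs (Cond (nonblank 1) (set_flag False) (set_flag True)) (heads e ?r d) (heads e (\<not> ?r) d) (3 + 2)"
    by (rule exec_Cond)
      (use exec_set_flag[where h = "heads e ?r d" and b' = ?r, OF h1, of inp D n "\<not> ?r"] nonblank_flag[where h = "heads e ?r d" and b = ?r, OF h1, of inp D n] upd in auto)
  then show ?case using exec_Seq[OF Neg.IH[of d e f]] Neg.prems by simp
next
  case (Conj p q)
  let ?r = "holds n R d p e"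
  have h1: "heads e ?r d 1 = flag ?r" by (simp add: heads_def)
  have "exec cs (Cond (nonblank 1) (compile d q) skip) (heads e ?r d) (heads e (holds n R d (Conj p q) e) d)
      (poly (time_poly q) L + 1 + 2)"
  proof (rule exec_Cond)
    assume "nonblank 1 (symbols cs (heads e ?r d))"
    then have r: ?r using nonblank_flag[where h = "heads e ?r d" and b = ?r, OF h1] by blast
    have "exec cs (compile d q) (heads e True d) (heads e (holds n R d q e) d) (poly (time_poly q) L)"
      using Conj.IH(2)[of d e True] Conj.prems by simp
    then show "exec cs (compile d q) (heads e ?r d) (heads e (holds n R d (Conj p q) e) d) (poly (time_poly q) L + 1)"
      using r by (auto elim: exec_mono)
  next
    assume "\<not> nonblank 1 (symbols cs (heads e ?r d))"
    then have "\<not> ?r" using nonblank_flag[where h = "heads e ?r d" and b = ?r, OF h1] by blast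
    then have "exec cs skip (heads e ?r d) (heads e (holds n R d (Conj p q) e) d) 1"
      using exec_skip by simp
    then show "exec cs skip (heads e ?r d) (heads e (holds n R d (Conj p q) e) d) (poly (time_poly q) L + 1)"
      by (rule exec_mono) simp
  qed
  moreover have "exec cs (compile d p) (heads e f d) (heads e ?r d) (poly (time_poly p) L)"
    using Conj.IH(1)[of d e f] Conj.prems by simp
  ultimately have "exec cs (compile d (Conj p q)) (heads e f d) (heads e (holds n R d (Conj p q) e) d)
      (poly (time_poly p) L + (poly (time_poly q) L + 1 + 2))"
    unfolding compile.simps using exec_Seq by blast
  then show ?case by (rule exec_mono) simp
next
  case (Ex p)
  let ?x = "d + 4"
  let ?T = "poly (time_poly p) L"
  define P where "P v = holds n R (Suc d) p (e(d := v))" for v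
  have dD: "d < D" and sc: "scoped B D (Suc d) p" using Ex.prems by auto
  \<comment> \<open>\<open>N\<close> is the number of loop iterations: one more than the least
    witness, or \<open>n\<close> if there is none.\<close>
  have "\<exists>N\<le>n. (\<forall>v<N. Suc v < N \<longrightarrow> \<not> P v) \<and> (N < n \<longrightarrow> 0 < N \<and> P (N - 1)) \<and>
      ((0 < N \<and> P (N - 1)) \<longleftrightarrow> (\<exists>v<n. P v))"
  proof (cases "\<exists>v<n. P v")
    case True
    define v where "v = (LEAST v. v < n \<and> P v)"
    have v: "v < n \<and> P v" unfolding v_def using True by (rule LeastI_ex)
    have "\<not> P u" if "u < v" for u
      using not_less_Least[of u "\<lambda>v. v < n \<and> P v"] that v unfolding v_def[symmetric] by simp
    then show ?thesis using v by (intro exI[of _ "Suc v"]) auto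
  next
    case False
    then show ?thesis by (intro exI[of _ n]) auto
  qed
  then obtain N where N': "N \<le> n \<and> (\<forall>v<N. Suc v < N \<longrightarrow> \<not> P v) \<and> (N < n \<longrightarrow> 0 < N \<and> P (N - 1)) \<and>
      ((0 < N \<and> P (N - 1)) \<longleftrightarrow> (\<exists>v<n. P v))" ..
  have N: "N \<le> n" "\<And>v. Suc v < N \<Longrightarrow> \<not> P v" "N < n \<Longrightarrow> 0 < N \<and> P (N - 1)"
      "(0 < N \<and> P (N - 1)) \<longleftrightarrow> (\<exists>v<n. P v)"
    using N' by (blast, meson N' Suc_lessD, blast, blast)
  \<comment> \<open>The state before iteration \<open>j\<close>: the flag holds the outcome for
    \<open>j - 1\<close>, and is false before the first iteration.\<close>
  define s where "s j = (heads e (0 < j \<and> P (j - 1)) d)(?x := int j)" for j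
  have 1: "exec cs (set_flag False) (heads e f d) (heads e False d) 3"
  proof -
    have "(heads e f d)(1 := flag False) = heads e False d" by (auto simp: heads_def fun_eq_iff)
    moreover have "heads e f d 1 = flag f" by (simp add: heads_def)
    ultimately show ?thesis using exec_set_flag by metis
  qed
  have 2: "exec cs (right ?x) (heads e False d) (s 0) 1"
    by (rule exec_right) (auto simp: s_def heads_def fun_eq_iff)
  have 3: "exec cs (Loop (\<lambda>ss. nonblank ?x ss \<and> \<not> nonblank 1 ss) (Seq (compile (Suc d) p) (right ?x))) (s 0) (s N)
      (N * (?T + 1 + 2) + 1)"
  proof (rule exec_Loop)
    have flag_s: "nonblank 1 (symbols cs (s j)) \<longleftrightarrow> 0 < j \<and> P (j - 1)" for j
      by (rule nonblank_flag) (simp add: s_def heads_def)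
    have counter_s: "nonblank ?x (symbols cs (s j)) \<longleftrightarrow> j < n" for j
      using dD by (simp add: nonblank_def s_def unary_def)
    show "\<not> (nonblank ?x (symbols cs (s N)) \<and> \<not> nonblank 1 (symbols cs (s N)))"
      using N(3) flag_s counter_s by blast
    fix j assume j: "j < N"
    have guard: "nonblank ?x (symbols cs (s j)) \<and> \<not> nonblank 1 (symbols cs (s j))"
      using N(1) N(2)[of "j - 1"] j flag_s counter_s by auto
    have "exec cs (compile (Suc d) p) (heads (e(d := j)) (0 < j \<and> P (j - 1)) (Suc d))
        (heads (e(d := j)) (P j) (Suc d)) ?T"
      unfolding P_def by (rule Ex.IH[OF sc]) (use dD Ex.prems(3) j N(1) in \<open>auto simp: less_Suc_eq\<close>)
    moreover have "heads (e(d := j)) b (Suc d) = (heads e b d)(?x := int j)" for b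
      by (auto simp: heads_def fun_eq_iff)
    ultimately have "exec cs (compile (Suc d) p) (s j) ((heads e (P j) d)(?x := int j)) ?T"
      by (simp add: s_def)
    moreover have "exec cs (right ?x) ((heads e (P j) d)(?x := int j)) (s (Suc j)) 1"
      by (rule exec_right) (auto simp: s_def fun_eq_iff)
    ultimately show "(nonblank ?x (symbols cs (s j)) \<and> \<not> nonblank 1 (symbols cs (s j))) \<and>
        exec cs (Seq (compile (Suc d) p) (right ?x)) (s j) (s (Suc j)) (?T + 1)"
      using guard exec_Seq by blast
  qed
  have 4: "exec cs (rewind ?x) (s N) ((s N)(?x := - 1)) (3 * N + 2)"
    by (rule exec_rewind[of _ _ _ N]) (use dD N(1) in \<open>auto simp: s_def unary_def\<close>)
  have fin: "(s N)(?x := - 1) = heads e (holds n R d (Ex p) e) d"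
    using N(4) by (auto simp: s_def heads_def fun_eq_iff P_def)
  have "exec cs (compile d (Ex p)) (heads e f d) (heads e (holds n R d (Ex p) e) d)
      (3 + (1 + (N * (?T + 1 + 2) + 1 + (3 * N + 2))))"
    unfolding compile.simps fin[symmetric]
    by (intro exec_Seq[OF 1] exec_Seq[OF 2] exec_Seq[OF 3 4])
  moreover have "N * (?T + 6) \<le> L * (?T + 6)" using N(1) n_less by (intro mult_le_mono1) simp
  then have "3 + (1 + (N * (?T + 1 + 2) + 1 + (3 * N + 2))) \<le> poly (time_poly (Ex p)) L"
    by (simp add: algebra_simps)
  ultimately show ?case by (rule exec_mono)
qed

end

section \<open>Initialisation of the tapes\<close>

definition setup_loop_body :: com where
  "setup_loop_body = Act (\<lambda>ss. map (\<lambda>i. (if 2 \<le> i then 1 else ss ! i, if i = 1 then Stay else Move_Right))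
     [0..<length ss])"

definition counters_left :: com where
  "counters_left = Move (\<lambda>i. if 2 \<le> i then Move_Left else Stay)"

text \<open>Symbol 2 encodes True, so the first loop copies the unary prefix onto all counter tapes
  in lockstep and stops at the separator. The counter heads then return together, so testing tape 2
  alone is enough.\<close>

definition prepare_tapes :: com where
  "prepare_tapes = Seq (Act (\<lambda>ss. map (\<lambda>i. (if i = 1 then 1 else ss ! i, Stay)) [0..<length ss]))
     (Seq (Loop (\<lambda>ss. ss ! 0 = 2) setup_loop_body)
       (Seq (Seq counters_left (Loop (nonblank 2) counters_left)) (Seq (rewind 0) (right 0))))"

lemma wf_prepare_tapes [simp]: "wf_com k prepare_tapes"
proof -
  have "ss ! i < 3" if "set ss \<subseteq> {..<3}" "i < length ss" for ss :: "nat list" and i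
    using that nth_mem by blast
  then show ?thesis by (auto simp: prepare_tapes_def setup_loop_body_def counters_left_def)
qed

text \<open>Serves the phase in which cells are still being written, where \<open>exec_Loop\<close>
  with its fixed contents does not apply.\<close>

lemma runs_Loop:
  assumes "\<And>i. i < N \<Longrightarrow> P (map tape_read (s i)) \<and> runs c (s i) (s (Suc i)) t"
    and "\<not> P (map tape_read (s N))"
  shows "runs (Loop P c) (s 0) (s N) (N * (t + 2) + 1)"
  using assms
proof (induction N arbitrary: s)
  case 0
  then show ?case using runs_Loop_False[of P "s 0" c] by simp
next
  case (Suc N)
  have "runs (Loop P c) (s (Suc 0)) (s (Suc N)) (N * (t + 2) + 1)"
    using Suc.IH[of "\<lambda>i. s (Suc i)"] Suc.prems by auto
  then have "runs (Loop P c) (s 0) (s (Suc N)) (t + 2 + (N * (t + 2) + 1))"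
    using Suc.prems(1)[of 0] runs_Loop_True by blast
  moreover have "t + 2 + (N * (t + 2) + 1) = Suc N * (t + 2) + 1" by simp
  ultimately show ?case by (simp only:)
qed

lemma tm_init_conf:
  "snd (tm_init (machine (D + 4) c) w) =
     conf ([fst (input_tape w), \<lambda>_. 0] @ replicate (D + 2) (\<lambda>_. 0)) (\<lambda>_. 0)"
proof -
  have "conf fs (\<lambda>_. 0) = map (\<lambda>f. (f, 0)) fs" for fs
    by (intro nth_equalityI) (auto simp: conf_def)
  then show ?thesis
    by (simp add: tm_init_def machine_def input_tape_def map_replicate_const eval_nat_numeral)
qed

context encoded_structure
begin

lemma word_prefix: "i < n \<Longrightarrow> w ! i" "\<not> w ! n"
proof -
  have eq: "w ! i = (replicate n True @ [False]) ! i" if "i \<le> n" for i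
    using prefix nth_take[of i "Suc n" w] that by simp
  show "i < n \<Longrightarrow> w ! i" using eq[of i] by (simp add: nth_append)
  show "\<not> w ! n" using eq[of n] by (simp add: nth_append)
qed

lemma runs_prepare_tapes:
  "\<exists>t\<le>9 * L + 10. runs prepare_tapes (snd (tm_init (machine (D + 4) c) w)) (conf cs (heads e True 0)) t"
proof -
  \<comment> \<open>After \<open>j\<close> rounds the counters have length \<open>j\<close>, and
    every head except that of the flag tape stands on cell \<open>j\<close>.\<close>
  define st where "st j = conf (contents inp D j) (\<lambda>i. if i = 1 then 0 else int j)" for j
  let ?g = "\<lambda>ss. map (\<lambda>i. (if i = 1 then 1 else ss ! i, Stay)) [0..<length ss]"
  let ?b = "\<lambda>ss. map (\<lambda>i. (if 2 \<le> i then 1 else ss ! i, if i = 1 then Stay else Move_Right)) [0..<length ss]"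
  define blank where "blank = [inp, \<lambda>_. 0] @ replicate (D + 2) (\<lambda>_. 0)"
  let ?ini = "conf blank (\<lambda>_. 0)"
  have blank: "length blank = D + 4" "blank ! 0 = inp"
    "0 < i \<Longrightarrow> i < D + 4 \<Longrightarrow> blank ! i = (\<lambda>_. 0)" for i
    by (auto simp: blank_def nth_Cons split: nat.split)
  have "map2 tape_act (?g (map tape_read ?ini)) ?ini = st 0"
  proof (rule nth_equalityI)
    fix i assume "i < length (map2 tape_act (?g (map tape_read ?ini)) ?ini)"
    then have i: "i < D + 4" by (simp add: conf_def blank)
    have u: "(\<lambda>_. 0)(0 := Suc 0) = unary (Suc 0)" "unary 0 = (\<lambda>_. 0)" by (auto simp: unary_def fun_eq_iff)
    consider "i = 0" | "i = 1" | "2 \<le> i" by linarith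
    then show "map2 tape_act (?g (map tape_read ?ini)) ?ini ! i = st 0 ! i"
      using i by cases (auto simp: st_def conf_def blank u)
  qed (simp add: st_def conf_def blank)
  then have 1: "runs (Act ?g) ?ini (st 0) 1" using runs_Act[of ?g ?ini] by simp
  have 2: "runs (Loop (\<lambda>ss. ss ! 0 = 2) setup_loop_body) (st 0) (st n) (n * (1 + 2) + 1)"
  proof (rule runs_Loop)
    fix j assume j: "j < n"
    have "map2 tape_act (?b (map tape_read (st j))) (st j) = st (Suc j)"
    proof (rule nth_equalityI)
      fix i assume "i < length (map2 tape_act (?b (map tape_read (st j))) (st j))"
      then have i: "i < D + 4" by (simp add: st_def conf_def)
      have u: "(unary j)(int j := Suc 0) = unary (Suc j)" by (auto simp: unary_def fun_eq_iff)
      consider "i = 0" | "i = 1" | "2 \<le> i" by linarith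
      then show "map2 tape_act (?b (map tape_read (st j))) (st j) ! i = st (Suc j) ! i"
        using i by cases (simp_all add: st_def conf_def u)
    qed (simp add: st_def conf_def)
    then have "runs setup_loop_body (st j) (st (Suc j)) 1"
      using runs_Act[of ?b "st j"] unfolding setup_loop_body_def by simp
    moreover have "map tape_read (st j) ! 0 = 2"
      using j n_less word_prefix by (simp add: st_def read_conf inp_nth bit_symbol_def)
    ultimately show "map tape_read (st j) ! 0 = 2 \<and> runs setup_loop_body (st j) (st (Suc j)) 1" by blast
  qed (use n_less word_prefix in \<open>simp add: st_def read_conf inp_nth bit_symbol_def\<close>)
  define h where "h j i = (if i = 0 then int n else if i = 1 then 0 else int n - 1 - int j)" for i j :: nat
  have move: "exec cs counters_left (\<lambda>i. if i = 1 then 0 else int n) (h 0) 1"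
    "exec cs counters_left (h j) (h (Suc j)) 1" for j
  proof -
    have "(\<lambda>i. (if i = 1 then 0 else int n) + head_shift (if 2 \<le> i then Move_Left else Stay)) = h 0"
      by (auto simp: h_def fun_eq_iff)
    then show "exec cs counters_left (\<lambda>i. if i = 1 then 0 else int n) (h 0) 1"
      using exec_Move[of cs "\<lambda>i. if 2 \<le> i then Move_Left else Stay" "\<lambda>i. if i = 1 then 0 else int n"]
      unfolding counters_left_def by simp
    have "(\<lambda>i. h j i + head_shift (if 2 \<le> i then Move_Left else Stay)) = h (Suc j)"
      by (auto simp: h_def fun_eq_iff)
    then show "exec cs counters_left (h j) (h (Suc j)) 1"
      using exec_Move[of cs "\<lambda>i. if 2 \<le> i then Move_Left else Stay" "h j"]
      unfolding counters_left_def by simp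
  qed
  have 3: "exec cs (Loop (nonblank 2) counters_left) (h 0) (h n) (n * (1 + 2) + 1)"
  proof (rule exec_Loop)
    have h2: "h j 2 = int n - 1 - int j" for j by (simp add: h_def)
    show "nonblank 2 (symbols cs (h j)) \<and> exec cs counters_left (h j) (h (Suc j)) 1" if "j < n" for j
      using move(2) that by (simp add: nonblank_def unary_def h2)
    show "\<not> nonblank 2 (symbols cs (h n))" by (simp add: nonblank_def unary_def h2)
  qed
  have 4: "exec cs (rewind 0) (h n) ((h n)(0 := - 1)) (3 * L + 2)"
    by (rule exec_rewind[of _ _ _ n]) (use n_less inp_nonzero inp_left in \<open>auto simp: h_def\<close>)
  have 5: "exec cs (right 0) ((h n)(0 := - 1)) (heads e True 0) 1"
    by (rule exec_right) (auto simp: h_def heads_def flag_def fun_eq_iff)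
  obtain t where t: "t \<le> 1 + (n * (1 + 2) + 1) + (3 * L + 2 + 1)"
      "runs (Seq (Seq counters_left (Loop (nonblank 2) counters_left)) (Seq (rewind 0) (right 0)))
        (st n) (conf cs (heads e True 0)) t"
    using exec_Seq[OF exec_Seq[OF move(1) 3] exec_Seq[OF 4 5]] unfolding exec_def st_def by blast
  have "runs prepare_tapes ?ini (conf cs (heads e True 0)) (1 + (n * (1 + 2) + 1 + t))"
    unfolding prepare_tapes_def by (intro runs_Seq[OF 1] runs_Seq[OF 2] t(2))
  moreover have "1 + (n * (1 + 2) + 1 + t) \<le> 9 * L + 10" using t(1) n_less by simp
  ultimately show ?thesis unfolding tm_init_conf blank_def by blast
qed

lemma decide_holds:
  assumes p: "scoped B D 0 p" and T: "poly (time_poly p) L + 9 * L + 11 \<le> T"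
  defines "M \<equiv> machine (D + 4) (Seq prepare_tapes (compile 0 p))"
  shows "fst ((tm_step M ^^ T) (tm_init M w)) =
    (if holds n R 0 p e then accept_state M else reject_state M)"
proof -
  let ?c = "Seq prepare_tapes (compile 0 p)"
  let ?r = "holds n R 0 p e"
  obtain t where t: "t \<le> 9 * L + 10"
      "runs prepare_tapes (snd (tm_init M w)) (conf cs (heads e True 0)) t"
    using runs_prepare_tapes unfolding M_def by blast
  have "exec cs (compile 0 p) (heads e True 0) (heads e ?r 0) (poly (time_poly p) L)"
    by (rule exec_compile[OF p]) auto
  then obtain u where u: "u \<le> poly (time_poly p) L"
      "runs (compile 0 p) (conf cs (heads e True 0)) (conf cs (heads e ?r 0)) u"
    unfolding exec_def by blast
  have "runs ?c (snd (tm_init M w)) (conf cs (heads e ?r 0)) (t + u)" by (rule runs_Seq[OF t(2) u(2)])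
  then have "fst ((tm_step M ^^ T) (tm_init M w)) =
      (if tape_read (conf cs (heads e ?r 0) ! 1) \<noteq> 0 then accept_state M else reject_state M)"
    unfolding M_def by (rule machine_run) (use t(1) u(1) T in \<open>auto simp: conf_def\<close>)
  moreover have "tape_read (conf cs (heads e ?r 0) ! 1) \<noteq> 0 \<longleftrightarrow> ?r"
    by (simp add: conf_def heads_def flag_def unary_def)
  ultimately show ?thesis by simp
qed

end

text \<open>The machine depends only on the formula and \<open>D\<close>, while \<open>n\<close> and
  the relations come with the instance. The summand \<open>[:11, 9:]\<close> pays for initialisation
  and verdict.\<close>

lemma first_order_poly_time_decidable:
  assumes p: "scoped B D 0 p"
    and enc: "\<And>x. x \<in> Inst \<Longrightarrow> \<exists>n R. encoded_structure (enc x) n B R \<and> (P x \<longleftrightarrow> holds n R 0 p (\<lambda>_. 0))"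
  shows "poly_time_decidable enc Inst P"
  unfolding poly_time_decidable_def
proof (intro exI conjI ballI)
  let ?M = "machine (D + 4) (Seq prepare_tapes (compile 0 p))"
  show "wf_tm ?M" by (rule wf_tm_machine) simp_all
  fix x assume "x \<in> Inst"
  then obtain n R where s: "encoded_structure (enc x) n B R" and P: "P x \<longleftrightarrow> holds n R 0 p (\<lambda>_. 0)"
    using enc by blast
  show "fst ((tm_step ?M ^^ poly (time_poly p + [:11, 9:]) (length (enc x))) (tm_init ?M (enc x))) =
      (if P x then accept_state ?M else reject_state ?M)"
    unfolding P by (rule encoded_structure.decide_holds[OF s p]) simp
qed

section \<open>Positions of the adjacency bits in the encodings\<close>

lemma concat_map_upt:
  "concat (map (\<lambda>i. map (f i) [0..<n]) [0..<m]) = map (\<lambda>k. f (k div n) (k mod n)) [0..<m * n]"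
proof (induction m)
  case (Suc m)
  have "map (f m) [0..<n] = map (\<lambda>k. f (k div n) (k mod n)) [m * n..<m * n + n]"
    by (intro nth_equalityI) auto
  then show ?case using Suc upt_add_eq_append[of 0 "m * n" n] by (simp add: add.commute)
qed simp

lemma length_adjacency_bits: "length (adjacency_bits n E) = n * n"
  by (simp add: adjacency_bits_def concat_map_upt)

lemma nth_adjacency_bits:
  assumes "x < n" "y < n"
  shows "x * n + y < n * n" "adjacency_bits n E ! (x * n + y) \<longleftrightarrow> (x, y) \<in> E"
proof -
  have "Suc x * n \<le> n * n" using assms by (intro mult_le_mono1) simp
  then show "x * n + y < n * n" using assms by simp
  then show "adjacency_bits n E ! (x * n + y) \<longleftrightarrow> (x, y) \<in> E"
    using assms by (simp add: adjacency_bits_def concat_map_upt)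
qed

lemma encoded_structure_graph: "encoded_structure (encode_graph (n, E)) n {False} (\<lambda>_. E)"
proof
  fix b x y assume b: "b \<in> {False}" and xy: "x < n" "y < n"
  let ?w = "replicate n True @ [False] @ adjacency_bits n E"
  have pos: "Suc x * n + Suc y = length (replicate n True @ [False]) + (x * n + y)" by simp
  have "?w ! (Suc x * n + Suc y) = adjacency_bits n E ! (x * n + y)"
    unfolding pos append_assoc[symmetric] nth_append_length_plus ..
  then show "(if b then n * n else 0) + Suc x * n + Suc y < length (encode_graph (n, E)) \<and>
      encode_graph (n, E) ! ((if b then n * n else 0) + Suc x * n + Suc y) = ((x, y) \<in> E)"
    using b nth_adjacency_bits[OF xy] by (simp add: length_adjacency_bits)
qed simp

lemma encoded_structure_graph_pair:
  "encoded_structure (encode_graph_pair (n, E\<^sub>1, E\<^sub>2)) n UNIV (\<lambda>b. if b then E\<^sub>2 else E\<^sub>1)"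
proof
  fix b x y assume xy: "x < n" "y < n"
  let ?p = "(if b then n * n else 0) + Suc x * n + Suc y"
  let ?w = "replicate n True @ [False] @ adjacency_bits n E\<^sub>1 @ adjacency_bits n E\<^sub>2"
  have "?w ! ?p = ((x, y) \<in> (if b then E\<^sub>2 else E\<^sub>1))"
  proof (cases b)
    case True
    then have pos: "?p = length ((replicate n True @ [False]) @ adjacency_bits n E\<^sub>1) + (x * n + y)"
      by (simp add: length_adjacency_bits)
    have "?w ! ?p = adjacency_bits n E\<^sub>2 ! (x * n + y)"
      unfolding pos append_assoc[symmetric] nth_append_length_plus ..
    then show ?thesis using True nth_adjacency_bits[OF xy] by simp
  next
    case False
    then have pos: "?p = length (replicate n True @ [False]) + (x * n + y)" by simp
    have "?w ! ?p = (adjacency_bits n E\<^sub>1 @ adjacency_bits n E\<^sub>2) ! (x * n + y)"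
      unfolding pos append_assoc[symmetric]
      by (metis append_assoc nth_append_length_plus)
    then show ?thesis
      using False nth_adjacency_bits[OF xy] by (simp add: nth_append length_adjacency_bits)
  qed
  then show "?p < length (encode_graph_pair (n, E\<^sub>1, E\<^sub>2)) \<and>
      encode_graph_pair (n, E\<^sub>1, E\<^sub>2) ! ?p = ((x, y) \<in> (if b then E\<^sub>2 else E\<^sub>1))"
    using nth_adjacency_bits[OF xy] by (simp add: length_adjacency_bits)
qed simp

section \<open>The criteria as first-order formulas\<close>

definition Disj :: "fm \<Rightarrow> fm \<Rightarrow> fm" where "Disj p q = Neg (Conj (Neg p) (Neg q))"
definition Imp :: "fm \<Rightarrow> fm \<Rightarrow> fm" where "Imp p q = Neg (Conj p (Neg q))"
definition Iff :: "fm \<Rightarrow> fm \<Rightarrow> fm" where "Iff p q = Conj (Imp p q) (Imp q p)"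
definition All :: "fm \<Rightarrow> fm" where "All p = Neg (Ex (Neg p))"
definition Adj :: "bool \<Rightarrow> nat \<Rightarrow> nat \<Rightarrow> fm" where "Adj b x y = Disj (Edge b x y) (Edge b y x)"

text \<open>Equality needs no atom of its own: in a reflexive acyclic relation only equal vertices are joined
  in both directions.\<close>

definition Same :: "nat \<Rightarrow> nat \<Rightarrow> fm" where "Same x y = Conj (Edge False x y) (Edge False y x)"

lemma holds_derived [simp]:
  "holds n R d (Disj p q) e \<longleftrightarrow> holds n R d p e \<or> holds n R d q e"
  "holds n R d (Imp p q) e \<longleftrightarrow> (holds n R d p e \<longrightarrow> holds n R d q e)"
  "holds n R d (Iff p q) e \<longleftrightarrow> (holds n R d p e \<longleftrightarrow> holds n R d q e)"
  "holds n R d (All p) e \<longleftrightarrow> (\<forall>v<n. holds n R (Suc d) p (e(d := v)))"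
  "holds n R d (Adj b x y) e \<longleftrightarrow> adjacent (R b) (e x) (e y)"
  "holds n R d (Same x y) e \<longleftrightarrow> (e x, e y) \<in> R False \<and> (e y, e x) \<in> R False"
  by (auto simp: Disj_def Imp_def Iff_def All_def Adj_def Same_def adjacent_def)

lemma scoped_derived [simp]:
  "scoped B D d (Disj p q) \<longleftrightarrow> scoped B D d p \<and> scoped B D d q"
  "scoped B D d (Imp p q) \<longleftrightarrow> scoped B D d p \<and> scoped B D d q"
  "scoped B D d (Iff p q) \<longleftrightarrow> scoped B D d p \<and> scoped B D d q"
  "scoped B D d (All p) \<longleftrightarrow> d < D \<and> scoped B D (Suc d) p"
  "scoped B D d (Adj b x y) \<longleftrightarrow> b \<in> B \<and> x < d \<and> y < d"
  "scoped B D d (Same x y) \<longleftrightarrow> False \<in> B \<and> x < d \<and> y < d"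
  by (auto simp: Disj_def Imp_def Iff_def All_def Adj_def Same_def)

text \<open>The free variables 0 and 1 stand for \<open>i\<close> and \<open>j\<close>. The clauses
  share the levels 2 and 3, so four variable tapes suffice for both criteria.\<close>

definition twin_fm :: fm where
  "twin_fm =
     Conj (All (Iff (Adj False 2 0) (Adj False 2 1)))
    (Conj (All (All (Imp (Conj (Edge False 2 0) (Edge False 0 3)) (Adj False 2 3))))
    (Conj (All (All (Imp (Conj (Edge False 2 0) (Adj False 2 3)) (Adj False 3 0))))
          (All (All (Imp (Conj (Edge False 0 2) (Edge False 2 3)) (Adj False 3 0))))))"

definition equivalence_fm :: fm where
  "equivalence_fm =
     Conj (All (All (Iff (Adj False 0 1) (Adj True 0 1))))
          (All (All (Imp (Conj (Neg (Same 0 1)) (Conj (Edge False 0 1) (Edge True 1 0))) twin_fm)))"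

definition identifiability_fm :: fm where
  "identifiability_fm =
     Neg (Ex (Ex (Conj (Neg (Same 0 1)) (Conj (Edge False 0 1) (Conj twin_fm
       (Conj (All (Imp (Edge False 2 0) (Edge False 2 1)))
             (All (Imp (Conj (Neg (Same 2 0)) (Edge False 0 2)) (Edge False 1 2)))))))))"

lemma scoped_criteria:
  "scoped {False} 4 0 identifiability_fm" "scoped UNIV 4 0 equivalence_fm"
  by (simp_all add: identifiability_fm_def equivalence_fm_def twin_fm_def)

lemma dag_on_both_directions_iff:
  assumes dag: "dag_on n E" and a: "a < n"
  shows "(a, b) \<in> E \<and> (b, a) \<in> E \<longleftrightarrow> a = b"
proof -
  obtain f where f: "ranked {..<n} E f" using dag_on_ranked[OF dag] .
  have "a = b" if "(a, b) \<in> E" "(b, a) \<in> E" using ranked.rank[OF f] that by (metis less_asym)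
  then show ?thesis using dag_onD(3)[OF dag a] by auto
qed

text \<open>Quantifiers of formulas range below \<open>n\<close>, those of the criterion over all
  naturals; the two agree because every edge has both end points below \<open>n\<close>.\<close>

lemma holds_twin_fm:
  assumes dag: "dag_on n (R False)"
  shows "holds n R (Suc (Suc 0)) twin_fm e \<longleftrightarrow> twin_condition (R False) (e 0) (e 1)"
proof -
  have bnd: "a < n" "b < n" if "adjacent (R False) a b" for a b
    using dag_onD[OF dag] that by (auto simp: adjacent_def)
  have edge: "adjacent (R False) a b" if "(a, b) \<in> R False" for a b using that by (simp add: adjacent_def)
  have "holds n R (Suc (Suc 0)) twin_fm e \<longleftrightarrow>
     (\<forall>k<n. adjacent (R False) k (e 0) \<longleftrightarrow> adjacent (R False) k (e 1)) \<and>
     (\<forall>u<n. \<forall>c<n. (u, e 0) \<in> R False \<and> (e 0, c) \<in> R False \<longrightarrow> adjacent (R False) u c) \<and>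
     (\<forall>u<n. \<forall>r<n. (u, e 0) \<in> R False \<and> adjacent (R False) u r \<longrightarrow> adjacent (R False) r (e 0)) \<and>
     (\<forall>c<n. \<forall>r<n. (e 0, c) \<in> R False \<and> (c, r) \<in> R False \<longrightarrow> adjacent (R False) r (e 0))"
    by (simp add: twin_fm_def numeral_2_eq_2 numeral_3_eq_3)
  also have "\<dots> \<longleftrightarrow> twin_condition (R False) (e 0) (e 1)"
    unfolding twin_condition_def using bnd edge by (intro conj_cong) blast+
  finally show ?thesis .
qed

lemma holds_equivalence_fm:
  assumes dag: "dag_on n E\<^sub>1" "dag_on n E\<^sub>2"
  shows "holds n (\<lambda>b. if b then E\<^sub>2 else E\<^sub>1) 0 equivalence_fm e \<longleftrightarrow> equivalence_criterion E\<^sub>1 E\<^sub>2"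
proof -
  let ?R = "\<lambda>b. if b then E\<^sub>2 else E\<^sub>1"
  have "holds n ?R 0 equivalence_fm e \<longleftrightarrow>
      (\<forall>a<n. \<forall>b<n. adjacent E\<^sub>1 a b \<longleftrightarrow> adjacent E\<^sub>2 a b) \<and>
      (\<forall>i<n. \<forall>j<n. i \<noteq> j \<and> (i, j) \<in> E\<^sub>1 \<and> (j, i) \<in> E\<^sub>2 \<longrightarrow> twin_condition E\<^sub>1 i j)"
    using dag_on_both_directions_iff[OF dag(1)] holds_twin_fm[of n ?R] dag(1)
    by (auto simp: equivalence_fm_def)
  also have "\<dots> \<longleftrightarrow> equivalence_criterion E\<^sub>1 E\<^sub>2"
    unfolding equivalence_criterion_def same_skeleton_def
  proof (rule conj_cong)
    have "adjacent E\<^sub>1 a b \<Longrightarrow> a < n \<and> b < n" "adjacent E\<^sub>2 a b \<Longrightarrow> a < n \<and> b < n" for a b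
      using dag_onD[OF dag(1)] dag_onD[OF dag(2)] by (auto simp: adjacent_def)
    then show "(\<forall>a<n. \<forall>b<n. adjacent E\<^sub>1 a b \<longleftrightarrow> adjacent E\<^sub>2 a b) \<longleftrightarrow>
        (\<forall>a b. adjacent E\<^sub>1 a b \<longleftrightarrow> adjacent E\<^sub>2 a b)" by blast
  qed (use dag_onD[OF dag(1)] in blast)
  finally show ?thesis .
qed

lemma holds_identifiability_fm:
  assumes dag: "dag_on n E"
  shows "holds n (\<lambda>_. E) 0 identifiability_fm e \<longleftrightarrow> (\<nexists>i j. reversible E i j)"
proof -
  note same = dag_on_both_directions_iff[OF dag]
  have "holds n (\<lambda>_. E) 0 identifiability_fm e \<longleftrightarrow>
      \<not> (\<exists>i<n. \<exists>j<n. i \<noteq> j \<and> (i, j) \<in> E \<and> twin_condition E i j \<and>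
          (\<forall>k<n. (k, i) \<in> E \<longrightarrow> (k, j) \<in> E) \<and> (\<forall>k<n. k \<noteq> i \<and> (i, k) \<in> E \<longrightarrow> (j, k) \<in> E))"
    using same holds_twin_fm[of n "\<lambda>_. E"] dag
    by (simp add: identifiability_fm_def numeral_2_eq_2 cong: conj_cong)
  also have "\<dots> \<longleftrightarrow> (\<nexists>i j. reversible E i j)"
    unfolding reversible_def using dag_onD(1,2)[OF dag] by blast
  finally show ?thesis .
qed

theorem corollary3p5:
  shows "poly_time_decidable encode_graph
           {(n, E). dag_on n E}
           (\<lambda>(n, E). dag_structurally_identifiable n E) \<and>
         poly_time_decidable encode_graph_pair
           {(n, E\<^sub>1, E\<^sub>2). dag_on n E\<^sub>1 \<and> dag_on n E\<^sub>2}
           (\<lambda>(n, E\<^sub>1, E\<^sub>2). model_equivalent n E\<^sub>1 E\<^sub>2)"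
proof (intro conjI)
  show "poly_time_decidable encode_graph {(n, E). dag_on n E}
      (\<lambda>(n, E). dag_structurally_identifiable n E)"
  proof (rule first_order_poly_time_decidable[OF scoped_criteria(1)])
    fix x :: "nat \<times> nat rel" assume "x \<in> {(n, E). dag_on n E}"
    then obtain n E where x: "x = (n, E)" and dag: "dag_on n E" by blast
    show "\<exists>n R. encoded_structure (encode_graph x) n {False} R \<and>
        ((case x of (n, E) \<Rightarrow> dag_structurally_identifiable n E) \<longleftrightarrow> holds n R 0 identifiability_fm (\<lambda>_. 0))"
      unfolding x prod.case dag_structurally_identifiable_iff[OF dag]
        holds_identifiability_fm[OF dag, of "\<lambda>_. 0", symmetric]
      using encoded_structure_graph[of n E] by blast
  qed
  show "poly_time_decidable encode_graph_pair {(n, E\<^sub>1, E\<^sub>2). dag_on n E\<^sub>1 \<and> dag_on n E\<^sub>2}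
      (\<lambda>(n, E\<^sub>1, E\<^sub>2). model_equivalent n E\<^sub>1 E\<^sub>2)"
  proof (rule first_order_poly_time_decidable[OF scoped_criteria(2)])
    fix x :: "nat \<times> nat rel \<times> nat rel"
    assume "x \<in> {(n, E\<^sub>1, E\<^sub>2). dag_on n E\<^sub>1 \<and> dag_on n E\<^sub>2}"
    then obtain n E\<^sub>1 E\<^sub>2 where x: "x = (n, E\<^sub>1, E\<^sub>2)" and dag: "dag_on n E\<^sub>1" "dag_on n E\<^sub>2" by blast
    show "\<exists>n R. encoded_structure (encode_graph_pair x) n UNIV R \<and>
        ((case x of (n, E\<^sub>1, E\<^sub>2) \<Rightarrow> model_equivalent n E\<^sub>1 E\<^sub>2) \<longleftrightarrow> holds n R 0 equivalence_fm (\<lambda>_. 0))"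
      unfolding x prod.case model_equivalent_iff[OF dag]
        holds_equivalence_fm[OF dag, of "\<lambda>_. 0", symmetric]
      using encoded_structure_graph_pair[of n E\<^sub>1 E\<^sub>2] by blast
  qed
qed

end
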